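(* Let $a,b\in\mathbb{R}\setminus\{0\}$ with $a+b\ne0$ and $c\in\mathbb{R}$. Let $H^8$ be the simply-connected nilpotent Lie group with a basis $e^1,\dots,e^8$ of left-invariant 1-forms satisfying $$de^1=c(e^{24}+e^{25}-e^{34}+e^{35}),\quad de^2=\dots=de^7=0,\quad de^8=a\,e^{23}+b\,e^{45}-(a+b)e^{67},$$ let $\Gamma$ be a lattice of maximal rank in $H^8$, and let $M^8=\Gamma\backslash H^8$ with the (balanced) $Spin(7)$-structure $$\Phi=e^{1238}-e^{1347}+e^{1458}+e^{1678}-e^{1257}-e^{1356}+e^{1246}+e^{4567}+e^{2568}+e^{2367}+e^{2345}+e^{3468}+e^{2478}-e^{3578},$$ $T=*d\Phi$ and $\nabla^+=\nabla^g+\frac12T$. For $\lambda,\mu\in\mathbb{R}$ let $A_{\lambda,\mu}$ be the linear connection on $M^8$ with connection forms $$\sigma^2_3=-\sigma^3_2=\sigma^4_5=-\sigma^5_4=\lambda e^8,\qquad \sigma^6_7=-\sigma^7_6=-2\lambda e^8,$$ $$\sigma^2_4=\sigma^2_5=\sigma^3_5=\sigma^4_3=-\mu e^1,\qquad \sigma^3_4=\sigma^4_2=\sigma^5_2=\sigma^5_3=\mu e^1,$$ the remaining $\sigma^i_j$ being zero. If $(\lambda,\mu)\neq(0,0)$ satisfies $3\lambda^2<a^2+ab+b^2$ and $3\lambda^2-2\mu^2=a^2+ab+b^2-2c^2$, then $$dT=2\pi^2\alpha'\big(p_1(\nabla^+)-p_1(A_{\lambda,\mu})\big),\qquad \alpha'=2(a^2+ab+b^2-3\lambda^2)^{-1}>0.$$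 Therefore $(M^8,\Phi,\nabla^+,A_{\lambda,\mu})$ is a compact solution to the heterotic Killing spinor equations (constant dilaton, flux $H=T$) satisfying the anomaly cancellation condition. If $a=b$, then $(M^8,\Phi,\nabla^+,A_{\lambda,\mu})$ with $(\lambda,\mu)\neq(0,0)$ satisfying $\lambda^2<a^2$ and $3\lambda^2-2\mu^2=3a^2-2c^2$ is a compact supersymmetric solution to the heterotic equations of motion in dimension 8. The Riemannian metric is locally given, with $a=b$, by $$g=\Big(dw+\tfrac cb(\tfrac{x_1}a-y_1)dx_2+c(\tfrac{x_1}a+y_1)dy_2\Big)^2+(\tfrac1adx_1)^2+(dy_1)^2+(\tfrac1bdx_2)^2+(dy_2)^2+(\tfrac{-1}{a+b}dx_3)^2+(dy_3)^2+(x_1dy_1+x_2dy_2+x_3dy_3-dz)^2,$$ where $(w,x_1,y_1,x_2,y_2,x_3,y_3,z)$ are global coordinates on $H^8$.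
   Context: $e^{ij\dots}=e^i\wedge e^j\wedge\cdots$; metric $g=\sum_ie^i\otimes e^i$, orientation $e^{1\cdots8}$, $\nabla^g$ Levi-Civita; $g(\nabla^+_XY,Z)=g(\nabla^g_XY,Z)+\frac12T(X,Y,Z)$. With $\{E_i\}$ the dual frame, connection forms are defined by $\nabla_XE_j=\sigma^i_j(X)E_i$; curvature $\Omega^i_j=d\sigma^i_j+\sigma^i_k\wedge\sigma^k_j$; $p_1(\nabla)=\frac1{8\pi^2}\sum_{i<j}\Omega^i_j\wedge\Omega^i_j$. A $Spin(7)$-structure is balanced if $*d\Phi\wedge\Phi=0$. The heterotic Killing spinor equations (existence of a nonzero real spinor $\epsilon$, the one defining $\Phi$, with $\nabla^+\epsilon=0$, $(d\phi-\frac12H)\cdot\epsilon=0$, $F^A\cdot\epsilon=0$) with constant dilaton amount, in dimension 8, to: $\Phi$ is balanced, $H=T=*d\Phi$, and $A$ is a $Spin(7)$-instanton, i.e. its curvature 2-forms $\beta$ satisfy $*(\beta\wedge\Phi)=-\beta$. Anomaly cancellation: $dT=2\pi^2\alpha'(p_1(\nabla^+)-p_1(A))$, $\alpha'>0$. The heterotic equations of motion (constant dilaton, curvature $R=R^+$ of $\nabla^+$) are, with full summation over repeated orthonormal indices and $R_{ijkl}=g(R(E_i,E_j)E_k,E_l)$ (same index convention for the curvature $F^A$ of $A$: first two indices are form indices), $$Ric^g_{ij}-\tfrac14H_{imn}H_j{}^{mn}-\tfrac{\alpha'}{4}\big[(F^A)_{imab}(F^A)_j{}^{mab}-R_{imnq}R_j{}^{mnq}\big]=0,\quad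 \nabla^g_iH^i{}_{jk}=0,\quad \nabla^+_i(F^A)^i{}_j=0,$$ where $Ric^g$ is the Ricci tensor of $\nabla^g$, the last derivative being $\nabla^+$ on form indices coupled to $A$ on the bundle indices.
   Formalization: The equations of motion are proved with α'/2 in place of α' (α' being the anomaly constant): with full summation over bundle indices and p_1 summed over i<j, the equation with the same α' fails, e.g. a=b=1, c=11/8, λ=1/2, μ=7/8, where the (2,2) component is 4.78125. *)

theory Defs
  imports "HOL-Analysis.Analysis" "HOL-Algebra.Coset" "HOL-Algebra.Generated_Groups"
begin

section \<open>Smooth maps and differential forms\<close>

primrec Ck :: "nat \<Rightarrow> ('a::euclidean_space \<Rightarrow> 'b::real_normed_vector) \<Rightarrow> bool" where
  "Ck 0 f = continuous_on UNIV f"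
| "Ck (Suc k) f = ((\<forall>x. f differentiable (at x)) \<and>
      (\<forall>v. Ck k (\<lambda>x. frechet_derivative f (at x) v)))"

definition smooth :: "('a::euclidean_space \<Rightarrow> 'b::real_normed_vector) \<Rightarrow> bool" where
  "smooth f \<longleftrightarrow> (\<forall>k. Ck k f)"

text \<open>
  A simply connected nilpotent Lie group of dimension 8 is diffeomorphic to 8-dimensional real
  space through its exponential map, so such a group is a smooth group structure on that space.

  A differential form is a point-dependent function of lists of tangent vectors.  A form that is
  homogeneous of degree \<open>k\<close> vanishes on lists whose length is not \<open>k\<close>; this is why the operations
  below do not mention degrees.
\<close>

type_synonym diff_form = "real^8 \<Rightarrow> (real^8) list \<Rightarrow> real"

definition zero_form :: diff_form where
  "zero_form = (\<lambda>x vs. 0)"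

definition smooth_form :: "nat \<Rightarrow> diff_form \<Rightarrow> bool" where
  "smooth_form k \<alpha> \<longleftrightarrow>
     (\<forall>x vs. length vs \<noteq> k \<longrightarrow> \<alpha> x vs = 0) \<and>
     (\<forall>x vs i. length vs = k \<and> i < k \<longrightarrow> linear (\<lambda>v. \<alpha> x (vs[i := v]))) \<and>
     (\<forall>x vs. \<not> distinct vs \<longrightarrow> \<alpha> x vs = 0) \<and>
     (\<forall>vs. smooth (\<lambda>x. \<alpha> x vs))"

definition form_of_fun :: "(real^8 \<Rightarrow> real) \<Rightarrow> diff_form" where
  "form_of_fun f x vs = (if vs = [] then f x else 0)"

text \<open>
  Shuffle form of the wedge product: \<open>S\<close> is the set of positions of the arguments passed to \<open>\<alpha>\<close>.
  For 1-forms this gives \<open>(\<alpha> \<and> \<beta>)(v,w) = \<alpha>(v) \<beta>(w) - \<alpha>(w) \<beta>(v)\<close>.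
\<close>

definition wedge :: "diff_form \<Rightarrow> diff_form \<Rightarrow> diff_form" where
  "wedge \<alpha> \<beta> x vs =
     (\<Sum>S\<in>Pow {..<length vs}.
        (- 1) ^ card {(i, j). i \<in> S \<and> j \<in> {..<length vs} - S \<and> j < i} *
        \<alpha> x (nths vs S) * \<beta> x (nths vs (- S)))"

text \<open>The arguments are constant vector fields, so the bracket terms of the invariant formula vanish.\<close>

definition ext_d :: "diff_form \<Rightarrow> diff_form" where
  "ext_d \<alpha> x vs =
     (\<Sum>i<length vs. (- 1) ^ i *
        frechet_derivative (\<lambda>y. \<alpha> y (take i vs @ drop (Suc i) vs)) (at x) (vs ! i))"

definition pullback :: "(real^8 \<Rightarrow> real^8) \<Rightarrow> diff_form \<Rightarrow> diff_form" where
  "pullback F \<alpha> x vs = \<alpha> (F x) (map (frechet_derivative F (at x)) vs)"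

definition emon :: "(nat \<Rightarrow> diff_form) \<Rightarrow> nat list \<Rightarrow> diff_form" where
  "emon e is = foldr (\<lambda>i. wedge (e i)) is (form_of_fun (\<lambda>x. 1))"

definition ecomb :: "(nat \<Rightarrow> diff_form) \<Rightarrow> (real \<times> nat list) list \<Rightarrow> diff_form" where
  "ecomb e cs x vs = (\<Sum>(r, is)\<leftarrow>cs. r * emon e is x vs)"

section \<open>Lie groups, lattices and quotients\<close>

definition lie_group :: "(real^8) monoid \<Rightarrow> bool" where
  "lie_group G \<longleftrightarrow> group G \<and> carrier G = UNIV \<and>
     smooth (\<lambda>(x, y). x \<otimes>\<^bsub>G\<^esub> y) \<and> smooth (m_inv G)"

primrec lower_central :: "('a, 'b) monoid_scheme \<Rightarrow> nat \<Rightarrow> 'a set" where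
  "lower_central G 0 = carrier G"
| "lower_central G (Suc n) = generate G
     {x \<otimes>\<^bsub>G\<^esub> y \<otimes>\<^bsub>G\<^esub> m_inv G x \<otimes>\<^bsub>G\<^esub> m_inv G y | x y. x \<in> carrier G \<and> y \<in> lower_central G n}"

definition nilpotent_group :: "('a, 'b) monoid_scheme \<Rightarrow> bool" where
  "nilpotent_group G \<longleftrightarrow> group G \<and> (\<exists>n. lower_central G n = {\<one>\<^bsub>G\<^esub>})"

definition invariant_under :: "(real^8) monoid \<Rightarrow> (real^8) set \<Rightarrow> diff_form \<Rightarrow> bool" where
  "invariant_under G S \<alpha> \<longleftrightarrow> (\<forall>h\<in>S. pullback (\<lambda>x. h \<otimes>\<^bsub>G\<^esub> x) \<alpha> = \<alpha>)"

text \<open>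
  Lattice of maximal rank: in a simply connected nilpotent group, a discrete subgroup has maximal
  rank (the dimension of the group) if and only if it is cocompact.
\<close>

definition max_rank_lattice :: "(real^8) monoid \<Rightarrow> (real^8) set \<Rightarrow> bool" where
  "max_rank_lattice G \<Gamma> \<longleftrightarrow> subgroup \<Gamma> G \<and> discrete \<Gamma> \<and>
     (\<exists>K. compact K \<and> carrier G = \<Gamma> <#>\<^bsub>G\<^esub> K)"

text \<open>
  The space of cosets \<open>\<Gamma>h\<close> with the quotient topology.  Since \<open>\<Gamma>\<close> is discrete, the group covers this
  space, and tensor fields and connections on it are the \<open>\<Gamma>\<close>-invariant ones on the group.
\<close>

definition quotient_space :: "(real^8) monoid \<Rightarrow> (real^8) set \<Rightarrow> (real^8) set topology" where
  "quotient_space G \<Gamma> = topology (\<lambda>U. U \<subseteq> rcosets\<^bsub>G\<^esub> \<Gamma> \<and>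
     open {x \<in> carrier G. \<Gamma> #>\<^bsub>G\<^esub> x \<in> U})"

section \<open>Metric, Hodge star and connections in a frame\<close>

text \<open>
  The indices of the coframe \<open>e\<close> and of its dual frame \<open>E\<close> run from 1 to 8.  The metric is the one
  for which \<open>e\<close> is orthonormal, and the orientation is \<open>e 1 \<and> \<dots> \<and> e 8\<close>.
\<close>

definition dual_frame :: "(nat \<Rightarrow> diff_form) \<Rightarrow> (nat \<Rightarrow> real^8 \<Rightarrow> real^8) \<Rightarrow> bool" where
  "dual_frame e E \<longleftrightarrow> (\<forall>i\<in>{1..8}. smooth (E i)) \<and>
     (\<forall>x. \<forall>i\<in>{1..8}. \<forall>j\<in>{1..8}. e i x [E j x] = (if i = j then 1 else 0))"

definition frame_at :: "(nat \<Rightarrow> real^8 \<Rightarrow> real^8) \<Rightarrow> real^8 \<Rightarrow> nat list \<Rightarrow> (real^8) list" where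
  "frame_at E x is = map (\<lambda>i. E i x) is"

definition metric :: "(nat \<Rightarrow> diff_form) \<Rightarrow> real^8 \<Rightarrow> real^8 \<Rightarrow> real^8 \<Rightarrow> real" where
  "metric e x v w = (\<Sum>i=1..8. e i x [v] * e i x [w])"

text \<open>
  On increasing monomials, \<open>*e\<^sup>I\<close> is the contraction of the volume form with \<open>E\<^sub>I\<close>,
  so that \<open>e\<^sup>I \<and> *e\<^sup>I\<close> is the volume form.
\<close>

definition hodge ::
  "(nat \<Rightarrow> diff_form) \<Rightarrow> (nat \<Rightarrow> real^8 \<Rightarrow> real^8) \<Rightarrow> diff_form \<Rightarrow> diff_form" where
  "hodge e E \<alpha> x ws =
     (\<Sum>I | I \<subseteq> {1..8} \<and> card I + length ws = 8.
        \<alpha> x (frame_at E x (sorted_list_of_set I)) *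
        emon e [1,2,3,4,5,6,7,8] x (frame_at E x (sorted_list_of_set I) @ ws))"

text \<open>
  A linear connection is given by its connection forms in the global frame:
  \<open>\<sigma> i j\<close> is the form with \<open>\<nabla>\<^sub>X E\<^sub>j = \<Sum>\<^sub>i \<sigma> i j (X) E\<^sub>i\<close>.
\<close>

type_synonym conn_forms = "nat \<Rightarrow> nat \<Rightarrow> diff_form"

definition cov_deriv :: "(nat \<Rightarrow> diff_form) \<Rightarrow> (nat \<Rightarrow> real^8 \<Rightarrow> real^8) \<Rightarrow> conn_forms \<Rightarrow>
    (real^8 \<Rightarrow> real^8) \<Rightarrow> (real^8 \<Rightarrow> real^8) \<Rightarrow> real^8 \<Rightarrow> real^8" where
  "cov_deriv e E \<sigma> X Y x =
     (\<Sum>i=1..8. (frechet_derivative (\<lambda>y. e i y [Y y]) (at x) (X x) +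
        (\<Sum>j=1..8. \<sigma> i j x [X x] * e j x [Y x])) *\<^sub>R E i x)"

definition lie_bracket :: "(real^8 \<Rightarrow> real^8) \<Rightarrow> (real^8 \<Rightarrow> real^8) \<Rightarrow> real^8 \<Rightarrow> real^8" where
  "lie_bracket X Y x = frechet_derivative Y (at x) (X x) - frechet_derivative X (at x) (Y x)"

definition levi_civita ::
  "(nat \<Rightarrow> diff_form) \<Rightarrow> (nat \<Rightarrow> real^8 \<Rightarrow> real^8) \<Rightarrow> conn_forms \<Rightarrow> bool" where
  "levi_civita e E \<sigma> \<longleftrightarrow>
     (\<forall>i\<in>{1..8}. \<forall>j\<in>{1..8}. smooth_form 1 (\<sigma> i j)) \<and>
     (\<forall>X Y Z x. smooth X \<and> smooth Y \<and> smooth Z \<longrightarrow>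
        frechet_derivative (\<lambda>y. metric e y (Y y) (Z y)) (at x) (X x) =
          metric e x (cov_deriv e E \<sigma> X Y x) (Z x) + metric e x (Y x) (cov_deriv e E \<sigma> X Z x)) \<and>
     (\<forall>X Y x. smooth X \<and> smooth Y \<longrightarrow>
        cov_deriv e E \<sigma> X Y x - cov_deriv e E \<sigma> Y X x = lie_bracket X Y x)"

text \<open>
  The connection \<open>\<nabla> + T/2\<close>: here \<open>\<sigma> i j (v)\<close> is changed to \<open>\<sigma> i j (v) + T(v, E\<^sub>j, E\<^sub>i)/2\<close>.
\<close>

definition add_torsion ::
  "(nat \<Rightarrow> real^8 \<Rightarrow> real^8) \<Rightarrow> conn_forms \<Rightarrow> diff_form \<Rightarrow> conn_forms" where
  "add_torsion E \<sigma> T i j x vs = \<sigma> i j x vs + 1/2 * T x (vs @ [E j x, E i x])"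

definition curvature :: "conn_forms \<Rightarrow> nat \<Rightarrow> nat \<Rightarrow> diff_form" where
  "curvature \<sigma> i j x vs = ext_d (\<sigma> i j) x vs + (\<Sum>k=1..8. wedge (\<sigma> i k) (\<sigma> k j) x vs)"

definition p1 :: "conn_forms \<Rightarrow> diff_form" where
  "p1 \<sigma> x vs = 1 / (8 * pi\<^sup>2) *
     (\<Sum>i=1..8. \<Sum>j\<in>{i<..8}. wedge (curvature \<sigma> i j) (curvature \<sigma> i j) x vs)"

section \<open>The heterotic equations\<close>

definition Phi_form :: "(nat \<Rightarrow> diff_form) \<Rightarrow> diff_form" where
  "Phi_form e = ecomb e
     [(1, [1,2,3,8]), (-1, [1,3,4,7]), (1, [1,4,5,8]), (1, [1,6,7,8]), (-1, [1,2,5,7]),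
      (-1, [1,3,5,6]), (1, [1,2,4,6]), (1, [4,5,6,7]), (1, [2,5,6,8]), (1, [2,3,6,7]),
      (1, [2,3,4,5]), (1, [3,4,6,8]), (1, [2,4,7,8]), (-1, [3,5,7,8])]"

definition A_conn :: "(nat \<Rightarrow> diff_form) \<Rightarrow> real \<Rightarrow> real \<Rightarrow> conn_forms" where
  "A_conn e l m i j x vs =
     (if (i, j) \<in> {(2,3), (4,5)} then l * e 8 x vs
      else if (i, j) \<in> {(3,2), (5,4)} then - l * e 8 x vs
      else if (i, j) = (6,7) then - 2 * l * e 8 x vs
      else if (i, j) = (7,6) then 2 * l * e 8 x vs
      else if (i, j) \<in> {(2,4), (2,5), (3,5), (4,3)} then - m * e 1 x vs
      else if (i, j) \<in> {(3,4), (4,2), (5,2), (5,3)} then m * e 1 x vs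
      else 0)"

definition balanced ::
  "(nat \<Rightarrow> diff_form) \<Rightarrow> (nat \<Rightarrow> real^8 \<Rightarrow> real^8) \<Rightarrow> diff_form \<Rightarrow> bool" where
  "balanced e E \<Phi> \<longleftrightarrow> wedge (hodge e E (ext_d \<Phi>)) \<Phi> = zero_form"

definition spin7_instanton ::
  "(nat \<Rightarrow> diff_form) \<Rightarrow> (nat \<Rightarrow> real^8 \<Rightarrow> real^8) \<Rightarrow> diff_form \<Rightarrow> conn_forms \<Rightarrow> bool" where
  "spin7_instanton e E \<Phi> A \<longleftrightarrow> (\<forall>i\<in>{1..8}. \<forall>j\<in>{1..8}.
     hodge e E (wedge (curvature A i j) \<Phi>) = (\<lambda>x vs. - curvature A i j x vs))"

text \<open>
  The real Clifford algebra of 8-dimensional Euclidean space is the algebra of real 16 by 16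
  matrices, so a representation on 16-dimensional real space is the real spinor module, unique up
  to isomorphism.  Vectors square to minus their norm squared and act by skew matrices.
\<close>

definition clifford_rep :: "(nat \<Rightarrow> real^16^16) \<Rightarrow> bool" where
  "clifford_rep \<gamma> \<longleftrightarrow>
     (\<forall>i\<in>{1..8}. \<forall>j\<in>{1..8}.
        \<gamma> i ** \<gamma> j + \<gamma> j ** \<gamma> i = (if i = j then - 2 else 0) *\<^sub>R mat 1) \<and>
     (\<forall>i\<in>{1..8}. transpose (\<gamma> i) = - \<gamma> i)"

definition gamma_word :: "(nat \<Rightarrow> real^16^16) \<Rightarrow> nat list \<Rightarrow> real^16 \<Rightarrow> real^16" where
  "gamma_word \<gamma> is s = foldr (\<lambda>i. (*v) (\<gamma> i)) is s"

definition clifford_action :: "(nat \<Rightarrow> real^16^16) \<Rightarrow> (nat \<Rightarrow> real^8 \<Rightarrow> real^8) \<Rightarrow>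
    diff_form \<Rightarrow> real^8 \<Rightarrow> real^16 \<Rightarrow> real^16" where
  "clifford_action \<gamma> E \<alpha> x s =
     (\<Sum>I\<in>Pow {1..8}. \<alpha> x (frame_at E x (sorted_list_of_set I)) *\<^sub>R
        gamma_word \<gamma> (sorted_list_of_set I) s)"

text \<open>The spinor bundle is trivialised by the frame \<open>E\<close>.\<close>

definition spin_deriv :: "(nat \<Rightarrow> real^16^16) \<Rightarrow> conn_forms \<Rightarrow> (real^8 \<Rightarrow> real^16) \<Rightarrow>
    real^8 \<Rightarrow> real^8 \<Rightarrow> real^16" where
  "spin_deriv \<gamma> \<sigma> \<epsilon> x v = frechet_derivative \<epsilon> (at x) v +
     (1/4) *\<^sub>R (\<Sum>i=1..8. \<Sum>j=1..8. \<sigma> j i x [v] *\<^sub>R gamma_word \<gamma> [i, j] (\<epsilon> x))"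

text \<open>
  \<open>\<Phi>(X,Y,Z,W) = - \<langle>\<epsilon>, X Y Z W \<epsilon>\<rangle> / |\<epsilon>|\<^sup>2\<close> on orthogonal vectors.  The sign does not depend on
  the sign convention for the Clifford algebra: a given 4-form arises from a spinor with at most
  one of the two signs, and the form \<open>Phi_form\<close> arises with this one.
\<close>

definition spinor_defines ::
  "(nat \<Rightarrow> real^16^16) \<Rightarrow> (nat \<Rightarrow> real^8 \<Rightarrow> real^8) \<Rightarrow> (real^8 \<Rightarrow> real^16) \<Rightarrow> diff_form \<Rightarrow> bool" where
  "spinor_defines \<gamma> E \<epsilon> \<Phi> \<longleftrightarrow>
     (\<forall>x. \<forall>is. length is = 4 \<and> distinct is \<and> set is \<subseteq> {1..8} \<longrightarrow>
        \<Phi> x (frame_at E x is) * (\<epsilon> x \<bullet> \<epsilon> x) = - (\<epsilon> x \<bullet> gamma_word \<gamma> is (\<epsilon> x)))"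

text \<open>
  \<open>\<sigma>\<close> is the Levi-Civita connection, \<open>\<phi>\<close> the dilaton, \<open>H\<close> the flux.  The spinor descends to the
  quotient by \<open>\<Gamma>\<close>, whose spin structure is the one induced by the left-invariant frame.
\<close>

definition killing_spinor_eqs :: "(real^8) monoid \<Rightarrow> (real^8) set \<Rightarrow> (nat \<Rightarrow> real^16^16) \<Rightarrow>
    (nat \<Rightarrow> real^8 \<Rightarrow> real^8) \<Rightarrow> conn_forms \<Rightarrow> diff_form \<Rightarrow> (real^8 \<Rightarrow> real) \<Rightarrow> diff_form \<Rightarrow>
    conn_forms \<Rightarrow> bool" where
  "killing_spinor_eqs G \<Gamma> \<gamma> E \<sigma> \<Phi> \<phi> H A \<longleftrightarrow>
     (\<exists>\<epsilon>. smooth \<epsilon> \<and> (\<forall>x. \<epsilon> x \<noteq> 0) \<and> (\<forall>h\<in>\<Gamma>. \<forall>x. \<epsilon> (h \<otimes>\<^bsub>G\<^esub> x) = \<epsilon> x) \<and>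
        spinor_defines \<gamma> E \<epsilon> \<Phi> \<and>
        (\<forall>x v. spin_deriv \<gamma> (add_torsion E \<sigma> H) \<epsilon> x v = 0) \<and>
        (\<forall>x. clifford_action \<gamma> E
               (\<lambda>y vs. ext_d (form_of_fun \<phi>) y vs - 1/2 * H y vs) x (\<epsilon> x) = 0) \<and>
        (\<forall>x. \<forall>i\<in>{1..8}. \<forall>j\<in>{1..8}. clifford_action \<gamma> E (curvature A i j) x (\<epsilon> x) = 0))"

text \<open>
  A compact solution of the heterotic Killing spinor equations on the quotient by \<open>\<Gamma>\<close>: all data
  descend to the compact quotient, the spinorial equations hold, and so do the conditions on \<open>\<Phi>\<close>,
  \<open>H\<close> and \<open>A\<close> to which they amount in dimension 8 for constant dilaton.
\<close>

definition compact_killing_solution :: "(real^8) monoid \<Rightarrow> (real^8) set \<Rightarrow>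
    (nat \<Rightarrow> real^16^16) \<Rightarrow> (nat \<Rightarrow> diff_form) \<Rightarrow> (nat \<Rightarrow> real^8 \<Rightarrow> real^8) \<Rightarrow> conn_forms \<Rightarrow>
    diff_form \<Rightarrow> real \<Rightarrow> diff_form \<Rightarrow> conn_forms \<Rightarrow> bool" where
  "compact_killing_solution G \<Gamma> \<gamma> e E \<sigma> \<Phi> \<phi>0 H A \<longleftrightarrow>
     compact_space (quotient_space G \<Gamma>) \<and>
     (\<forall>i\<in>{1..8}. invariant_under G \<Gamma> (e i)) \<and>
     invariant_under G \<Gamma> \<Phi> \<and> invariant_under G \<Gamma> H \<and>
     (\<forall>i\<in>{1..8}. \<forall>j\<in>{1..8}. invariant_under G \<Gamma> (add_torsion E \<sigma> H i j) \<and>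
                            invariant_under G \<Gamma> (A i j)) \<and>
     killing_spinor_eqs G \<Gamma> \<gamma> E \<sigma> \<Phi> (\<lambda>x. \<phi>0) H A \<and>
     balanced e E \<Phi> \<and> H = hodge e E (ext_d \<Phi>) \<and> spin7_instanton e E \<Phi> A"

definition anomaly_cancellation ::
  "(nat \<Rightarrow> real^8 \<Rightarrow> real^8) \<Rightarrow> conn_forms \<Rightarrow> diff_form \<Rightarrow> conn_forms \<Rightarrow> real \<Rightarrow> bool" where
  "anomaly_cancellation E \<sigma> T A \<alpha>' \<longleftrightarrow> \<alpha>' > 0 \<and>
     ext_d T = (\<lambda>x vs. 2 * pi\<^sup>2 * \<alpha>' * (p1 (add_torsion E \<sigma> T) x vs - p1 A x vs))"

text \<open>\<open>R\<^sub>i\<^sub>j\<^sub>k\<^sub>l = g(R(E\<^sub>i,E\<^sub>j)E\<^sub>k, E\<^sub>l)\<close>; the curvature form \<open>\<Omega> l k\<close> takes \<open>E\<^sub>k\<close> to its \<open>E\<^sub>l\<close>-component.\<close>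

definition Rm :: "(nat \<Rightarrow> real^8 \<Rightarrow> real^8) \<Rightarrow> conn_forms \<Rightarrow> real^8 \<Rightarrow>
    nat \<Rightarrow> nat \<Rightarrow> nat \<Rightarrow> nat \<Rightarrow> real" where
  "Rm E \<sigma> x i j k l = curvature \<sigma> l k x (frame_at E x [i, j])"

definition Ric :: "(nat \<Rightarrow> real^8 \<Rightarrow> real^8) \<Rightarrow> conn_forms \<Rightarrow> real^8 \<Rightarrow> nat \<Rightarrow> nat \<Rightarrow> real" where
  "Ric E \<sigma> x i j = (\<Sum>m=1..8. Rm E \<sigma> x m i j m)"

text \<open>The covariant derivative of \<open>\<alpha>\<close> along \<open>E k\<close>, evaluated on the frame vectors listed by \<open>is\<close>.\<close>

definition nabla_comp :: "(nat \<Rightarrow> real^8 \<Rightarrow> real^8) \<Rightarrow> conn_forms \<Rightarrow> diff_form \<Rightarrow> real^8 \<Rightarrow>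
    nat \<Rightarrow> nat list \<Rightarrow> real" where
  "nabla_comp E \<sigma> \<alpha> x k is =
     frechet_derivative (\<lambda>y. \<alpha> y (frame_at E y is)) (at x) (E k x) -
     (\<Sum>p<length is. \<Sum>l=1..8. \<sigma> l (is ! p) x [E k x] * \<alpha> x (frame_at E x (is[p := l])))"

text \<open>
  The equations of motion for constant dilaton, with Levi-Civita connection \<open>\<sigma>\<close>, flux \<open>H\<close>, gauge
  connection \<open>A\<close> and curvature \<open>R\<close> of \<open>\<nabla>\<^sup>+\<close>.  The last equation couples \<open>\<nabla>\<^sup>+\<close> on the form indices
  with \<open>A\<close> on the endomorphism indices \<open>s, t\<close>.

  Pitfall: all sums are full sums, including those over pairs of bundle indices, whereas \<open>p1\<close> sums
  over \<open>i < j\<close> only.  The constant of the equations of motion that corresponds to \<open>\<alpha>'\<close> in the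
  anomaly cancellation condition with this \<open>p1\<close> is therefore \<open>\<alpha>' / 2\<close>; equivalently, it
  is \<open>\<alpha>'\<close> when the bundle pairs \<open>(a, b)\<close> and \<open>(n, q)\<close> are summed over \<open>a < b\<close> and \<open>n < q\<close>.
\<close>

definition heterotic_eom :: "(nat \<Rightarrow> real^8 \<Rightarrow> real^8) \<Rightarrow> conn_forms \<Rightarrow> diff_form \<Rightarrow>
    conn_forms \<Rightarrow> real \<Rightarrow> bool" where
  "heterotic_eom E \<sigma> H A \<alpha>' \<longleftrightarrow>
     (\<forall>x. \<forall>i\<in>{1..8}. \<forall>j\<in>{1..8}.
        Ric E \<sigma> x i j
        - 1/4 * (\<Sum>m=1..8. \<Sum>n=1..8. H x (frame_at E x [i, m, n]) * H x (frame_at E x [j, m, n]))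
        - \<alpha>'/4 * ((\<Sum>m=1..8. \<Sum>a=1..8. \<Sum>b=1..8. Rm E A x i m a b * Rm E A x j m a b)
                 - (\<Sum>m=1..8. \<Sum>n=1..8. \<Sum>q=1..8.
                      Rm E (add_torsion E \<sigma> H) x i m n q * Rm E (add_torsion E \<sigma> H) x j m n q))
        = 0) \<and>
     (\<forall>x. \<forall>j\<in>{1..8}. \<forall>k\<in>{1..8}. (\<Sum>i=1..8. nabla_comp E \<sigma> H x i [i, j, k]) = 0) \<and>
     (\<forall>x. \<forall>j\<in>{1..8}. \<forall>s\<in>{1..8}. \<forall>t\<in>{1..8}.
        (\<Sum>i=1..8. nabla_comp E (add_torsion E \<sigma> H) (curvature A s t) x i [i, j] +
           (\<Sum>u=1..8. A s u x [E i x] * curvature A u t x (frame_at E x [i, j])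
                    - curvature A s u x (frame_at E x [i, j]) * A u t x [E i x])) = 0)"

section \<open>Global coordinates\<close>

definition global_coordinates :: "(real^8 \<Rightarrow> real) list \<Rightarrow> bool" where
  "global_coordinates fs \<longleftrightarrow> length fs = 8 \<and>
     (let \<psi> = (\<lambda>p. vector (map (\<lambda>f. f p) fs) :: real^8)
      in bij \<psi> \<and> smooth \<psi> \<and> smooth (inv_into UNIV \<psi>))"

definition dcoord :: "(real^8 \<Rightarrow> real) \<Rightarrow> real^8 \<Rightarrow> real^8 \<Rightarrow> real" where
  "dcoord f p v = frechet_derivative f (at p) v"

text \<open>The symmetric bilinear form \<open>\<theta>\<^sub>1\<^sup>2 + \<theta>\<^sub>2\<^sup>2 + \<dots>\<close> with \<open>\<theta>\<^sup>2 = \<theta> \<otimes> \<theta>\<close>.\<close>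

definition sum_of_squares ::
  "(real^8 \<Rightarrow> real^8 \<Rightarrow> real) list \<Rightarrow> real^8 \<Rightarrow> real^8 \<Rightarrow> real^8 \<Rightarrow> real" where
  "sum_of_squares ths p u v = (\<Sum>\<theta>\<leftarrow>ths. \<theta> p u * \<theta> p v)"

end

theory Submission
  imports Defs
begin

text \<open>
  The Hodge dual \<open>T\<close> of \<open>d\<Phi>\<close> is \<open>e 1 \<and> d e 1 + e 8 \<and> d e 8\<close>, and adding half of it to the Levi-Civita
  connection leaves connection forms of exactly the shape of \<open>A_conn\<close>: a skew matrix times \<open>e 8\<close> plus a
  skew matrix times \<open>e 1\<close>.  For every connection of this shape the first Pontryagin form is a
  combination of \<open>d e 1 \<and> d e 1\<close> and \<open>d e 8 \<and> d e 8\<close>, whose sum is \<open>d T\<close>; the anomaly condition compares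
  the two coefficients.  The 2-forms \<open>d e 1\<close> and \<open>d e 8\<close> lie in \<open>spin(7)\<close>, which gives the instanton
  condition and the vanishing of the Clifford actions on the spinor.

  The words in the Clifford generators that belong to the monomials of \<open>\<Phi>\<close> generate, up to sign, a
  commutative group (the extended Hamming code); the spinor is a joint eigenvector.  A word outside
  the code anticommutes with one of the generators of the group, so its expectation value vanishes.

  The coordinates are primitives of closed 1-forms.  Normalised at the unit they form a homomorphism
  to a polynomial group law on \<open>\<real>\<^sup>8\<close> that is a local diffeomorphism, hence a covering, hence bijective.
\<close>

section \<open>The algebra of forms\<close>

text \<open>Wedge product and exterior derivative are given as sums over positions in argument
  lists, which cannot be expanded by hand on monomials of degree four to six. Induction on the
  argument list avoids this: contraction with the first argument is an antiderivation, so product,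
  derivative and evaluation on the frame obey short recursions, and monomials can be replaced by
  signed words that are compared after sorting. The curvature of a connection of the common shape
  also has a term in \<open>e 1 \<and> e 8\<close>, whose coefficient is the commutator of the two
  matrices, and this 2-form does not lie in \<open>spin(7)\<close>. The commutator vanishes when the
  \<open>e 8\<close> matrix has equal parameters p = q. This always holds for \<open>A_conn\<close>,
  and it holds for the torsion connection when a = b, which is where that restriction in the
  equations of motion comes from. In \<open>p1\<close> the extra term drops out for all p and q,
  because the commutator is orthogonal to both matrices.\<close>

definition contract :: "real^8 \<Rightarrow> diff_form \<Rightarrow> diff_form" where
  "contract v \<alpha> x vs = \<alpha> x (v # vs)"

definition grade_inv :: "diff_form \<Rightarrow> diff_form" where
  "grade_inv \<alpha> x vs = (- 1) ^ length vs * \<alpha> x vs"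

lemma wedge_Nil: "wedge \<alpha> \<beta> x [] = \<alpha> x [] * \<beta> x []"
  by (simp add: wedge_def)

text \<open>Position 0 is the head of the argument list; the two sums collect the shuffles that pass
  the head to the left and to the right factor of a wedge product.\<close>

lemma sum_Pow_Suc:
  fixes f :: "nat set \<Rightarrow> 'a::comm_monoid_add"
  shows "(\<Sum>S\<in>Pow {..<Suc n}. f S) =
    (\<Sum>S\<in>Pow {..<n}. f (insert 0 (Suc ` S))) + (\<Sum>S\<in>Pow {..<n}. f (Suc ` S))"
proof -
  have P: "Pow {..<Suc n} = (\<lambda>S. insert 0 (Suc ` S)) ` Pow {..<n} \<union> (`) Suc ` Pow {..<n}"
    by (simp add: lessThan_Suc_eq_insert_0 Pow_insert image_Pow_surj[symmetric] image_image Un_commute)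
  have inj2: "inj_on ((`) Suc) (Pow {..<n})"
    by (meson inj_Suc inj_image_eq_iff inj_onI)
  have inj1: "inj_on (\<lambda>S. insert 0 (Suc ` S)) (Pow {..<n})"
  proof (rule inj_onI)
    fix S T :: "nat set" assume "insert 0 (Suc ` S) = insert 0 (Suc ` T)"
    then have "Suc ` S = Suc ` T"
      by (metis Diff_insert_absorb image_iff nat.distinct(1))
    then show "S = T" by (simp add: inj_image_eq_iff)
  qed
  have dis: "(\<lambda>S. insert 0 (Suc ` S)) ` Pow {..<n} \<inter> (`) Suc ` Pow {..<n} = {}"
    by auto
  show ?thesis
    unfolding P by (subst sum.union_disjoint) (use dis inj1 inj2 in \<open>auto simp: sum.reindex\<close>)
qed

text \<open>Contraction is an antiderivation: the head goes either to \<alpha>, or to \<beta> after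
  passing every argument of \<alpha>, which costs the sign recorded by \<open>grade_inv\<close>.
  Together with \<open>wedge_Nil\<close> this recursion determines the product and replaces shuffles
  in the later proofs.\<close>

lemma wedge_Cons:
  "wedge \<alpha> \<beta> x (v # vs) = wedge (contract v \<alpha>) \<beta> x vs + wedge (grade_inv \<alpha>) (contract v \<beta>) x vs"
proof -
  let ?n = "length vs"
  define I where "I S n = {(i, j). i \<in> S \<and> j \<in> {..<n} - S \<and> j < i}" for S :: "nat set" and n :: nat
  have c1: "card (I (insert 0 (Suc ` S)) (Suc ?n)) = card (I S ?n)" if "S \<subseteq> {..<?n}" for S
  proof -
    have "I (insert 0 (Suc ` S)) (Suc ?n) = map_prod Suc Suc ` I S ?n"
    proof (intro equalityI subsetI)
      fix p assume p: "p \<in> I (insert 0 (Suc ` S)) (Suc ?n)"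
      then obtain i j where "p = (i, j)" "j < i" "i \<in> insert 0 (Suc ` S)" "j < Suc ?n"
        "j \<notin> insert 0 (Suc ` S)" by (auto simp: I_def)
      moreover then obtain i' where "i = Suc i'" "i' \<in> S" by auto
      moreover from calculation obtain j' where "j = Suc j'" by (cases j) auto
      ultimately have "p = map_prod Suc Suc (i', j')" "(i', j') \<in> I S ?n" by (auto simp: I_def)
      then show "p \<in> map_prod Suc Suc ` I S ?n" by blast
    qed (auto simp: I_def)
    then show ?thesis
      using card_image[OF inj_on_subset[OF prod.inj_map[OF inj_Suc inj_Suc] subset_UNIV]] by metis
  qed
  \<comment> \<open>Position 0 now lies outside the shuffled set and below all its elements, so it
    forms one inversion with each of them.\<close>
  have c2: "card (I (Suc ` S) (Suc ?n)) = card (I S ?n) + card S" if S: "S \<subseteq> {..<?n}" for S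
  proof -
    have fS: "finite S" using S finite_subset by blast
    have "I (Suc ` S) (Suc ?n) = map_prod Suc Suc ` I S ?n \<union> (\<lambda>i. (Suc i, 0)) ` S"
    proof (intro equalityI subsetI)
      fix p assume p: "p \<in> I (Suc ` S) (Suc ?n)"
      then obtain i j where ij: "p = (Suc i, j)" "j < Suc i" "i \<in> S" "j < Suc ?n"
        "j \<notin> Suc ` S" by (auto simp: I_def)
      show "p \<in> map_prod Suc Suc ` I S ?n \<union> (\<lambda>i. (Suc i, 0)) ` S"
      proof (cases j)
        case (Suc j')
        then have "p = map_prod Suc Suc (i, j')" "(i, j') \<in> I S ?n" using ij by (auto simp: I_def)
        then show ?thesis by blast
      qed (use ij in auto)
    qed (auto simp: I_def)
    moreover have "finite (I S ?n)"
      by (rule finite_subset[of _ "S \<times> {..<?n}"]) (use fS in \<open>auto simp: I_def\<close>)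
    ultimately have "card (I (Suc ` S) (Suc ?n)) =
        card (map_prod Suc Suc ` I S ?n) + card ((\<lambda>i. (Suc i, 0::nat)) ` S)"
      using fS by (auto intro!: card_Un_disjoint)
    moreover have "card (map_prod Suc Suc ` I S ?n) = card (I S ?n)"
      by (rule card_image[OF inj_on_subset[OF prod.inj_map[OF inj_Suc inj_Suc] subset_UNIV]])
    moreover have "card ((\<lambda>i. (Suc i, 0::nat)) ` S) = card S"
      by (rule card_image) (simp add: inj_on_def)
    ultimately show ?thesis by simp
  qed
  have n1: "nths (v # vs) (insert 0 (Suc ` S)) = v # nths vs S"
    "nths (v # vs) (- insert 0 (Suc ` S)) = nths vs (- S)"
    "nths (v # vs) (Suc ` S) = nths vs S"
    "nths (v # vs) (- Suc ` S) = v # nths vs (- S)" for S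
    by (auto simp: nths_Cons intro!: arg_cong2[where f = nths])
  have len: "length (nths vs S) = card S" if "S \<subseteq> {..<?n}" for S
    using that by (auto simp: length_nths intro!: arg_cong[where f = card])
  show ?thesis
    unfolding wedge_def I_def[symmetric] length_Cons
    apply (subst sum_Pow_Suc)
    apply (intro arg_cong2[where f = "(+)"] sum.cong refl)
    by (auto simp: c1 c2 n1 len contract_def grade_inv_def power_add)
qed

lemma wedge_cong: "\<alpha> x = \<alpha>' x \<Longrightarrow> \<beta> x = \<beta>' x \<Longrightarrow> wedge \<alpha> \<beta> x = wedge \<alpha>' \<beta>' x"
  by (simp add: wedge_def fun_eq_iff)

lemma wedge_add_left: "wedge (\<lambda>x vs. \<alpha> x vs + \<beta> x vs) \<gamma> x vs = wedge \<alpha> \<gamma> x vs + wedge \<beta> \<gamma> x vs"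
  by (simp add: wedge_def algebra_simps sum.distrib)

lemma wedge_add_right: "wedge \<gamma> (\<lambda>x vs. \<alpha> x vs + \<beta> x vs) x vs = wedge \<gamma> \<alpha> x vs + wedge \<gamma> \<beta> x vs"
  by (simp add: wedge_def algebra_simps sum.distrib)

lemma wedge_scale_left: "wedge (\<lambda>x vs. r * \<alpha> x vs) \<beta> x vs = r * wedge \<alpha> \<beta> x vs"
  by (simp add: wedge_def sum_distrib_left mult_ac)

lemma wedge_scale_right: "wedge \<alpha> (\<lambda>x vs. r * \<beta> x vs) x vs = r * wedge \<alpha> \<beta> x vs"
  by (simp add: wedge_def sum_distrib_left mult_ac)

lemma wedge_zero_left: "(\<And>ys. \<alpha> x ys = 0) \<Longrightarrow> wedge \<alpha> \<beta> x vs = 0"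
  by (simp add: wedge_def)

lemma wedge_zero_right: "(\<And>ys. \<beta> x ys = 0) \<Longrightarrow> wedge \<alpha> \<beta> x vs = 0"
  by (simp add: wedge_def)

lemma contract_wedge:
  "contract v (wedge \<alpha> \<beta>) =
    (\<lambda>x vs. wedge (contract v \<alpha>) \<beta> x vs + wedge (grade_inv \<alpha>) (contract v \<beta>) x vs)"
  by (simp add: fun_eq_iff contract_def[of v "wedge \<alpha> \<beta>"] wedge_Cons)

lemma contract_grade_inv: "contract v (grade_inv \<alpha>) = (\<lambda>x vs. - 1 * grade_inv (contract v \<alpha>) x vs)"
  by (simp add: fun_eq_iff contract_def grade_inv_def)

lemma grade_inv_grade_inv [simp]: "grade_inv (grade_inv \<alpha>) = \<alpha>"
  by (simp add: fun_eq_iff grade_inv_def flip: mult.assoc)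

lemma grade_inv_wedge: "grade_inv (wedge \<alpha> \<beta>) = wedge (grade_inv \<alpha>) (grade_inv \<beta>)"
proof -
  have "grade_inv (wedge \<alpha> \<beta>) x vs = wedge (grade_inv \<alpha>) (grade_inv \<beta>) x vs" for x vs
  proof (induction vs arbitrary: \<alpha> \<beta>)
    case Nil
    then show ?case by (simp add: wedge_Nil grade_inv_def)
  next
    case (Cons v vs)
    have "grade_inv (wedge \<alpha> \<beta>) x (v # vs) = - grade_inv (contract v (wedge \<alpha> \<beta>)) x vs"
      by (simp add: grade_inv_def contract_def)
    also have "\<dots> = - (grade_inv (wedge (contract v \<alpha>) \<beta>) x vs
        + grade_inv (wedge (grade_inv \<alpha>) (contract v \<beta>)) x vs)"
      by (simp add: contract_wedge grade_inv_def algebra_simps)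
    also have "\<dots> = wedge (grade_inv \<alpha>) (grade_inv \<beta>) x (v # vs)"
      unfolding wedge_Cons contract_grade_inv Cons.IH
      by (simp only: wedge_scale_left wedge_scale_right grade_inv_grade_inv)
    finally show ?case .
  qed
  then show ?thesis by blast
qed

text \<open>Both sides obey the same recursion in the argument list, because the grade involution
  distributes over products; hence an induction that generalises all three forms.\<close>

lemma wedge_assoc: "wedge (wedge \<alpha> \<beta>) \<gamma> = wedge \<alpha> (wedge \<beta> \<gamma>)"
proof -
  have "wedge (wedge \<alpha> \<beta>) \<gamma> x vs = wedge \<alpha> (wedge \<beta> \<gamma>) x vs" for x vs
  proof (induction vs arbitrary: \<alpha> \<beta> \<gamma>)
    case Nil
    then show ?case by (simp add: wedge_Nil)
  next
    case (Cons v vs)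
    show ?case
      unfolding wedge_Cons contract_wedge grade_inv_wedge wedge_add_left wedge_add_right Cons.IH
      by simp
  qed
  then show ?thesis by blast
qed

text \<open>Cartan's formula for a constant vector field, whose Lie derivative is the directional derivative.\<close>

lemma ext_d_Nil: "ext_d \<alpha> x [] = 0"
  by (simp add: ext_d_def)

lemma ext_d_Cons:
  "ext_d \<alpha> x (v # vs) = frechet_derivative (\<lambda>y. \<alpha> y vs) (at x) v - ext_d (contract v \<alpha>) x vs"
  by (simp add: ext_d_def contract_def sum.lessThan_Suc_shift sum_negf del: sum.lessThan_Suc)

text \<open>A condition on coefficients at fixed arguments only: the class is closed under
  \<open>contract\<close> and \<open>grade_inv\<close>, as the inductions over argument lists
  require, and it keeps away from the unspecified values of
  \<open>frechet_derivative\<close>.\<close>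

definition diff_coeffs :: "diff_form \<Rightarrow> bool" where
  "diff_coeffs \<alpha> \<longleftrightarrow> (\<forall>vs x. (\<lambda>y. \<alpha> y vs) differentiable (at x))"

lemma diff_coeffsD: "diff_coeffs \<alpha> \<Longrightarrow> (\<lambda>y. \<alpha> y vs) differentiable (at x)"
  by (simp add: diff_coeffs_def)

lemma diff_coeffs_contract: "diff_coeffs \<alpha> \<Longrightarrow> diff_coeffs (contract v \<alpha>)"
  by (simp add: diff_coeffs_def contract_def)

lemma diff_coeffs_scale: "diff_coeffs \<alpha> \<Longrightarrow> diff_coeffs (\<lambda>x vs. r * \<alpha> x vs)"
  by (simp add: diff_coeffs_def)

lemma diff_coeffs_add: "diff_coeffs \<alpha> \<Longrightarrow> diff_coeffs \<beta> \<Longrightarrow> diff_coeffs (\<lambda>x vs. \<alpha> x vs + \<beta> x vs)"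
  by (simp add: diff_coeffs_def)

lemma diff_coeffs_grade_inv: "diff_coeffs \<alpha> \<Longrightarrow> diff_coeffs (grade_inv \<alpha>)"
  by (simp add: diff_coeffs_def grade_inv_def)

lemma diff_coeffs_wedge: "diff_coeffs \<alpha> \<Longrightarrow> diff_coeffs \<beta> \<Longrightarrow> diff_coeffs (wedge \<alpha> \<beta>)"
  unfolding diff_coeffs_def wedge_def by (intro allI differentiable_sum differentiable_mult) auto

lemma frechet_derivativeI: "(f has_derivative f') (at x) \<Longrightarrow> frechet_derivative f (at x) v = f' v"
  using frechet_derivative_at by metis

lemma frechet_derivative_scale:
  fixes f :: "'a::real_normed_vector \<Rightarrow> real"
  assumes "f differentiable (at x)"
  shows "frechet_derivative (\<lambda>y. r * f y) (at x) v = r * frechet_derivative f (at x) v"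
proof -
  have "((\<lambda>y. r * f y) has_derivative (\<lambda>v. r * frechet_derivative f (at x) v)) (at x)"
    using assms frechet_derivative_works by (intro has_derivative_mult_right) blast
  from frechet_derivativeI[OF this] show ?thesis .
qed

lemma frechet_derivative_add:
  fixes f g :: "'a::real_normed_vector \<Rightarrow> real"
  assumes "f differentiable (at x)" "g differentiable (at x)"
  shows "frechet_derivative (\<lambda>y. f y + g y) (at x) v =
    frechet_derivative f (at x) v + frechet_derivative g (at x) v"
proof -
  have "((\<lambda>y. f y + g y) has_derivative
      (\<lambda>v. frechet_derivative f (at x) v + frechet_derivative g (at x) v)) (at x)"
    using assms frechet_derivative_works by (intro has_derivative_add) blast+
  from frechet_derivativeI[OF this] show ?thesis .
qed

lemma ext_d_scale: "diff_coeffs \<alpha> \<Longrightarrow> ext_d (\<lambda>x vs. r * \<alpha> x vs) x vs = r * ext_d \<alpha> x vs"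
  by (simp add: ext_d_def frechet_derivative_scale diff_coeffsD sum_distrib_left mult_ac)

lemma ext_d_add: "diff_coeffs \<alpha> \<Longrightarrow> diff_coeffs \<beta> \<Longrightarrow>
   ext_d (\<lambda>x vs. \<alpha> x vs + \<beta> x vs) x vs = ext_d \<alpha> x vs + ext_d \<beta> x vs"
  by (simp add: ext_d_def frechet_derivative_add diff_coeffsD sum.distrib algebra_simps)

lemma ext_d_const: "(\<And>x y vs. \<alpha> x vs = \<alpha> y vs) \<Longrightarrow> ext_d \<alpha> x vs = 0"
proof -
  assume a: "\<And>x y vs. \<alpha> x vs = \<alpha> y vs"
  have "frechet_derivative (\<lambda>y. \<alpha> y vs) (at x) v = 0" for vs v
  proof -
    have "(\<lambda>y. \<alpha> y vs) = (\<lambda>y. \<alpha> 0 vs)" using a by blast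
    then show ?thesis by simp
  qed
  then show ?thesis by (simp add: ext_d_def)
qed

text \<open>\<open>ext_d\<close> evaluates its form on lists one shorter than its own, so the two
  powers of -1 differ by one factor.\<close>

lemma ext_d_grade_inv: "diff_coeffs \<alpha> \<Longrightarrow> ext_d (grade_inv \<alpha>) = (\<lambda>x vs. - 1 * grade_inv (ext_d \<alpha>) x vs)"
proof (intro ext)
  fix x :: "real^8" and vs :: "(real^8) list" assume d: "diff_coeffs \<alpha>"
  have "frechet_derivative (\<lambda>y. grade_inv \<alpha> y (take i vs @ drop (Suc i) vs)) (at x) v =
      - ((- 1) ^ length vs * frechet_derivative (\<lambda>y. \<alpha> y (take i vs @ drop (Suc i) vs)) (at x) v)"
    if "i < length vs" for i v
  proof -
    let ?us = "take i vs @ drop (Suc i) vs"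
    have "length vs = Suc (length ?us)" using that by simp
    then have "(- 1 :: real) ^ length ?us = - ((- 1) ^ length vs)" by (simp only: power_Suc)
    then show ?thesis
      unfolding grade_inv_def frechet_derivative_scale[OF diff_coeffsD[OF d]] by simp
  qed
  then show "ext_d (grade_inv \<alpha>) x vs = - 1 * grade_inv (ext_d \<alpha>) x vs"
    by (simp add: ext_d_def grade_inv_def[of "ext_d \<alpha>"] sum_distrib_left sum_negf[symmetric] mult_ac)
qed

text \<open>The Lie derivative along the constant field v, the even derivation in Cartan's
  formula.\<close>

definition dir_deriv :: "real^8 \<Rightarrow> diff_form \<Rightarrow> diff_form" where
  "dir_deriv v \<alpha> x vs = frechet_derivative (\<lambda>y. \<alpha> y vs) (at x) v"

lemma dir_deriv_wedge:
  assumes "diff_coeffs \<alpha>" "diff_coeffs \<beta>"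
  shows "dir_deriv v (wedge \<alpha> \<beta>) x vs = wedge (dir_deriv v \<alpha>) \<beta> x vs + wedge \<alpha> (dir_deriv v \<beta>) x vs"
proof -
  have "((\<lambda>y. wedge \<alpha> \<beta> y vs) has_derivative
     (\<lambda>v. wedge (dir_deriv v \<alpha>) \<beta> x vs + wedge \<alpha> (dir_deriv v \<beta>) x vs)) (at x)"
    unfolding wedge_def sum.distrib[symmetric]
  proof (rule has_derivative_sum)
    fix S
    let ?s = "(- 1 :: real) ^ card {(i, j). i \<in> S \<and> j \<in> {..<length vs} - S \<and> j < i}"
    have A: "((\<lambda>y. \<alpha> y (nths vs S)) has_derivative (\<lambda>v. dir_deriv v \<alpha> x (nths vs S))) (at x)"
      using assms(1) unfolding dir_deriv_def diff_coeffs_def frechet_derivative_works by blast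
    have B: "((\<lambda>y. \<beta> y (nths vs (- S))) has_derivative (\<lambda>v. dir_deriv v \<beta> x (nths vs (- S)))) (at x)"
      using assms(2) unfolding dir_deriv_def diff_coeffs_def frechet_derivative_works by blast
    show "((\<lambda>x. ?s * \<alpha> x (nths vs S) * \<beta> x (nths vs (- S))) has_derivative
      (\<lambda>v. ?s * dir_deriv v \<alpha> x (nths vs S) * \<beta> x (nths vs (- S)) +
           ?s * \<alpha> x (nths vs S) * dir_deriv v \<beta> x (nths vs (- S)))) (at x)"
      by (rule derivative_eq_intros A B refl | simp add: algebra_simps fun_eq_iff)+
  qed
  from frechet_derivativeI[OF this] show ?thesis
    by (simp only: dir_deriv_def[of v "wedge \<alpha> \<beta>"])
qed

lemma contract_ext_d:
  "contract v (ext_d \<alpha>) = (\<lambda>x vs. dir_deriv v \<alpha> x vs + - 1 * ext_d (contract v \<alpha>) x vs)"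
  by (simp add: fun_eq_iff contract_def[of v "ext_d \<alpha>"] ext_d_Cons dir_deriv_def)

text \<open>Contracting by Cartan's formula leaves the ordinary product rule of
  \<open>dir_deriv\<close> and derivatives of products with one argument fewer, to which the
  induction hypothesis applies with contracted factors.\<close>

theorem ext_d_wedge:
  assumes "diff_coeffs \<alpha>" "diff_coeffs \<beta>"
  shows "ext_d (wedge \<alpha> \<beta>) x vs = wedge (ext_d \<alpha>) \<beta> x vs + wedge (grade_inv \<alpha>) (ext_d \<beta>) x vs"
  using assms
proof (induction vs arbitrary: \<alpha> \<beta>)
  case Nil
  then show ?case by (simp add: wedge_Nil ext_d_Nil)
next
  case (Cons v vs)
  note d = Cons.prems diff_coeffs_contract diff_coeffs_grade_inv diff_coeffs_wedge
  have "ext_d (wedge \<alpha> \<beta>) x (v # vs) = dir_deriv v (wedge \<alpha> \<beta>) x vs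
      - ext_d (\<lambda>x vs. wedge (contract v \<alpha>) \<beta> x vs + wedge (grade_inv \<alpha>) (contract v \<beta>) x vs) x vs"
    by (simp only: ext_d_Cons dir_deriv_def contract_wedge)
  also have "\<dots> = (wedge (dir_deriv v \<alpha>) \<beta> x vs + wedge \<alpha> (dir_deriv v \<beta>) x vs) -
     (wedge (ext_d (contract v \<alpha>)) \<beta> x vs + wedge (grade_inv (contract v \<alpha>)) (ext_d \<beta>) x vs
      + (wedge (ext_d (grade_inv \<alpha>)) (contract v \<beta>) x vs + wedge \<alpha> (ext_d (contract v \<beta>)) x vs))"
    by (simp add: ext_d_add dir_deriv_wedge Cons.IH d)
  also have "\<dots> = wedge (ext_d \<alpha>) \<beta> x (v # vs) + wedge (grade_inv \<alpha>) (ext_d \<beta>) x (v # vs)"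
    unfolding wedge_Cons contract_ext_d contract_grade_inv ext_d_grade_inv[OF Cons.prems(1)]
      wedge_add_left wedge_add_right wedge_scale_left wedge_scale_right grade_inv_grade_inv
    by simp
  finally show ?case .
qed

lemma pullback_wedge: "pullback F (wedge \<alpha> \<beta>) = wedge (pullback F \<alpha>) (pullback F \<beta>)"
  by (simp add: fun_eq_iff pullback_def wedge_def nths_map)

section \<open>Monomials in a coframe\<close>

definition one_form :: "diff_form \<Rightarrow> bool" where
  "one_form \<alpha> \<longleftrightarrow> (\<forall>x vs. length vs \<noteq> 1 \<longrightarrow> \<alpha> x vs = 0)"

lemma one_formD: "one_form \<alpha> \<Longrightarrow> length vs \<noteq> 1 \<Longrightarrow> \<alpha> x vs = 0"
  by (simp add: one_form_def)

lemma grade_inv_one_form: "one_form \<alpha> \<Longrightarrow> grade_inv \<alpha> = (\<lambda>x vs. - 1 * \<alpha> x vs)"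
proof (intro ext)
  fix x :: "real^8" and vs :: "(real^8) list"
  assume "one_form \<alpha>"
  then show "grade_inv \<alpha> x vs = - 1 * \<alpha> x vs"
    by (cases "length vs = 1") (auto simp: grade_inv_def one_formD)
qed

lemma wedge_scalar: "(\<And>ys. ys \<noteq> [] \<Longrightarrow> \<alpha> x ys = 0) \<Longrightarrow> wedge \<alpha> \<beta> x vs = \<alpha> x [] * \<beta> x vs"
proof (induction vs arbitrary: \<alpha> \<beta>)
  case Nil
  then show ?case by (simp add: wedge_Nil)
next
  case (Cons v vs)
  have "wedge (contract v \<alpha>) \<beta> x vs = 0"
    using Cons.prems by (intro wedge_zero_left) (simp add: contract_def)
  moreover have "wedge (grade_inv \<alpha>) (contract v \<beta>) x vs = \<alpha> x [] * \<beta> x (v # vs)"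
    using Cons.prems by (subst Cons.IH) (auto simp: contract_def grade_inv_def)
  ultimately show ?case by (simp add: wedge_Cons)
qed

lemma wedge_one_form_Cons:
  assumes "one_form \<alpha>"
  shows "wedge \<alpha> \<beta> x (v # vs) = \<alpha> x [v] * \<beta> x vs - wedge \<alpha> (contract v \<beta>) x vs"
proof -
  have "wedge (contract v \<alpha>) \<beta> x vs = \<alpha> x [v] * \<beta> x vs"
    using one_formD[OF assms] by (subst wedge_scalar) (auto simp: contract_def)
  then show ?thesis
    by (simp only: wedge_Cons grade_inv_one_form[OF assms] wedge_scale_left)
qed

lemma wedge_one_form_Nil: "one_form \<alpha> \<Longrightarrow> wedge \<alpha> \<beta> x [] = 0"
  by (simp add: wedge_Nil one_formD)

lemma contract_wedge_one_form:
  assumes "one_form \<alpha>"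
  shows "contract v (wedge \<alpha> \<beta>) =
    (\<lambda>x vs. \<alpha> x [v] * \<beta> x vs + - 1 * wedge \<alpha> (contract v \<beta>) x vs)"
  by (simp add: fun_eq_iff contract_def[of v "wedge \<alpha> \<beta>"] wedge_one_form_Cons[OF assms])

lemma wedge_pointwise_scale_right: "wedge \<alpha> (\<lambda>x vs. f x * \<beta> x vs) x vs = f x * wedge \<alpha> \<beta> x vs"
  by (simp add: wedge_def sum_distrib_left mult_ac)

text \<open>The third factor is present because monomials are right-nested products: in this form
  the rule swaps the first two letters of any word.\<close>

lemma wedge_one_forms_swap:
  assumes "one_form \<alpha>" "one_form \<beta>"
  shows "wedge \<alpha> (wedge \<beta> \<gamma>) x vs = - wedge \<beta> (wedge \<alpha> \<gamma>) x vs"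
proof (induction vs arbitrary: \<gamma>)
  case Nil
  then show ?case by (simp add: wedge_one_form_Nil assms)
next
  case (Cons v vs)
  show ?case
    unfolding wedge_one_form_Cons[OF assms(1)] wedge_one_form_Cons[OF assms(2)]
      contract_wedge_one_form[OF assms(1)] contract_wedge_one_form[OF assms(2)]
      wedge_add_right wedge_scale_right wedge_pointwise_scale_right Cons.IH[of "contract v \<gamma>"]
    by simp
qed

lemma emon_Nil: "emon e [] x vs = (if vs = [] then 1 else 0)"
  by (simp add: emon_def form_of_fun_def)

lemma emon_Cons: "emon e (i # is) = wedge (e i) (emon e is)"
  by (simp add: emon_def)

lemma emon_append: "emon e (is @ js) = wedge (emon e is) (emon e js)"
proof (induction "is")
  case Nil
  have "wedge (emon e []) (emon e js) x vs = emon e js x vs" for x vs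
    by (subst wedge_scalar) (auto simp: emon_Nil)
  then show ?case by (simp add: fun_eq_iff)
qed (simp add: emon_Cons wedge_assoc)

lemma ecomb_Nil: "ecomb e [] x vs = 0"
  by (simp add: ecomb_def)

lemma ecomb_Cons: "ecomb e ((r, is) # cs) x vs = r * emon e is x vs + ecomb e cs x vs"
  by (simp add: ecomb_def)

lemma ecomb_append: "ecomb e (cs @ ds) x vs = ecomb e cs x vs + ecomb e ds x vs"
  by (simp add: ecomb_def)

lemma ecomb_zero: "ecomb e [] = (\<lambda>x vs. 0)"
  by (simp add: fun_eq_iff ecomb_Nil)

lemma ecomb_split:
  "ecomb e ((r, is) # cs) = (\<lambda>x vs. r * emon e is x vs + ecomb e cs x vs)"
  by (simp add: fun_eq_iff ecomb_Cons)

section \<open>Signed words as a formal exterior algebra\<close>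

definition scale_comb :: "real \<Rightarrow> (real \<times> nat list) list \<Rightarrow> (real \<times> nat list) list" where
  "scale_comb r cs = map (\<lambda>(s, is). (r * s, is)) cs"

definition cons_comb :: "nat \<Rightarrow> (real \<times> nat list) list \<Rightarrow> (real \<times> nat list) list" where
  "cons_comb i cs = map (\<lambda>(s, is). (s, i # is)) cs"

definition append_comb :: "(real \<times> nat list) list \<Rightarrow> nat list \<Rightarrow> (real \<times> nat list) list" where
  "append_comb cs js = map (\<lambda>(s, is). (s, is @ js)) cs"

text \<open>The linear extension of a map on words. Products, sorting and exterior derivatives of
  combinations are all instances of it.\<close>

primrec bind_comb ::
  "(real \<times> nat list) list \<Rightarrow> (nat list \<Rightarrow> (real \<times> nat list) list) \<Rightarrow> (real \<times> nat list) list" where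
  "bind_comb [] f = []"
| "bind_comb (c # cs) f = scale_comb (fst c) (f (snd c)) @ bind_comb cs f"

lemma words_scale_comb: "snd ` set (scale_comb r cs) = snd ` set cs"
  by (force simp: scale_comb_def)

lemma words_cons_comb: "snd ` set (cons_comb i cs) = (#) i ` snd ` set cs"
  by (force simp: cons_comb_def)

lemma words_bind_comb: "snd ` set (bind_comb cs f) = (\<Union>l\<in>snd ` set cs. snd ` set (f l))"
  by (induction cs) (auto simp: image_Un words_scale_comb)

lemma ecomb_scale: "ecomb e (scale_comb r cs) x vs = r * ecomb e cs x vs"
  by (induction cs) (auto simp: scale_comb_def ecomb_Nil ecomb_Cons algebra_simps)

lemma ecomb_bind: "ecomb e (bind_comb cs f) x vs = (\<Sum>(r, is)\<leftarrow>cs. r * ecomb e (f is) x vs)"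
  by (induction cs) (auto simp: ecomb_Nil ecomb_append ecomb_scale)

lemma ecomb_cons_comb: "ecomb e (cons_comb i cs) = wedge (e i) (ecomb e cs)"
proof (induction cs)
  case Nil
  then show ?case by (simp add: cons_comb_def ecomb_zero fun_eq_iff wedge_zero_right)
next
  case (Cons c cs)
  then show ?case
    by (cases c) (simp add: cons_comb_def ecomb_split emon_Cons fun_eq_iff wedge_add_right wedge_scale_right)
qed

lemma ecomb_append_comb: "ecomb e (append_comb cs js) = wedge (ecomb e cs) (emon e js)"
proof (induction cs)
  case Nil
  then show ?case by (simp add: append_comb_def ecomb_zero fun_eq_iff wedge_zero_left)
next
  case (Cons c cs)
  then show ?case
    by (cases c) (simp add: append_comb_def ecomb_split emon_append fun_eq_iff wedge_add_left wedge_scale_left)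
qed

lemma wedge_ecomb: "wedge (ecomb e cs) (ecomb e ds) = ecomb e (bind_comb ds (append_comb cs))"
proof (induction ds)
  case Nil
  then show ?case by (simp add: ecomb_zero fun_eq_iff wedge_zero_right)
next
  case (Cons c ds)
  obtain r js where c: "c = (r, js)" by fastforce
  show ?case
    by (simp add: c ecomb_split ecomb_append ecomb_scale ecomb_append_comb Cons.IH[symmetric]
      fun_eq_iff wedge_add_right wedge_scale_right)
qed

text \<open>Each letter passed costs a sign, and a letter met twice gives the empty combination
  because \<open>e i \<and> e i = 0\<close>. Sorting words this way is what allows two combinations
  to be compared coefficient by coefficient.\<close>

fun signed_insert :: "nat \<Rightarrow> nat list \<Rightarrow> (real \<times> nat list) list" where
  "signed_insert i [] = [(1, [i])]"
| "signed_insert i (j # js) =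
    (if i < j then [(1, i # j # js)] else if i = j then []
     else scale_comb (- 1) (cons_comb j (signed_insert i js)))"

primrec signed_sort :: "nat list \<Rightarrow> (real \<times> nat list) list" where
  "signed_sort [] = [(1, [])]"
| "signed_sort (i # is) = bind_comb (signed_sort is) (signed_insert i)"

lemma pullback_emon:
  assumes "\<And>i. i \<in> set is \<Longrightarrow> pullback F (e i) = e i"
  shows "pullback F (emon e is) = emon e is"
  using assms
proof (induction "is")
  case Nil
  then show ?case by (simp add: fun_eq_iff pullback_def emon_Nil)
qed (simp add: emon_Cons pullback_wedge)

lemma pullback_ecomb:
  assumes "\<And>r is i. (r, is) \<in> set cs \<Longrightarrow> i \<in> set is \<Longrightarrow> pullback F (e i) = e i"
  shows "pullback F (ecomb e cs) = ecomb e cs"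
  using assms
proof (induction cs)
  case Nil
  then show ?case by (simp add: fun_eq_iff pullback_def ecomb_Nil)
next
  case (Cons c cs)
  obtain r "is" where c: "c = (r, is)" by fastforce
  have "pullback F (emon e is) = emon e is"
    using Cons.prems c by (intro pullback_emon) auto
  moreover have "pullback F (ecomb e cs) = ecomb e cs"
    using Cons.prems by (intro Cons.IH) auto
  ultimately show ?case
    by (simp add: c ecomb_split pullback_def fun_eq_iff)
qed

text \<open>The terms in the contraction of a monomial, as in the expansion of a determinant along a
  row: sign, letter that receives the vector, remaining word.\<close>

primrec drops :: "nat list \<Rightarrow> (real \<times> nat \<times> nat list) list" where
  "drops [] = []"
| "drops (i # is) = (1, i, is) # map (\<lambda>(s, j, l). (- s, j, i # l)) (drops is)"

lemma sum_drops_Cons: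
  fixes g :: "nat \<Rightarrow> real"
  shows "(\<Sum>(s, j, l)\<leftarrow>drops (i # is). s * g j * h l) =
    g i * h is - (\<Sum>(s, j, l)\<leftarrow>drops is. s * g j * h (i # l))"
proof -
  have "(\<Sum>(s, j, l)\<leftarrow>map (\<lambda>(s, j, l). (- s, j, i # l)) ds. s * g j * h l) =
    - (\<Sum>(s, j, l)\<leftarrow>ds. s * g j * h (i # l))" for ds
    by (induction ds) auto
  then show ?thesis by simp
qed

lemma drops_word: "(s, j, l) \<in> set (drops is) \<Longrightarrow> Suc (length l) = length is \<and> set l \<subseteq> set is"
proof (induction "is" arbitrary: s l)
  case (Cons i "is")
  show ?case
  proof (cases "(s, j, l) = (1, i, is)")
    case False
    with Cons.prems obtain t l' where "(t, j, l') \<in> set (drops is)" "l = i # l'" by auto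
    with Cons.IH[of t l'] show ?thesis by auto
  qed auto
qed simp

text \<open>The graded Leibniz rule along a word, where \<open>dl i\<close> stands for the
  derivative of the i-th coframe form.\<close>

primrec dmon :: "(nat \<Rightarrow> (real \<times> nat list) list) \<Rightarrow> nat list \<Rightarrow> (real \<times> nat list) list" where
  "dmon dl [] = []"
| "dmon dl (i # is) = append_comb (dl i) is @ scale_comb (- 1) (cons_comb i (dmon dl is))"

lemma sum_list_zero: "(\<And>p. p \<in> set ps \<Longrightarrow> f p = 0) \<Longrightarrow> (\<Sum>p\<leftarrow>ps. f p) = (0::'a::monoid_add)"
  by (induction ps) auto

lemma smooth_differentiable: "smooth f \<Longrightarrow> f differentiable (at x)"
  unfolding smooth_def by (metis Ck.simps(2))

lemma smooth_form_linear: "smooth_form 1 \<alpha> \<Longrightarrow> linear (\<lambda>v. \<alpha> x [v])"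
proof -
  assume "smooth_form 1 \<alpha>"
  then have "\<forall>x vs i. length vs = 1 \<and> i < 1 \<longrightarrow> linear (\<lambda>v. \<alpha> x (vs[i := v]))"
    unfolding smooth_form_def by (elim conjE)
  from this[rule_format, of "[0]" 0 x] show ?thesis by simp
qed

section \<open>Evaluation of monomials on the dual frame\<close>

locale coframe =
  fixes e :: "nat \<Rightarrow> diff_form" and E :: "nat \<Rightarrow> real^8 \<Rightarrow> real^8"
  assumes smooth_coframe: "i \<in> {1..8} \<Longrightarrow> smooth_form 1 (e i)"
    and dual_frame: "dual_frame e E"
begin

lemma one_form_e: "i \<in> {1..8} \<Longrightarrow> one_form (e i)"
  using smooth_coframe[of i] by (simp add: smooth_form_def one_form_def)

lemma diff_coeffs_e: "i \<in> {1..8} \<Longrightarrow> diff_coeffs (e i)"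
  using smooth_coframe[of i] by (simp add: smooth_form_def diff_coeffs_def smooth_differentiable)

lemma linear_e: "i \<in> {1..8} \<Longrightarrow> linear (\<lambda>v. e i x [v])"
  by (rule smooth_form_linear[OF smooth_coframe])

lemma e_E: "i \<in> {1..8} \<Longrightarrow> j \<in> {1..8} \<Longrightarrow> e i x [E j x] = (if i = j then 1 else 0)"
  using dual_frame by (simp add: dual_frame_def)

lemma smooth_E: "i \<in> {1..8} \<Longrightarrow> smooth (E i)"
  using dual_frame by (simp add: dual_frame_def)

lemma emon_swap:
  "i \<in> {1..8} \<Longrightarrow> j \<in> {1..8} \<Longrightarrow> emon e (i # j # is) x vs = - emon e (j # i # is) x vs"
  unfolding emon_Cons by (rule wedge_one_forms_swap) (auto intro: one_form_e)

lemma emon_repeat: "i \<in> {1..8} \<Longrightarrow> emon e (i # i # is) x vs = 0"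
  using emon_swap[of i i "is" x vs] by simp

lemma ecomb_signed_insert:
  "i \<in> {1..8} \<Longrightarrow> set is \<subseteq> {1..8} \<Longrightarrow> ecomb e (signed_insert i is) = emon e (i # is)"
proof (induction "is")
  case Nil
  then show ?case by (simp add: fun_eq_iff ecomb_Cons ecomb_Nil)
next
  case (Cons j js)
  consider "i < j" | "i = j" | "i > j" by linarith
  then show ?case
  proof cases
    case 1
    then show ?thesis by (simp add: fun_eq_iff ecomb_Cons ecomb_Nil)
  next
    case 2
    then show ?thesis using Cons.prems emon_repeat[of i js] by (auto simp: fun_eq_iff ecomb_Nil)
  next
    case 3
    then have "ecomb e (signed_insert i (j # js)) x vs = - emon e (j # i # js) x vs" for x vs
      using Cons by (simp add: ecomb_scale ecomb_cons_comb emon_Cons)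
    then show ?thesis using Cons.prems emon_swap[of i j js] by (auto simp: fun_eq_iff)
  qed
qed

lemma words_signed_insert: "l \<in> snd ` set (signed_insert i is) \<Longrightarrow> set l \<subseteq> insert i (set is)"
proof (induction "is" arbitrary: l)
  case (Cons j js)
  consider "i < j" | "i = j" | "i > j" by linarith
  then show ?case
  proof cases
    case 3
    then have "l \<in> (#) j ` snd ` set (signed_insert i js)"
      using Cons.prems by (simp add: words_scale_comb words_cons_comb)
    then obtain l' where "l = j # l'" "l' \<in> snd ` set (signed_insert i js)" by (rule imageE)
    with Cons.IH[of l'] show ?thesis by auto
  qed (use Cons.prems in auto)
qed simp

lemma words_signed_sort: "l \<in> snd ` set (signed_sort is) \<Longrightarrow> set l \<subseteq> set is"
proof (induction "is" arbitrary: l)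
  case (Cons i "is")
  then obtain js where "js \<in> snd ` set (signed_sort is)" "l \<in> snd ` set (signed_insert i js)"
    unfolding signed_sort.simps words_bind_comb by (elim UN_E)
  with Cons.IH[of js] words_signed_insert[of l i js] show ?case by auto
qed simp

lemma ecomb_signed_sort:
  "set is \<subseteq> {1..8} \<Longrightarrow> ecomb e (signed_sort is) = emon e is"
proof (induction "is")
  case Nil
  then show ?case by (simp add: fun_eq_iff ecomb_Cons ecomb_Nil)
next
  case (Cons i "is")
  have "ecomb e (signed_sort (i # is)) x vs =
      (\<Sum>(r, js)\<leftarrow>signed_sort is. r * wedge (e i) (emon e js) x vs)" for x vs
    unfolding signed_sort.simps ecomb_bind
  proof (intro arg_cong[where f = sum_list] map_cong refl, clarify)
    fix r js assume "(r, js) \<in> set (signed_sort is)"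
    then have "js \<in> snd ` set (signed_sort is)" by force
    with words_signed_sort Cons.prems have "set js \<subseteq> {1..8}" by fastforce
    with Cons.prems show "r * ecomb e (signed_insert i js) x vs = r * wedge (e i) (emon e js) x vs"
      by (simp add: ecomb_signed_insert emon_Cons)
  qed
  also have "(\<Sum>(r, js)\<leftarrow>cs. r * wedge (e i) (emon e js) x vs) = wedge (e i) (ecomb e cs) x vs" for cs x vs
    by (induction cs) (auto simp: ecomb_zero wedge_zero_right ecomb_split wedge_add_right wedge_scale_right)
  moreover have "ecomb e (signed_sort is) = emon e is" using Cons by simp
  ultimately show ?case by (simp add: emon_Cons fun_eq_iff)
qed

definition index_le8 :: "(real \<times> nat list) list \<Rightarrow> bool" where
  "index_le8 cs \<longleftrightarrow> (\<forall>(r, is) \<in> set cs. set is \<subseteq> {1..8})"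

lemma ecomb_normalize:
  "index_le8 cs \<Longrightarrow> ecomb e cs = ecomb e (bind_comb cs signed_sort)"
proof (induction cs)
  case (Cons c cs)
  obtain r "is" where c: "c = (r, is)" by fastforce
  from Cons.prems have "set is \<subseteq> {1..8}" "index_le8 cs"
    by (auto simp: c index_le8_def)
  moreover from this(1) have "ecomb e (signed_sort is) = emon e is" by (rule ecomb_signed_sort)
  ultimately
  show ?case using Cons.IH by (simp add: c ecomb_split ecomb_append ecomb_scale fun_eq_iff)
qed simp

lemma emon_drops:
  "set is \<subseteq> {1..8} \<Longrightarrow>
    emon e is x (v # vs) = (\<Sum>(s, j, l)\<leftarrow>drops is. s * e j x [v] * emon e l x vs)"
proof (induction "is" arbitrary: vs)
  case Nil
  then show ?case by (simp add: emon_Nil)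
next
  case (Cons i "is")
  have one: "one_form (e i)" using Cons.prems one_form_e by auto
  have contr: "contract v (emon e is) x = (\<lambda>vs. \<Sum>(s, j, l)\<leftarrow>drops is. s * e j x [v] * emon e l x vs)"
    using Cons by (simp add: contract_def fun_eq_iff)
  \<comment> \<open>\<open>wedge\<close> at x involves its factors only at x, so the expansion of
    the contraction at this point may be substituted.\<close>
  have "wedge (e i) (contract v (emon e is)) x vs =
      wedge (e i) (\<lambda>x vs. \<Sum>(s, j, l)\<leftarrow>drops is. s * e j x [v] * emon e l x vs) x vs"
    by (rule fun_cong[OF wedge_cong[OF refl]]) (simp only: contr)
  also have "\<dots> = (\<Sum>(s, j, l)\<leftarrow>ds. s * e j x [v] * emon e (i # l) x vs)"
    if "ds = drops is" for ds
    unfolding that[symmetric]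
    by (induction ds)
      (auto simp: wedge_zero_right wedge_add_right emon_Cons
        wedge_pointwise_scale_right[of _ "\<lambda>x. c * e d x [v]" for c d])
  finally have "wedge (e i) (contract v (emon e is)) x vs =
     (\<Sum>(s, j, l)\<leftarrow>drops is. s * e j x [v] * emon e (i # l) x vs)" by blast
  then show ?case
    by (simp only: sum_drops_Cons emon_Cons[of e i "is"] wedge_one_form_Cons[OF one])
qed

lemma emon_Nil_arg: "set is \<subseteq> {1..8} \<Longrightarrow> emon e is x [] = (if is = [] then 1 else 0)"
  by (cases "is") (auto simp: emon_Nil emon_Cons wedge_one_form_Nil one_form_e)

lemma emon_length: "set is \<subseteq> {1..8} \<Longrightarrow> length vs \<noteq> length is \<Longrightarrow> emon e is x vs = 0"
proof (induction vs arbitrary: "is")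
  case Nil
  then show ?case by (auto simp: emon_Nil_arg)
next
  case (Cons v vs)
  have "emon e l x vs = 0" if "(s, j, l) \<in> set (drops is)" for s j l
    using drops_word[OF that] Cons.prems by (intro Cons.IH) auto
  then have "(\<Sum>(s, j, l)\<leftarrow>drops is. s * e j x [v] * emon e l x vs) = 0"
    by (intro sum_list_zero) auto
  then show ?case using Cons.prems by (simp only: emon_drops)
qed

lemma diff_coeffs_emon: "set is \<subseteq> {1..8} \<Longrightarrow> diff_coeffs (emon e is)"
proof (induction "is")
  case Nil
  then show ?case by (simp add: diff_coeffs_def emon_Nil)
next
  case (Cons i "is")
  then show ?case unfolding emon_Cons by (intro diff_coeffs_wedge diff_coeffs_e) auto
qed

lemma diff_coeffs_ecomb: "index_le8 cs \<Longrightarrow> diff_coeffs (ecomb e cs)"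
proof (induction cs)
  case Nil
  then show ?case by (simp add: diff_coeffs_def ecomb_Nil)
next
  case (Cons c cs)
  then show ?case
    by (cases c) (auto simp: ecomb_split index_le8_def intro!: diff_coeffs_add diff_coeffs_scale diff_coeffs_emon)
qed

lemma ext_d_emon:
  assumes "\<And>i. i \<in> {1..8} \<Longrightarrow> ext_d (e i) = ecomb e (dl i)" "set is \<subseteq> {1..8}"
  shows "ext_d (emon e is) = ecomb e (dmon dl is)"
  using assms(2)
proof (induction "is")
  case Nil
  have "ext_d (emon e []) x vs = 0" for x vs by (rule ext_d_const) (simp add: emon_Nil)
  then show ?case by (simp add: fun_eq_iff ecomb_Nil)
next
  case (Cons i "is")
  then have i: "i \<in> {1..8}" and "is": "set is \<subseteq> {1..8}" by auto
  have "ext_d (emon e (i # is)) x vs = ecomb e (dmon dl (i # is)) x vs" for x vs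
    using Cons.IH[OF "is"]
    by (simp add: emon_Cons ext_d_wedge diff_coeffs_e[OF i] diff_coeffs_emon[OF "is"] assms(1)[OF i]
        grade_inv_one_form[OF one_form_e[OF i]] ecomb_append ecomb_append_comb ecomb_scale ecomb_cons_comb
        wedge_scale_left[of "- 1", simplified])
  then show ?case by (simp add: fun_eq_iff)
qed

lemma ext_d_ecomb:
  assumes "\<And>i. i \<in> {1..8} \<Longrightarrow> ext_d (e i) = ecomb e (dl i)" "index_le8 cs"
  shows "ext_d (ecomb e cs) = ecomb e (bind_comb cs (dmon dl))"
  using assms(2)
proof (induction cs)
  case Nil
  have "ext_d (\<lambda>x vs. 0) x vs = 0" for x vs by (rule ext_d_const) simp
  then show ?case by (simp add: ecomb_zero fun_eq_iff)
next
  case (Cons c cs)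
  obtain r "is" where c: "c = (r, is)" by fastforce
  with Cons.prems have "is": "set is \<subseteq> {1..8}" and cs: "index_le8 cs" by (auto simp: index_le8_def)
  have "ext_d (ecomb e (c # cs)) x vs = r * ext_d (emon e is) x vs + ext_d (ecomb e cs) x vs" for x vs
    unfolding c ecomb_split
    by (simp add: ext_d_add ext_d_scale diff_coeffs_scale diff_coeffs_emon[OF "is"] diff_coeffs_ecomb[OF cs])
  moreover have "ext_d (emon e is) = ecomb e (dmon dl is)"
    using ext_d_emon[OF assms(1) "is"] .
  ultimately show ?case
    unfolding Cons.IH[OF cs] by (simp add: fun_eq_iff c ecomb_append ecomb_scale)
qed

lemma drops_notin:
  "set is \<subseteq> {1..8} \<Longrightarrow> j \<in> {1..8} \<Longrightarrow> j \<notin> set is \<Longrightarrow>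
   (\<Sum>(s, i, l)\<leftarrow>drops is. s * e i x [E j x] * f l) = 0"
proof (induction "is" arbitrary: f)
  case (Cons i "is")
  then have "e i x [E j x] = 0" "(\<Sum>(s, k, l)\<leftarrow>drops is. s * e k x [E j x] * f (i # l)) = 0"
    by (auto simp: e_E)
  then show ?case by (simp only: sum_drops_Cons)
qed simp

lemma emon_frame_notin:
  assumes "set is \<subseteq> {1..8}" "j \<in> {1..8}" "j \<notin> set is"
  shows "emon e is x (E j x # vs) = 0"
  using drops_notin[OF assms, of x "\<lambda>l. emon e l x vs"] by (simp only: emon_drops[OF assms(1)])

lemma emon_frame_in:
  assumes "set (l1 @ j # l2) \<subseteq> {1..8}" "distinct (l1 @ j # l2)"
  shows "emon e (l1 @ j # l2) x (E j x # vs) = (- 1) ^ length l1 * emon e (l1 @ l2) x vs"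
proof -
  have "(\<Sum>(s, i, l)\<leftarrow>drops (l1 @ j # l2). s * e i x [E j x] * f l) = (- 1) ^ length l1 * f (l1 @ l2)" for f
    using assms
  proof (induction l1 arbitrary: f)
    case Nil
    then have "e j x [E j x] = 1" "(\<Sum>(s, i, l)\<leftarrow>drops l2. s * e i x [E j x] * f (j # l)) = 0"
      by (auto simp: e_E intro!: drops_notin)
    then show ?case by (simp add: sum_drops_Cons del: drops.simps)
  next
    case (Cons i l1)
    then have "e i x [E j x] = 0" by (auto simp: e_E)
    moreover have "(\<Sum>(s, k, l)\<leftarrow>drops (l1 @ j # l2). s * e k x [E j x] * f (i # l)) =
       (- 1) ^ length l1 * f (i # l1 @ l2)"
      using Cons by (intro Cons.IH) auto
    ultimately show ?case by (simp add: sum_drops_Cons del: drops.simps)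
  qed
  then show ?thesis using assms by (simp only: emon_drops)
qed

lemma emon_frame_sorted:
  assumes "set is \<subseteq> {1..8}" "set js \<subseteq> {1..8}" "sorted_wrt (<) is" "sorted_wrt (<) js"
  shows "emon e is x (frame_at E x js) = (if is = js then 1 else 0)"
  using assms
proof (induction js arbitrary: "is")
  case Nil
  then show ?case by (auto simp: emon_Nil_arg frame_at_def)
next
  case (Cons j js)
  have fr: "frame_at E x (j # js) = E j x # frame_at E x js" by (simp add: frame_at_def)
  show ?case
  proof (cases "j \<in> set is")
    case False
    then show ?thesis using Cons.prems by (auto simp: fr emon_frame_notin)
  next
    case True
    then obtain l1 l2 where "is": "is = l1 @ j # l2" by (meson split_list)
    have d: "distinct is" using Cons.prems strict_sorted_iff by blast
    have "emon e is x (frame_at E x (j # js)) = (- 1) ^ length l1 * emon e (l1 @ l2) x (frame_at E x js)"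
      unfolding fr "is" using Cons.prems d "is" by (intro emon_frame_in) auto
    also have "emon e (l1 @ l2) x (frame_at E x js) = (if l1 @ l2 = js then 1 else 0)"
      using Cons.prems "is" by (intro Cons.IH) (auto simp: sorted_wrt_append)
    \<comment> \<open>If \<open>l1\<close> is nonempty, its head is smaller than j and hence smaller
      than every element of \<open>js\<close>, so both equalities fail. If it is empty, the sign is
      1.\<close>
    finally show ?thesis
      using Cons.prems "is" by (cases l1) auto
  qed
qed

text \<open>Sorted monomials are dual to sorted frame lists, so the sum over index sets extracts the
  coefficients. The values of f lie in an arbitrary vector space because the result serves both the
  Hodge star and the Clifford action.\<close>

lemma ecomb_frame_sum:
  fixes f :: "nat list \<Rightarrow> 'b::real_vector"
  assumes cs: "\<And>r is. (r, is) \<in> set cs \<Longrightarrow> set is \<subseteq> {1..8} \<and> sorted_wrt (<) is"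
    and J: "J \<subseteq> Pow {1..8}" "\<And>r is. (r, is) \<in> set cs \<Longrightarrow> set is \<in> J"
  shows "(\<Sum>I\<in>J. ecomb e cs x (frame_at E x (sorted_list_of_set I)) *\<^sub>R f (sorted_list_of_set I)) =
    (\<Sum>(r, is)\<leftarrow>cs. r *\<^sub>R f is)"
  using cs J(2)
proof (induction cs)
  case Nil
  then show ?case by (simp add: ecomb_Nil)
next
  case (Cons c cs)
  obtain r "is" where c: "c = (r, is)" by fastforce
  have "is": "set is \<subseteq> {1..8}" "sorted_wrt (<) is" "set is \<in> J"
    using Cons.prems(1)[of r "is"] Cons.prems(2)[of r "is"] c by auto
  have fin: "finite J" using J(1) finite_subset by blast
  have eq: "is = sorted_list_of_set I \<longleftrightarrow> I = set is" if "I \<in> J" for I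
  proof -
    have "finite I" using that J(1) by (meson PowD finite_atLeastAtMost finite_subset subsetD)
    then show ?thesis using "is"(2)
      by (metis sorted_list_of_set.idem_if_sorted_distinct set_sorted_list_of_set strict_sorted_iff)
  qed
  have "emon e is x (frame_at E x (sorted_list_of_set I)) = (if I = set is then 1 else 0)" if "I \<in> J" for I
  proof -
    have "I \<subseteq> {1..8}" "finite I" using that J(1) by (auto intro: finite_subset)
    then show ?thesis using "is" eq[OF that] by (subst emon_frame_sorted) auto
  qed
  then have "(\<Sum>I\<in>J. (r * emon e is x (frame_at E x (sorted_list_of_set I))) *\<^sub>R f (sorted_list_of_set I)) =
     (\<Sum>I\<in>J. if I = set is then r *\<^sub>R f is else 0)"
    by (intro sum.cong refl) (auto simp: eq[symmetric])
  also have "\<dots> = r *\<^sub>R f is" using fin "is" by simp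
  moreover have "(\<Sum>I\<in>J. ecomb e cs x (frame_at E x (sorted_list_of_set I)) *\<^sub>R f (sorted_list_of_set I)) =
    (\<Sum>(r, is)\<leftarrow>cs. r *\<^sub>R f is)"
    using Cons.prems by (intro Cons.IH) (meson list.set_intros(2))+
  ultimately show ?case
    by (simp add: c ecomb_Cons scaleR_add_left sum.distrib)
qed

definition sorted_comb :: "(real \<times> nat list) list \<Rightarrow> bool" where
  "sorted_comb cs \<longleftrightarrow> (\<forall>(r, is) \<in> set cs. set is \<subseteq> {1..8} \<and> sorted_wrt (<) is)"

lemma hodge_ecomb:
  assumes "sorted_comb cs"
  shows "hodge e E (ecomb e cs) x ws =
    (\<Sum>(r, is)\<leftarrow>cs. r * emon e [1,2,3,4,5,6,7,8] x (frame_at E x is @ ws))"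
proof -
  let ?vol = "\<lambda>is. emon e [1,2,3,4,5,6,7,8] x (frame_at E x is @ ws)"
  have "hodge e E (ecomb e cs) x ws =
    (\<Sum>I\<in>Pow {1..8}. ecomb e cs x (frame_at E x (sorted_list_of_set I)) *\<^sub>R ?vol (sorted_list_of_set I))"
    unfolding hodge_def real_scaleR_def
  \<comment> \<open>Index sets of the wrong size contribute nothing, since the volume form vanishes
    on lists whose length is not 8.\<close>
  proof (rule sum.mono_neutral_left)
    show "\<forall>I\<in>Pow {1..8} - {I. I \<subseteq> {1..8} \<and> card I + length ws = 8}.
       ecomb e cs x (frame_at E x (sorted_list_of_set I)) * ?vol (sorted_list_of_set I) = 0"
      by (auto simp: frame_at_def intro!: emon_length)
  qed auto
  also have "\<dots> = (\<Sum>(r, is)\<leftarrow>cs. r *\<^sub>R ?vol is)"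
    using assms by (intro ecomb_frame_sum) (auto simp: sorted_comb_def)
  finally show ?thesis by simp
qed

end

text \<open>The index 1 has to stay a numeral like the other indices; as \<open>Suc 0\<close> it
  would not match the sums and lemmas stated for index 1.\<close>

declare One_nat_def [simp del]

section \<open>The Hodge star on words, and the Koszul formula\<close>

fun delete_index :: "nat \<Rightarrow> nat list \<Rightarrow> real \<times> nat list" where
  "delete_index j [] = (0, [])"
| "delete_index j (i # is) =
    (if i = j then (1, is) else (- fst (delete_index j is), i # snd (delete_index j is)))"

text \<open>Contraction of a word with several frame vectors in turn; a missing letter makes the
  coefficient 0.\<close>

primrec delete_indices :: "nat list \<Rightarrow> nat list \<Rightarrow> real \<times> nat list" where
  "delete_indices [] is = (1, is)"
| "delete_indices (j # js) is =
    (fst (delete_index j is) * fst (delete_indices js (snd (delete_index j is))),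
     snd (delete_indices js (snd (delete_index j is))))"

text \<open>Contracting the volume word with the letters of a monomial leaves the complementary word
  with the sign that the convention of \<open>hodge\<close> prescribes.\<close>

definition hodge_comb :: "(real \<times> nat list) list \<Rightarrow> (real \<times> nat list) list" where
  "hodge_comb cs = map (\<lambda>(r, is). (r * fst (delete_indices is [1,2,3,4,5,6,7,8]),
     snd (delete_indices is [1,2,3,4,5,6,7,8]))) cs"

lemma delete_index_in:
  "j \<notin> set l1 \<Longrightarrow> delete_index j (l1 @ j # l2) = ((- 1) ^ length l1, l1 @ l2)"
  by (induction l1) auto

lemma delete_index_notin: "j \<notin> set is \<Longrightarrow> delete_index j is = (0, is)"
  by (induction "is") auto

text \<open>The product rule for a form applied to a vector field, both varying with the point. The
  form is differentiable for fixed arguments, so the field is expanded in the standard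
  basis.\<close>

lemma has_derivative_pairing:
  fixes \<alpha> :: "'a::euclidean_space \<Rightarrow> 'b::euclidean_space \<Rightarrow> real"
  assumes lin: "\<And>x. linear (\<alpha> x)"
    and \<alpha>: "\<And>v. ((\<lambda>y. \<alpha> y v) has_derivative \<alpha>' v) (at x)"
    and Y: "(Y has_derivative Y') (at x)"
  shows "((\<lambda>y. \<alpha> y (Y y)) has_derivative (\<lambda>u. \<alpha>' (Y x) u + \<alpha> x (Y' u))) (at x)"
proof -
  have expand: "\<alpha> y v = (\<Sum>b\<in>Basis. (v \<bullet> b) * \<alpha> y b)" for y v
    using Linear_Algebra.linear_componentwise[OF lin, of y v 1] by simp
  have "((\<lambda>y. \<Sum>b\<in>Basis. (Y y \<bullet> b) * \<alpha> y b) has_derivative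
     (\<lambda>u. \<Sum>b\<in>Basis. (Y x \<bullet> b) * \<alpha>' b u + (Y' u \<bullet> b) * \<alpha> x b)) (at x)"
    by (intro has_derivative_sum has_derivative_mult has_derivative_inner_left Y \<alpha>)
  moreover have "(\<lambda>y. \<Sum>b\<in>Basis. (Y y \<bullet> b) * \<alpha> y b) = (\<lambda>y. \<alpha> y (Y y))"
    by (simp add: expand[symmetric])
  \<comment> \<open>Uniqueness of derivatives shows that \<open>\<alpha>'\<close> is linear in its
    vector slot.\<close>
  moreover have "(\<Sum>b\<in>Basis. (Y x \<bullet> b) * \<alpha>' b u) = \<alpha>' (Y x) u" for u
  proof -
    have "((\<lambda>y. \<Sum>b\<in>Basis. (Y x \<bullet> b) * \<alpha> y b) has_derivative
       (\<lambda>u. \<Sum>b\<in>Basis. (Y x \<bullet> b) * \<alpha>' b u)) (at x)"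
      by (intro has_derivative_sum has_derivative_mult_right \<alpha>)
    then have "((\<lambda>y. \<alpha> y (Y x)) has_derivative (\<lambda>u. \<Sum>b\<in>Basis. (Y x \<bullet> b) * \<alpha>' b u)) (at x)"
      by (simp only: expand[symmetric])
    from has_derivative_unique[OF this \<alpha>] show ?thesis by metis
  qed
  ultimately show ?thesis
    by (simp only: sum.distrib expand[symmetric])
qed

lemma smooth_has_derivative: "smooth f \<Longrightarrow> (f has_derivative frechet_derivative f (at x)) (at x)"
  using smooth_differentiable frechet_derivative_works by blast

lemma ext_d_pair:
  "ext_d \<alpha> x [u, v] = frechet_derivative (\<lambda>y. \<alpha> y [v]) (at x) u - frechet_derivative (\<lambda>y. \<alpha> y [u]) (at x) v"
  by (simp add: ext_d_def)

context coframe begin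

lemma smooth_e: "i \<in> {1..8} \<Longrightarrow> smooth (\<lambda>x. e i x vs)"
  using smooth_coframe[of i] by (simp add: smooth_form_def)

lemma emon_delete_index:
  assumes "set is \<subseteq> {1..8}" "distinct is" "j \<in> {1..8}"
  shows "emon e is x (E j x # vs) = fst (delete_index j is) * emon e (snd (delete_index j is)) x vs"
proof (cases "j \<in> set is")
  case True
  then obtain l1 l2 where "is": "is = l1 @ j # l2" by (meson split_list)
  then show ?thesis using emon_frame_in[of l1 j l2 x vs] assms by (simp add: delete_index_in)
next
  case False
  then show ?thesis using emon_frame_notin[OF assms(1,3)] by (simp add: delete_index_notin)
qed

lemma emon_delete_indices:
  assumes "set is \<subseteq> {1..8}" "distinct is" "set js \<subseteq> {1..8}"
  shows "emon e is x (frame_at E x js @ vs) =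
    fst (delete_indices js is) * emon e (snd (delete_indices js is)) x vs"
  using assms
proof (induction js arbitrary: "is")
  case Nil
  then show ?case by (simp add: frame_at_def)
next
  case (Cons j js)
  have "set (snd (delete_index j is)) \<subseteq> set is \<and> distinct (snd (delete_index j is))"
  proof (cases "j \<in> set is")
    case True
    then obtain l1 l2 where "is = l1 @ j # l2" by (meson split_list)
    then show ?thesis using Cons.prems by (auto simp: delete_index_in)
  qed (simp add: delete_index_notin Cons.prems)
  then have sub: "set (snd (delete_index j is)) \<subseteq> {1..8}" "distinct (snd (delete_index j is))"
    using Cons.prems(1) by auto
  have "emon e is x (frame_at E x (j # js) @ vs) =
      fst (delete_index j is) * emon e (snd (delete_index j is)) x (frame_at E x js @ vs)"
    using Cons.prems by (simp add: frame_at_def emon_delete_index)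
  then show ?case using Cons.IH[OF sub] Cons.prems(3) by simp
qed

lemma hodge_ecomb_comb:
  assumes "sorted_comb cs"
  shows "hodge e E (ecomb e cs) = ecomb e (hodge_comb cs)"
proof (intro ext)
  fix x :: "real^8" and ws :: "(real^8) list"
  have "hodge e E (ecomb e cs) x ws =
    (\<Sum>(r, is)\<leftarrow>cs. r * emon e [1,2,3,4,5,6,7,8] x (frame_at E x is @ ws))"
    by (rule hodge_ecomb[OF assms])
  also have "\<dots> = (\<Sum>(r, is)\<leftarrow>cs. r * (fst (delete_indices is [1,2,3,4,5,6,7,8]) *
      emon e (snd (delete_indices is [1,2,3,4,5,6,7,8])) x ws))"
  proof (intro arg_cong[where f = sum_list] map_cong refl, clarify)
    fix r "is" assume "(r, is) \<in> set cs"
    with assms have "set is \<subseteq> {1..8}" by (auto simp: sorted_comb_def)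
    then show "r * emon e [1,2,3,4,5,6,7,8] x (frame_at E x is @ ws) =
      r * (fst (delete_indices is [1,2,3,4,5,6,7,8]) * emon e (snd (delete_indices is [1,2,3,4,5,6,7,8])) x ws)"
      by (subst emon_delete_indices) auto
  qed
  also have "\<dots> = ecomb e (hodge_comb cs) x ws"
    by (induction cs) (auto simp: hodge_comb_def ecomb_Nil ecomb_Cons)
  finally show "hodge e E (ecomb e cs) x ws = ecomb e (hodge_comb cs) x ws" .
qed

lemma e_sum_frame:
  assumes "i \<in> {1..8}"
  shows "e i x [\<Sum>k=1..8. r k *\<^sub>R E k x] = r i"
proof -
  have "e i x [\<Sum>k=1..8. r k *\<^sub>R E k x] = (\<Sum>k=1..8. r k * e i x [E k x])"
    using linear_sum[OF linear_e[OF assms], of x "\<lambda>k. r k *\<^sub>R E k x" "{1..8}"]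
      linear_cmul[OF linear_e[OF assms]] by simp
  also have "\<dots> = (\<Sum>k=1..8. if k = i then r k else 0)"
    using assms by (intro sum.cong refl) (subst e_E, auto)
  also have "\<dots> = r i" using assms by simp
  finally show ?thesis .
qed

text \<open>Duality makes the eight frame vectors independent, and by dimension they span.\<close>

lemma frame_expand: "v = (\<Sum>k=1..8. e k x [v] *\<^sub>R E k x)"
proof -
  let ?F = "\<lambda>k. E k x"
  have inj: "inj_on ?F {1..8}"
  proof (rule inj_onI)
    fix i j :: nat assume "i \<in> {1..8}" "j \<in> {1..8}" "E i x = E j x"
    then show "i = j" using e_E[of i j x] e_E[of i i x] by (auto split: if_splits)
  qed
  have ind: "independent (?F ` {1..8})"
  proof (rule independent_if_scalars_zero)
    fix f y assume s: "(\<Sum>y\<in>?F ` {1..8}. f y *\<^sub>R y) = 0" and "y \<in> ?F ` {1..8}"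
    then obtain i where i: "i \<in> {1..8}" "y = E i x" by auto
    have "(\<Sum>k=1..8. f (E k x) *\<^sub>R E k x) = 0"
      using s unfolding sum.reindex[OF inj] o_def .
    then have "f (E i x) = e i x [0]" using e_sum_frame[OF i(1), of x "\<lambda>k. f (E k x)"] by simp
    then show "f y = 0" using i linear_0[OF linear_e[OF i(1)]] by simp
  qed simp
  have "UNIV \<subseteq> span (?F ` {1..8})"
    by (rule card_ge_dim_independent) (use ind in \<open>auto simp: card_image[OF inj]\<close>)
  then have "v \<in> span (?F ` {1..8})" by blast
  then obtain u where "v = (\<Sum>y\<in>?F ` {1..8}. u y *\<^sub>R y)"
    by (auto simp: span_finite)
  then have v: "v = (\<Sum>k=1..8. u (E k x) *\<^sub>R E k x)"
    by (simp add: sum.reindex[OF inj])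
  then have "e k x [v] = u (E k x)" if "k \<in> {1..8}" for k
    using e_sum_frame[OF that, of x "\<lambda>k. u (E k x)"] by simp
  then have "(\<Sum>k=1..8. e k x [v] *\<^sub>R E k x) = (\<Sum>k=1..8. u (E k x) *\<^sub>R E k x)"
    by (intro sum.cong refl) simp
  with v show ?thesis by simp
qed

lemma one_form_expand:
  assumes "linear (\<lambda>v. \<alpha> x [v])"
  shows "\<alpha> x [v] = (\<Sum>k=1..8. \<alpha> x [E k x] * e k x [v])"
proof -
  have "\<alpha> x [v] = \<alpha> x [\<Sum>k=1..8. e k x [v] *\<^sub>R E k x]" using frame_expand[of v x] by simp
  also have "\<dots> = (\<Sum>k=1..8. \<alpha> x [E k x] * e k x [v])"
    using linear_sum[OF assms, of "\<lambda>k. e k x [v] *\<^sub>R E k x" "{1..8}"] linear_cmul[OF assms]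
    by (simp add: mult_ac)
  finally show ?thesis .
qed

text \<open>The pairings of coframe and frame are constant. Differentiating them moves the
  derivative from the field to the form, and the two terms of the bracket combine to an exterior
  derivative.\<close>

lemma e_bracket:
  assumes i: "i \<in> {1..8}" and j: "j \<in> {1..8}" and k: "k \<in> {1..8}"
  shows "e i x [lie_bracket (E k) (E j) x] = - ext_d (e i) x [E k x, E j x]"
proof -
  have lin: "linear (\<lambda>v. e i y [v])" for y by (rule linear_e[OF i])
  have D: "e i x [frechet_derivative (E m) (at x) u] = - frechet_derivative (\<lambda>y. e i y [E m x]) (at x) u"
    if m: "m \<in> {1..8}" for m u
  proof -
    have "(\<lambda>y. e i y [E m y]) = (\<lambda>y. if i = m then 1 else 0)"
      using e_E[OF i m] by simp
    then have "frechet_derivative (\<lambda>y. e i y [E m y]) (at x) u = 0" by simp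
    moreover have "((\<lambda>y. e i y [E m y]) has_derivative (\<lambda>u. frechet_derivative (\<lambda>y. e i y [E m x]) (at x) u +
        e i x [frechet_derivative (E m) (at x) u])) (at x)"
      by (rule has_derivative_pairing[where \<alpha> = "\<lambda>y v. e i y [v]"
            and \<alpha>' = "\<lambda>v. frechet_derivative (\<lambda>y. e i y [v]) (at x)"])
        (rule lin smooth_has_derivative smooth_e[OF i] smooth_E[OF m])+
    note frechet_derivativeI[OF this, of u]
    ultimately have "frechet_derivative (\<lambda>y. e i y [E m x]) (at x) u +
        e i x [frechet_derivative (E m) (at x) u] = 0" by simp
    then show ?thesis by linarith
  qed
  show ?thesis
    unfolding lie_bracket_def linear_diff[OF lin] D[OF j] D[OF k] ext_d_pair by simp
qed

lemma cov_deriv_frame: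
  assumes "j \<in> {1..8}"
  shows "cov_deriv e E \<sigma> X (E j) x = (\<Sum>i=1..8. \<sigma> i j x [X x] *\<^sub>R E i x)"
  unfolding cov_deriv_def
proof (intro sum.cong refl)
  fix i :: nat assume i: "i \<in> {1..8}"
  have "(\<lambda>y. e i y [E j y]) = (\<lambda>y. if i = j then 1 else 0)" using e_E[OF i assms] by simp
  then have "frechet_derivative (\<lambda>y. e i y [E j y]) (at x) (X x) = 0" by simp
  moreover have "(\<Sum>k=1..8. \<sigma> i k x [X x] * e k x [E j x]) = (\<Sum>k=1..8. if k = j then \<sigma> i k x [X x] else 0)"
    using assms by (intro sum.cong refl) (subst e_E, auto)
  ultimately show "(frechet_derivative (\<lambda>y. e i y [E j y]) (at x) (X x) +
      (\<Sum>k=1..8. \<sigma> i k x [X x] * e k x [E j x])) *\<^sub>R E i x = \<sigma> i j x [X x] *\<^sub>R E i x"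
    using assms by simp
qed

lemma metric_frame:
  assumes "i \<in> {1..8}"
  shows "metric e x v (E i x) = e i x [v]"
proof -
  have "metric e x v (E i x) = (\<Sum>k=1..8. if k = i then e k x [v] else 0)"
    unfolding metric_def using assms by (intro sum.cong refl) (subst e_E, auto)
  then show ?thesis using assms by simp
qed

lemma metric_frame': "i \<in> {1..8} \<Longrightarrow> metric e x (E i x) v = e i x [v]"
  using metric_frame by (simp add: metric_def mult.commute)

text \<open>The Koszul formula in an orthonormal frame, where the metric coefficients are constant.
  Metric compatibility gives three skew-symmetry relations and vanishing torsion three more; these
  linear equations determine the value.\<close>

lemma levi_civita_frame:
  assumes lc: "levi_civita e E \<sigma>" and i: "i \<in> {1..8}" and j: "j \<in> {1..8}" and k: "k \<in> {1..8}"
  shows "\<sigma> i j x [E k x] =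
    1/2 * (ext_d (e k) x [E j x, E i x] - ext_d (e i) x [E k x, E j x] - ext_d (e j) x [E i x, E k x])"
proof -
  have skew: "\<sigma> p q x [E r x] = - \<sigma> q p x [E r x]" if p: "p \<in> {1..8}" and q: "q \<in> {1..8}" and r: "r \<in> {1..8}" for p q r
  proof -
    have "frechet_derivative (\<lambda>y. metric e y (E q y) (E p y)) (at x) (E r x) =
      metric e x (cov_deriv e E \<sigma> (E r) (E q) x) (E p x) + metric e x (E q x) (cov_deriv e E \<sigma> (E r) (E p) x)"
      by (rule lc[unfolded levi_civita_def, THEN conjunct2, THEN conjunct1, rule_format])
        (intro conjI smooth_E p q r)
    moreover have "(\<lambda>y. metric e y (E q y) (E p y)) = (\<lambda>y. if p = q then 1 else 0)"
      by (simp add: metric_frame[OF p] e_E[OF p q])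
    ultimately show ?thesis
      by (simp add: metric_frame[OF p] metric_frame'[OF q]
        cov_deriv_frame[OF p] cov_deriv_frame[OF q] e_sum_frame[OF p] e_sum_frame[OF q])
  qed
  have tor: "\<sigma> p q x [E r x] - \<sigma> p r x [E q x] = - ext_d (e p) x [E r x, E q x]"
    if p: "p \<in> {1..8}" and q: "q \<in> {1..8}" and r: "r \<in> {1..8}" for p q r
  proof -
    have "cov_deriv e E \<sigma> (E r) (E q) x - cov_deriv e E \<sigma> (E q) (E r) x = lie_bracket (E r) (E q) x"
      by (rule lc[unfolded levi_civita_def, THEN conjunct2, THEN conjunct2, rule_format])
        (intro conjI smooth_E q r)
    then have "e p x [(\<Sum>i=1..8. \<sigma> i q x [E r x] *\<^sub>R E i x) - (\<Sum>i=1..8. \<sigma> i r x [E q x] *\<^sub>R E i x)] =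
       - ext_d (e p) x [E r x, E q x]"
      by (simp add: cov_deriv_frame[OF q] cov_deriv_frame[OF r] e_bracket[OF p q r])
    then show ?thesis
      by (simp add: linear_diff[OF linear_e[OF p]] e_sum_frame[OF p])
  qed
  show ?thesis
    using skew[OF i j k] skew[OF i k j] skew[OF k j i] tor[OF i j k] tor[OF k i j] tor[OF j k i]
    by argo
qed

end

section \<open>Structure equations, torsion and the balanced condition\<close>

definition d1_comb :: "real \<Rightarrow> (real \<times> nat list) list" where
  "d1_comb c = [(c, [2,4]), (c, [2,5]), (- c, [3,4]), (c, [3,5])]"

definition d8_comb :: "real \<Rightarrow> real \<Rightarrow> (real \<times> nat list) list" where
  "d8_comb a b = [(a, [2,3]), (b, [4,5]), (- (a + b), [6,7])]"

definition structure_comb :: "real \<Rightarrow> real \<Rightarrow> real \<Rightarrow> nat \<Rightarrow> (real \<times> nat list) list" where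
  "structure_comb a b c i = (if i = 1 then d1_comb c else if i = 8 then d8_comb a b else [])"

definition Phi_comb :: "(real \<times> nat list) list" where
  "Phi_comb =
     [(1, [1,2,3,8]), (-1, [1,3,4,7]), (1, [1,4,5,8]), (1, [1,6,7,8]), (-1, [1,2,5,7]),
      (-1, [1,3,5,6]), (1, [1,2,4,6]), (1, [4,5,6,7]), (1, [2,5,6,8]), (1, [2,3,6,7]),
      (1, [2,3,4,5]), (1, [3,4,6,8]), (1, [2,4,7,8]), (-1, [3,5,7,8])]"

text \<open>The sorted derivative of \<open>Phi_comb\<close>. All its terms come from the three
  words that contain both 1 and 8; the contributions of the other words cancel.\<close>

definition dPhi_comb :: "real \<Rightarrow> real \<Rightarrow> real \<Rightarrow> (real \<times> nat list) list" where
  "dPhi_comb a b c = [(- (a + b), [1,2,3,4,5]), (b, [1,2,3,6,7]), (a, [1,4,5,6,7]),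
     (c, [2,4,6,7,8]), (c, [2,5,6,7,8]), (- c, [3,4,6,7,8]), (c, [3,5,6,7,8])]"

definition torsion_comb :: "real \<Rightarrow> real \<Rightarrow> real \<Rightarrow> (real \<times> nat list) list" where
  "torsion_comb a b c = [(c, [1,2,4]), (c, [1,2,5]), (- c, [1,3,4]), (c, [1,3,5]),
     (a, [2,3,8]), (b, [4,5,8]), (- (a + b), [6,7,8])]"

lemmas comb_simps = scale_comb_def cons_comb_def append_comb_def ecomb_Cons ecomb_Nil
  d1_comb_def d8_comb_def structure_comb_def Phi_comb_def dPhi_comb_def torsion_comb_def

lemma sum_1_8: "(\<Sum>i=1..8. f i) = f 1 + f 2 + f 3 + f 4 + f 5 + f 6 + f 7 + f (8::nat)"
proof -
  have "{1..8::nat} = {1,2,3,4,5,6,7,8}" by auto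
  then show ?thesis by (simp add: add.assoc)
qed

lemma ball_1_8: "(\<forall>i\<in>{1..8::nat}. P i) \<longleftrightarrow> P 1 \<and> P 2 \<and> P 3 \<and> P 4 \<and> P 5 \<and> P 6 \<and> P 7 \<and> P 8"
proof -
  have "{1..8::nat} = {1,2,3,4,5,6,7,8}" by auto
  then show ?thesis by simp
qed

context coframe begin

text \<open>With all words sorted, an identity between combinations becomes ring arithmetic on
  coefficients. This rule is used when the right side is sorted already;
  \<open>ecomb_eq_normalized\<close> sorts both sides.\<close>

lemma ecomb_eqI:
  assumes "index_le8 cs" "\<And>x vs. ecomb e (bind_comb cs signed_sort) x vs = ecomb e ds x vs"
  shows "ecomb e cs = ecomb e ds"
  using ecomb_normalize[OF assms(1)] assms(2) by (simp add: fun_eq_iff)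

lemma ecomb_eq_normalized:
  assumes "index_le8 cs" "index_le8 ds"
    and "\<And>x vs. ecomb e (bind_comb cs signed_sort) x vs = ecomb e (bind_comb ds signed_sort) x vs"
  shows "ecomb e cs = ecomb e ds"
  using ecomb_normalize[OF assms(1)] ecomb_normalize[OF assms(2)] assms(3) by (simp add: fun_eq_iff)

lemma emon_single: "i \<in> {1..8} \<Longrightarrow> emon e [i] = e i"
proof (intro ext)
  fix x :: "real^8" and vs :: "(real^8) list"
  assume i: "i \<in> {1..8}"
  then show "emon e [i] x vs = e i x vs"
  proof (cases vs)
    case Nil
    then show ?thesis using i by (simp add: emon_Nil_arg one_formD[OF one_form_e])
  next
    case (Cons v us)
    then show ?thesis using i one_formD[OF one_form_e[OF i], of vs x]
      by (auto simp: emon_drops emon_Nil)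
  qed
qed

lemma emon_pair: "i \<in> {1..8} \<Longrightarrow> j \<in> {1..8} \<Longrightarrow> emon e [i, j] = wedge (e i) (e j)"
  using emon_single[of j] by (simp add: emon_Cons[of e i])

lemma emon_pair_eval:
  "i \<in> {1..8} \<Longrightarrow> j \<in> {1..8} \<Longrightarrow> emon e [i, j] x [u, v] = e i x [u] * e j x [v] - e j x [u] * e i x [v]"
  by (simp add: emon_drops emon_Nil)

lemma hodge_add: "hodge e E (\<lambda>x vs. \<alpha> x vs + \<beta> x vs) x ws = hodge e E \<alpha> x ws + hodge e E \<beta> x ws"
  by (simp add: hodge_def algebra_simps sum.distrib)

lemma hodge_scale: "hodge e E (\<lambda>x vs. r * \<alpha> x vs) x ws = r * hodge e E \<alpha> x ws"
  by (simp add: hodge_def sum_distrib_left mult_ac)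

end

section \<open>Connections along \<open>e 8\<close> and \<open>e 1\<close> and their Pontryagin
  forms\<close>

lemma curvature_cong:
  assumes "\<And>i j. i \<in> {1..8} \<Longrightarrow> j \<in> {1..8} \<Longrightarrow> \<sigma> i j = \<tau> i j" "i \<in> {1..8}" "j \<in> {1..8}"
  shows "curvature \<sigma> i j = curvature \<tau> i j"
proof -
  have "(\<Sum>k=1..8. wedge (\<sigma> i k) (\<sigma> k j) x vs) = (\<Sum>k=1..8. wedge (\<tau> i k) (\<tau> k j) x vs)" for x vs
    using assms by (intro sum.cong) auto
  moreover have "ext_d (\<sigma> i j) = ext_d (\<tau> i j)" using assms by simp
  ultimately show ?thesis by (simp add: curvature_def fun_eq_iff)
qed

text \<open>
  Both \<open>\<nabla>\<^sup>+\<close> and \<open>A_conn\<close> have connection forms \<open>X8 \<otimes> e 8 + X1 \<otimes> e 1\<close> with skew matrices of this shape;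
  up to sign these are also the component matrices of \<open>d e 8\<close> and \<open>d e 1\<close>.
\<close>

definition X8 :: "real \<Rightarrow> real \<Rightarrow> nat \<Rightarrow> nat \<Rightarrow> real" where
  "X8 p q i j = (if i = 2 then if j = 3 then p else 0
    else if i = 3 then if j = 2 then - p else 0
    else if i = 4 then if j = 5 then q else 0
    else if i = 5 then if j = 4 then - q else 0
    else if i = 6 then if j = 7 then - (p + q) else 0
    else if i = 7 then if j = 6 then p + q else 0 else 0)"

definition X1 :: "real \<Rightarrow> nat \<Rightarrow> nat \<Rightarrow> real" where
  "X1 s i j = (if i = 2 then if j = 4 \<or> j = 5 then - s else 0
    else if i = 3 then if j = 4 then s else if j = 5 then - s else 0
    else if i = 4 then if j = 2 then s else if j = 3 then - s else 0
    else if i = 5 then if j = 2 \<or> j = 3 then s else 0 else 0)"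

text \<open>The commutator of the two matrices, which becomes the coefficient of
  \<open>e 1 \<and> e 8\<close> in the curvature.\<close>

definition X18 :: "real \<Rightarrow> real \<Rightarrow> real \<Rightarrow> nat \<Rightarrow> nat \<Rightarrow> real" where
  "X18 p q s i j = (\<Sum>k=1..8. X1 s i k * X8 p q k j - X8 p q i k * X1 s k j)"

definition block_conn :: "(nat \<Rightarrow> diff_form) \<Rightarrow> real \<Rightarrow> real \<Rightarrow> real \<Rightarrow> conn_forms" where
  "block_conn e p q s i j x vs = X8 p q i j * e 8 x vs + X1 s i j * e 1 x vs"

lemma A_conn_eq: "A_conn e l m = block_conn e l l m"
  by (intro ext) (auto simp: A_conn_def block_conn_def X8_def X1_def)

lemma X8_skew: "X8 p q j i = - X8 p q i j"
  by (simp add: X8_def)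

lemma X1_skew: "X1 s j i = - X1 s i j"
  by (simp add: X1_def)

lemma X8_minus: "X8 (- p) (- q) i j = - X8 p q i j"
  by (simp add: X8_def)

lemma X8_margin: "X8 p q 1 j = 0" "X8 p q 8 j = 0" "X8 p q j 1 = 0" "X8 p q j 8 = 0"
  by (simp_all add: X8_def)

lemma X1_margin: "X1 s 1 j = 0" "X1 s 8 j = 0" "X1 s j 1 = 0" "X1 s j 8 = 0"
  by (simp_all add: X1_def)

text \<open>For p = q the matrix \<open>X8\<close> acts on the indices 2 to 5 as p times a complex
  structure that pairs 2 with 3 and 4 with 5, and \<open>X1\<close> is complex linear for it; on 6
  and 7 \<open>X1\<close> is zero. So the two matrices commute.\<close>

lemma X18_equal: "X18 p p s i j = 0" if "i \<in> {1..8}" "j \<in> {1..8}"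
proof -
  have "\<forall>i\<in>{1..8}. \<forall>j\<in>{1..8}. X18 p p s i j = 0"
    unfolding ball_1_8 X18_def sum_1_8 by (simp add: X8_def X1_def)
  with that show ?thesis by blast
qed

lemma sum_less_1_8: "(\<Sum>i=1..8. \<Sum>j\<in>{i<..8}. f i j) =
    f 1 2 + f 1 3 + f 1 4 + f 1 5 + f 1 6 + f 1 7 + f 1 8 + (f 2 3 + f 2 4 + f 2 5 + f 2 6 + f 2 7 + f 2 8)
    + (f 3 4 + f 3 5 + f 3 6 + f 3 7 + f 3 8) + (f 4 5 + f 4 6 + f 4 7 + f 4 8) + (f 5 6 + f 5 7 + f 5 8)
    + (f 6 7 + f 6 8) + f 7 (8::nat)" for f :: "nat \<Rightarrow> nat \<Rightarrow> real"
proof -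
  have "{1<..8::nat} = {2,3,4,5,6,7,8}" "{2<..8::nat} = {3,4,5,6,7,8}" "{3<..8::nat} = {4,5,6,7,8}"
    "{4<..8::nat} = {5,6,7,8}" "{5<..8::nat} = {6,7,8}" "{6<..8::nat} = {7,8}" "{7<..8::nat} = {8}"
    by auto
  then show ?thesis unfolding sum_1_8 by simp
qed

text \<open>The coefficients that \<open>p1\<close> sees; the first is the sum of the squares of p,
  q and p + q. The last sum is, up to a factor, the trace of \<open>X1\<close> times a commutator
  with \<open>X1\<close>, which vanishes by cyclicity.\<close>

lemma block_sums:
  "(\<Sum>i=1..8. \<Sum>j\<in>{i<..8}. (X8 p q i j)\<^sup>2) = 2 * p\<^sup>2 + 2 * q\<^sup>2 + 2 * p * q"
  "(\<Sum>i=1..8. \<Sum>j\<in>{i<..8}. (X1 s i j)\<^sup>2) = 4 * s\<^sup>2"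
  "(\<Sum>i=1..8. \<Sum>j\<in>{i<..8}. X1 s i j * X18 p q s i j) = 0"
  unfolding sum_less_1_8
  by (simp_all add: X8_def X1_def X18_def sum_1_8 power2_eq_square algebra_simps)

text \<open>Disjoint supports: \<open>X8\<close> stays within the blocks 23, 45 and 67, while
  \<open>X1\<close> maps between the blocks 23 and 45. The commutator also maps between these two
  blocks, whence \<open>X8_X18\<close>.\<close>

lemma X8_X1: "X8 p q i j * X1 s i j = 0"
  by (simp add: X8_def X1_def)

lemma X8_X18: "X8 p q i j * X18 p q s i j = 0" if "i \<in> {1..8}" "j \<in> {1..8}"
proof -
  have "\<forall>i\<in>{1..8}. \<forall>j\<in>{1..8}. X8 p q i j * X18 p q s i j = 0"
    unfolding ball_1_8 X18_def sum_1_8 by (simp add: X8_def X1_def)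
  with that show ?thesis by blast
qed

locale nil_coframe = coframe +
  fixes a b c :: real
  assumes d_e1: "ext_d (e 1) = ecomb e (d1_comb c)"
    and d_e8: "ext_d (e 8) = ecomb e (d8_comb a b)"
    and d_e: "i \<in> {2..7} \<Longrightarrow> ext_d (e i) = zero_form"
begin

abbreviation "W1 \<equiv> ecomb e (d1_comb c)"
abbreviation "W8 \<equiv> ecomb e (d8_comb a b)"

lemma ext_d_e: "i \<in> {1..8} \<Longrightarrow> ext_d (e i) = ecomb e (structure_comb a b c i)"
proof -
  assume "i \<in> {1..8}"
  then consider "i = 1" | "i = 8" | "i \<in> {2..7}" by fastforce
  then show ?thesis
    by cases (auto simp: structure_comb_def d_e1 d_e8 d_e zero_form_def ecomb_zero)
qed

lemma index_le8_simps [simp]: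
  "index_le8 []" "index_le8 ((r, is) # cs) \<longleftrightarrow> set is \<subseteq> {1..8} \<and> index_le8 cs"
  by (auto simp: index_le8_def)

lemma sorted_comb_simps [simp]:
  "sorted_comb []"
  "sorted_comb ((r, is) # cs) \<longleftrightarrow> set is \<subseteq> {1..8} \<and> sorted_wrt (<) is \<and> sorted_comb cs"
  by (auto simp: sorted_comb_def)

lemma Phi_form_eq: "Phi_form e = ecomb e Phi_comb"
  by (simp add: Phi_form_def Phi_comb_def)

lemma ext_d_Phi: "ext_d (Phi_form e) = ecomb e (dPhi_comb a b c)"
proof -
  have "ext_d (Phi_form e) = ecomb e (bind_comb Phi_comb (dmon (structure_comb a b c)))"
    unfolding Phi_form_eq by (rule ext_d_ecomb[OF ext_d_e]) (simp_all add: Phi_comb_def)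
  also have "\<dots> = ecomb e (dPhi_comb a b c)"
    by (rule ecomb_eqI) (simp_all add: comb_simps algebra_simps)
  finally show ?thesis .
qed

lemma torsion_eq: "hodge e E (ext_d (Phi_form e)) = ecomb e (torsion_comb a b c)"
proof -
  have "hodge e E (ext_d (Phi_form e)) = ecomb e (hodge_comb (dPhi_comb a b c))"
    unfolding ext_d_Phi by (rule hodge_ecomb_comb) (simp add: dPhi_comb_def)
  also have "\<dots> = ecomb e (torsion_comb a b c)"
    by (intro ext) (simp add: hodge_comb_def comb_simps)
  finally show ?thesis .
qed

abbreviation "T \<equiv> ecomb e (torsion_comb a b c)"

lemma balanced: "balanced e E (Phi_form e)"
proof -
  have "wedge T (ecomb e Phi_comb) = ecomb e (bind_comb Phi_comb (append_comb (torsion_comb a b c)))"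
    by (rule wedge_ecomb)
  also have "\<dots> = ecomb e []"
    by (rule ecomb_eqI) (simp_all add: comb_simps algebra_simps)
  finally show ?thesis
    unfolding balanced_def torsion_eq unfolding Phi_form_eq by (simp add: zero_form_def ecomb_zero)
qed

lemma T_eq: "T = (\<lambda>x vs. wedge (e 1) W1 x vs + wedge (e 8) W8 x vs)"
proof -
  have "ecomb e (cons_comb 1 (d1_comb c) @ cons_comb 8 (d8_comb a b)) = T"
    by (rule ecomb_eqI) (simp_all add: comb_simps)
  from this[symmetric] show ?thesis
    by (simp only: fun_eq_iff ecomb_append ecomb_cons_comb) simp
qed

lemma ext_d_T: "ext_d T x vs = wedge W1 W1 x vs + wedge W8 W8 x vs"
proof -
  have "ext_d T = ecomb e (bind_comb (torsion_comb a b c) (dmon (structure_comb a b c)))"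
    by (rule ext_d_ecomb[OF ext_d_e]) (simp_all add: torsion_comb_def)
  also have "\<dots> = ecomb e (bind_comb (d1_comb c) (append_comb (d1_comb c)) @
      bind_comb (d8_comb a b) (append_comb (d8_comb a b)))"
    by (rule ecomb_eq_normalized) (simp_all add: comb_simps algebra_simps)
  finally show ?thesis by (simp add: ecomb_append wedge_ecomb)
qed

lemma wedge_Phi_W1: "hodge e E (wedge W1 (Phi_form e)) = (\<lambda>x vs. - W1 x vs)"
proof -
  let ?ds = "[(c, [1,2,4,6,7,8]), (c, [1,2,5,6,7,8]), (- c, [1,3,4,6,7,8]), (c, [1,3,5,6,7,8])]"
  have "wedge W1 (Phi_form e) = ecomb e (bind_comb Phi_comb (append_comb (d1_comb c)))"
    unfolding Phi_form_eq by (rule wedge_ecomb)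
  also have "\<dots> = ecomb e ?ds"
    by (rule ecomb_eqI) (simp_all add: comb_simps algebra_simps)
  finally have "hodge e E (wedge W1 (Phi_form e)) = ecomb e (hodge_comb ?ds)"
    using hodge_ecomb_comb[of ?ds] by simp
  also have "\<dots> = (\<lambda>x vs. - W1 x vs)"
    by (intro ext) (simp add: hodge_comb_def comb_simps algebra_simps)
  finally show ?thesis .
qed

lemma wedge_Phi_W8: "hodge e E (wedge W8 (Phi_form e)) = (\<lambda>x vs. - W8 x vs)"
proof -
  let ?ds = "[(a + b, [1,2,3,4,5,8]), (- b, [1,2,3,6,7,8]), (- a, [1,4,5,6,7,8])]"
  have "wedge W8 (Phi_form e) = ecomb e (bind_comb Phi_comb (append_comb (d8_comb a b)))"
    unfolding Phi_form_eq by (rule wedge_ecomb)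
  also have "\<dots> = ecomb e ?ds"
    by (rule ecomb_eqI) (simp_all add: comb_simps algebra_simps)
  finally have "hodge e E (wedge W8 (Phi_form e)) = ecomb e (hodge_comb ?ds)"
    using hodge_ecomb_comb[of ?ds] by simp
  also have "\<dots> = (\<lambda>x vs. - W8 x vs)"
    by (intro ext) (simp add: hodge_comb_def comb_simps algebra_simps)
  finally show ?thesis .
qed

abbreviation "V \<equiv> emon e [1, 8]"

lemma wedge_e_e: "i \<in> {1..8} \<Longrightarrow> wedge (e i) (e i) x vs = 0"
  using emon_repeat[of i "[]" x vs] emon_pair[of i i] by simp

text \<open>The matrices are constant, so the derivative contributes only \<open>W8\<close> and
  \<open>W1\<close>. In the quadratic term \<open>e 1 \<and> e 1\<close> and
  \<open>e 8 \<and> e 8\<close> vanish and the mixed products antisymmetrise to the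
  commutator.\<close>

lemma curvature_block_conn:
  assumes "i \<in> {1..8}" "j \<in> {1..8}"
  shows "curvature (block_conn e p q s) i j =
    (\<lambda>x vs. X8 p q i j * W8 x vs + X1 s i j * W1 x vs + X18 p q s i j * V x vs)"
proof (intro ext)
  fix x :: "real^8" and vs :: "(real^8) list"
  have d: "ext_d (block_conn e p q s i j) x vs = X8 p q i j * W8 x vs + X1 s i j * W1 x vs"
    unfolding block_conn_def
    by (simp add: ext_d_add ext_d_scale diff_coeffs_scale diff_coeffs_e d_e1 d_e8)
  have V: "wedge (e 1) (e 8) x vs = V x vs" "wedge (e 8) (e 1) x vs = - V x vs"
    using emon_swap[of 1 8 "[]" x vs] by (simp_all add: emon_pair)
  have "wedge (block_conn e p q s i k) (block_conn e p q s k j) x vs =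
    (X1 s i k * X8 p q k j - X8 p q i k * X1 s k j) * V x vs" for k
    unfolding block_conn_def
    by (simp add: wedge_add_left wedge_add_right wedge_scale_left wedge_scale_right V wedge_e_e algebra_simps)
  then show "curvature (block_conn e p q s) i j x vs =
      X8 p q i j * W8 x vs + X1 s i j * W1 x vs + X18 p q s i j * V x vs"
    by (simp add: curvature_def d X18_def sum_distrib_right)
qed

lemma wedge_W_commute: "wedge W8 W1 x vs = wedge W1 W8 x vs" "wedge W1 V x vs = wedge V W1 x vs"
  "wedge W8 V x vs = wedge V W8 x vs" "wedge V V x vs = 0"
proof -
  have V: "V = ecomb e [(1, [1, 8])]" by (simp add: ecomb_split ecomb_zero)
  note eq = ecomb_eq_normalized[THEN fun_cong, THEN fun_cong]
  show "wedge W8 W1 x vs = wedge W1 W8 x vs" "wedge W1 V x vs = wedge V W1 x vs"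
    "wedge W8 V x vs = wedge V W8 x vs"
    unfolding V wedge_ecomb by (rule eq; simp add: comb_simps algebra_simps)+
  have "wedge V V = ecomb e []"
    unfolding V wedge_ecomb by (rule ecomb_eqI) (simp_all add: comb_simps)
  then show "wedge V V x vs = 0" by (simp add: ecomb_zero)
qed

lemma p1_block_conn:
  "p1 (block_conn e p q s) x vs =
    1 / (8 * pi\<^sup>2) * ((2 * p\<^sup>2 + 2 * q\<^sup>2 + 2 * p * q) * wedge W8 W8 x vs + 4 * s\<^sup>2 * wedge W1 W1 x vs)"
proof -
  have "wedge (curvature (block_conn e p q s) i j) (curvature (block_conn e p q s) i j) x vs =
    (X8 p q i j)\<^sup>2 * wedge W8 W8 x vs + (X1 s i j)\<^sup>2 * wedge W1 W1 x vs
    + (X1 s i j * X18 p q s i j) * (2 * wedge V W1 x vs)" if "i \<in> {1..8}" "j \<in> {1..8}" for i j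
  proof -
    have "wedge (curvature (block_conn e p q s) i j) (curvature (block_conn e p q s) i j) x vs =
      (X8 p q i j)\<^sup>2 * wedge W8 W8 x vs + (X1 s i j)\<^sup>2 * wedge W1 W1 x vs
      + (X8 p q i j * X1 s i j) * (2 * wedge W1 W8 x vs) + (X8 p q i j * X18 p q s i j) * (2 * wedge V W8 x vs)
      + (X1 s i j * X18 p q s i j) * (2 * wedge V W1 x vs)"
      unfolding curvature_block_conn[OF that]
      by (simp add: wedge_add_left wedge_add_right wedge_scale_left wedge_scale_right wedge_W_commute
        power2_eq_square algebra_simps)
    then show ?thesis by (simp add: X8_X1 X8_X18[OF that])
  qed
  then have "(\<Sum>i=1..8. \<Sum>j\<in>{i<..8}. wedge (curvature (block_conn e p q s) i j) (curvature (block_conn e p q s) i j) x vs)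
    = (\<Sum>i=1..8. \<Sum>j\<in>{i<..8}. (X8 p q i j)\<^sup>2 * wedge W8 W8 x vs + (X1 s i j)\<^sup>2 * wedge W1 W1 x vs
    + (X1 s i j * X18 p q s i j) * (2 * wedge V W1 x vs))"
    by (intro sum.cong refl) auto
  also have "\<dots> = (2 * p\<^sup>2 + 2 * q\<^sup>2 + 2 * p * q) * wedge W8 W8 x vs + 4 * s\<^sup>2 * wedge W1 W1 x vs"
    unfolding sum.distrib sum_distrib_right[symmetric] block_sums by simp
  finally show ?thesis by (simp only: p1_def)
qed

end

section \<open>Frame components of the torsion and of the Levi-Civita connection\<close>

context nil_coframe begin

lemma W_frame:
  assumes "i \<in> {1..8}" "j \<in> {1..8}"
  shows "W8 x [E i x, E j x] = X8 a b i j" "W1 x [E i x, E j x] = - X1 c i j"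
proof -
  have "\<forall>i\<in>{1..8}. \<forall>j\<in>{1..8}. W8 x [E i x, E j x] = X8 a b i j \<and> W1 x [E i x, E j x] = - X1 c i j"
    unfolding ball_1_8 by (simp add: comb_simps emon_pair_eval e_E X8_def X1_def)
  with assms show "W8 x [E i x, E j x] = X8 a b i j" "W1 x [E i x, E j x] = - X1 c i j" by blast+
qed

lemma wedge_one_form_3:
  assumes "one_form \<alpha>"
  shows "wedge \<alpha> \<beta> x [u, v, w] = \<alpha> x [u] * \<beta> x [v, w] - \<alpha> x [v] * \<beta> x [u, w] + \<alpha> x [w] * \<beta> x [u, v]"
  by (simp add: wedge_one_form_Cons[OF assms] wedge_one_form_Nil[OF assms] contract_def)

lemma linear_T: "j \<in> {1..8} \<Longrightarrow> i \<in> {1..8} \<Longrightarrow> linear (\<lambda>v. T x [v, E j x, E i x])"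
proof (rule linearI)
  fix u v :: "real^8" and r :: real
  assume ij: "j \<in> {1..8}" "i \<in> {1..8}"
  have W_add: "ecomb e cs x [u + v, w] = ecomb e cs x [u, w] + ecomb e cs x [v, w]"
    and W_scale: "ecomb e cs x [r *\<^sub>R u, w] = r * ecomb e cs x [u, w]"
    if "cs = d1_comb c \<or> cs = d8_comb a b" for cs w
    using that by (auto simp: comb_simps emon_pair_eval linear_add[OF linear_e] linear_cmul[OF linear_e] algebra_simps)
  show "T x [u + v, E j x, E i x] = T x [u, E j x, E i x] + T x [v, E j x, E i x]"
    unfolding T_eq by (simp add: wedge_one_form_3 one_form_e W_add linear_add[OF linear_e] algebra_simps)
  show "T x [r *\<^sub>R u, E j x, E i x] = r *\<^sub>R T x [u, E j x, E i x]"
    unfolding T_eq by (simp add: wedge_one_form_3 one_form_e W_scale linear_cmul[OF linear_e] algebra_simps)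
qed

text \<open>The frame components of T. The \<open>X8\<close> terms come from
  \<open>e 8 \<and> d e 8\<close> and the \<open>X1\<close> terms from
  \<open>e 1 \<and> d e 1\<close>; the signs are opposite because \<open>X1 c\<close> is minus the
  component matrix of \<open>d e 1\<close>.\<close>

definition tor :: "nat \<Rightarrow> nat \<Rightarrow> nat \<Rightarrow> real" where
  "tor i j k = (if i = 8 then X8 a b j k else 0) - (if j = 8 then X8 a b i k else 0)
    + (if k = 8 then X8 a b i j else 0) - (if i = 1 then X1 c j k else 0)
    + (if j = 1 then X1 c i k else 0) - (if k = 1 then X1 c i j else 0)"

lemma T_frame:
  assumes "i \<in> {1..8}" "j \<in> {1..8}" "k \<in> {1..8}"
  shows "T x [E i x, E j x, E k x] = tor i j k"
  unfolding T_eq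
  by (simp add: wedge_one_form_3 one_form_e W_frame[OF assms(1,2)] W_frame[OF assms(1,3)]
    W_frame[OF assms(2,3)] e_E[OF _ assms(1)] e_E[OF _ assms(2)] e_E[OF _ assms(3)] tor_def)

text \<open>The Koszul formula with the structure equations inserted: the value on
  \<open>E k\<close> of the Levi-Civita connection form with matrix indices i and j.\<close>

definition lc :: "nat \<Rightarrow> nat \<Rightarrow> nat \<Rightarrow> real" where
  "lc i j k = ((if k = 8 then X8 a b j i else 0) - (if i = 8 then X8 a b k j else 0)
      - (if j = 8 then X8 a b i k else 0) - (if k = 1 then X1 c j i else 0)
      + (if i = 1 then X1 c k j else 0) + (if j = 1 then X1 c i k else 0)) / 2"

lemma ext_d_e_frame:
  assumes "i \<in> {1..8}" "j \<in> {1..8}" "k \<in> {1..8}"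
  shows "ext_d (e i) x [E j x, E k x] =
    (if i = 8 then X8 a b j k else 0) - (if i = 1 then X1 c j k else 0)"
  using assms by (simp add: ext_d_e structure_comb_def W_frame ecomb_Nil)

text \<open>For p = q the curvature lies in the span of \<open>W1\<close> and \<open>W8\<close>,
  where wedging with \<Phi> and applying the Hodge star is multiplication by -1.\<close>

lemma instanton: "spin7_instanton e E (Phi_form e) (A_conn e l m)"
  unfolding spin7_instanton_def A_conn_eq
proof (intro ballI ext)
  fix i j :: nat and x :: "real^8" and vs :: "(real^8) list"
  assume ij: "i \<in> {1..8}" "j \<in> {1..8}"
  have "wedge (curvature (block_conn e l l m) i j) (Phi_form e) =
    (\<lambda>x vs. X8 l l i j * wedge W8 (Phi_form e) x vs + X1 m i j * wedge W1 (Phi_form e) x vs)"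
    by (simp add: curvature_block_conn[OF ij] X18_equal[OF ij] fun_eq_iff wedge_add_left wedge_scale_left)
  then show "hodge e E (wedge (curvature (block_conn e l l m) i j) (Phi_form e)) x vs =
      - curvature (block_conn e l l m) i j x vs"
    by (simp add: hodge_add hodge_scale wedge_Phi_W1 wedge_Phi_W8 curvature_block_conn[OF ij] X18_equal[OF ij])
qed

context
  fixes \<sigma>
  assumes lc: "levi_civita e E \<sigma>"
begin

lemma lc_one_form: "i \<in> {1..8} \<Longrightarrow> j \<in> {1..8} \<Longrightarrow> smooth_form 1 (\<sigma> i j)"
  using lc by (simp add: levi_civita_def)

lemma lc_frame:
  assumes "i \<in> {1..8}" "j \<in> {1..8}" "k \<in> {1..8}"
  shows "\<sigma> i j x [E k x] = lc i j k"
  unfolding levi_civita_frame[OF lc assms] using assms by (simp add: ext_d_e_frame lc_def)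

lemma lc_eval:
  assumes "i \<in> {1..8}" "j \<in> {1..8}"
  shows "\<sigma> i j x [v] = (\<Sum>k=1..8. lc i j k * e k x [v])"
proof -
  have "\<sigma> i j x [v] = (\<Sum>k=1..8. \<sigma> i j x [E k x] * e k x [v])"
    by (rule one_form_expand[OF smooth_form_linear[OF lc_one_form[OF assms]]])
  also have "\<dots> = (\<Sum>k=1..8. lc i j k * e k x [v])"
    using assms by (intro sum.cong refl) (simp add: lc_frame)
  finally show ?thesis .
qed

text \<open>Half the torsion cancels the Levi-Civita terms in which 1 or 8 is a matrix index and
  doubles those in which it is the form index. The result is a constant matrix along
  \<open>e 8\<close> and another along \<open>e 1\<close>.\<close>

lemma add_torsion_eq:
  assumes "i \<in> {1..8}" "j \<in> {1..8}"
  shows "add_torsion E \<sigma> T i j = block_conn e (- a) (- b) c i j"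
proof (intro ext)
  fix x :: "real^8" and vs :: "(real^8) list"
  show "add_torsion E \<sigma> T i j x vs = block_conn e (- a) (- b) c i j x vs"
  proof (cases "length vs = 1")
    case False
    have "T x (vs @ [E j x, E i x]) = 0"
      using False by (simp add: torsion_comb_def ecomb_Cons ecomb_Nil emon_length)
    moreover have "\<sigma> i j x vs = 0"
      using lc_one_form[OF assms] False by (simp add: smooth_form_def)
    ultimately show ?thesis
      using False by (simp add: add_torsion_def block_conn_def one_formD[OF one_form_e])
  next
    case True
    then obtain v where vs: "vs = [v]" by (metis One_nat_def length_0_conv length_Suc_conv)
    have "linear (\<lambda>v. T x [v, E j x, E i x])"
      using assms by (intro linear_T)
    then have "T x [v, E j x, E i x] = (\<Sum>k=1..8. T x [E k x, E j x, E i x] * e k x [v])"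
      using one_form_expand[of "\<lambda>x vs. T x (vs @ [E j x, E i x])" x v] by simp
    also have "\<dots> = (\<Sum>k=1..8. tor k j i * e k x [v])"
      using assms by (intro sum.cong refl) (simp add: T_frame)
    finally have "add_torsion E \<sigma> T i j x [v] = (\<Sum>k=1..8. (lc i j k + 1/2 * tor k j i) * e k x [v])"
      by (simp add: add_torsion_def lc_eval[OF assms] sum_distrib_left sum.distrib algebra_simps)
    moreover have "lc i j k + 1/2 * tor k j i =
        (if k = 8 then X8 (- a) (- b) i j else if k = 1 then X1 c i j else 0)" for k
    proof -
      have "X8 a b k i = - X8 a b i k" "X1 c k i = - X1 c i k" "X8 a b j i = - X8 a b i j" "X1 c j i = - X1 c i j"
        by (rule X8_skew X1_skew)+
      then show ?thesis
        unfolding lc_def tor_def X8_minus by (auto simp: field_simps)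
    qed
    ultimately show ?thesis
      by (simp add: vs block_conn_def sum_1_8)
  qed
qed

lemma curvature_add_torsion:
  assumes "i \<in> {1..8}" "j \<in> {1..8}"
  shows "curvature (add_torsion E \<sigma> T) i j = curvature (block_conn e (- a) (- b) c) i j"
  using assms add_torsion_eq by (intro curvature_cong)

lemma p1_add_torsion: "p1 (add_torsion E \<sigma> T) = p1 (block_conn e (- a) (- b) c)"
proof (intro ext)
  fix x :: "real^8" and vs :: "(real^8) list"
  show "p1 (add_torsion E \<sigma> T) x vs = p1 (block_conn e (- a) (- b) c) x vs"
    unfolding p1_def
    by (intro arg_cong2[where f = "(*)"] sum.cong refl) (simp add: curvature_add_torsion)
qed

text \<open>With d the denominator of \<alpha>', the difference of Pontryagin forms carries the
  coefficients 2 d and 4 (c^2 - m^2), up to the common factor 1 / (8 pi^2). The equation between the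
  parameters says that these agree, as the equal coefficients in \<open>ext_d_T\<close> demand; the
  scale then gives \<alpha>' = 2 / d.\<close>

lemma anomaly:
  assumes D: "3 * l\<^sup>2 < a\<^sup>2 + a * b + b\<^sup>2"
    and eq: "3 * l\<^sup>2 - 2 * m\<^sup>2 = a\<^sup>2 + a * b + b\<^sup>2 - 2 * c\<^sup>2"
  shows "anomaly_cancellation E \<sigma> T (A_conn e l m) (2 / (a\<^sup>2 + a * b + b\<^sup>2 - 3 * l\<^sup>2))"
proof -
  define d where "d = a\<^sup>2 + a * b + b\<^sup>2 - 3 * l\<^sup>2"
  have d: "d > 0" and m: "c\<^sup>2 - m\<^sup>2 = d / 2" using D eq by (simp_all add: d_def)
  have "ext_d T x vs = 2 * pi\<^sup>2 * (2 / d) * (p1 (add_torsion E \<sigma> T) x vs - p1 (A_conn e l m) x vs)" for x vs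
  proof -
    have "p1 (add_torsion E \<sigma> T) x vs - p1 (A_conn e l m) x vs =
        1 / (8 * pi\<^sup>2) * (2 * d * wedge W8 W8 x vs + 4 * (c\<^sup>2 - m\<^sup>2) * wedge W1 W1 x vs)"
      unfolding p1_add_torsion A_conn_eq p1_block_conn d_def by (simp add: algebra_simps power2_eq_square)
    also have "\<dots> = d / (4 * pi\<^sup>2) * (wedge W8 W8 x vs + wedge W1 W1 x vs)"
      unfolding m by (simp add: field_simps)
    finally show ?thesis using d by (simp add: ext_d_T)
  qed
  then show ?thesis using d by (simp add: anomaly_cancellation_def d_def fun_eq_iff)
qed

end

end

section \<open>The equations of motion in components\<close>

lemma X_squares:
  "(\<Sum>i=1..8. \<Sum>j=1..8. (X8 p q i j)\<^sup>2) = 4 * (p\<^sup>2 + q\<^sup>2 + p * q)"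
  "(\<Sum>i=1..8. \<Sum>j=1..8. (X1 s i j)\<^sup>2) = 8 * s\<^sup>2"
  unfolding sum_1_8 by (simp_all add: X8_def X1_def power2_eq_square algebra_simps)

context nil_coframe begin

lemma Rm_block_conn:
  assumes "i \<in> {1..8}" "j \<in> {1..8}" "k \<in> {1..8}" "l \<in> {1..8}"
  shows "Rm E (block_conn e p p s) x i j k l = X8 p p l k * X8 a b i j - X1 s l k * X1 c i j"
  using assms by (simp add: Rm_def frame_at_def curvature_block_conn X18_equal W_frame)

definition sq8 :: "nat \<Rightarrow> nat \<Rightarrow> real" where
  "sq8 i j = (\<Sum>m=1..8. X8 a b i m * X8 a b j m)"

definition sq1 :: "nat \<Rightarrow> nat \<Rightarrow> real" where
  "sq1 i j = (\<Sum>m=1..8. X1 c i m * X1 c j m)"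

text \<open>The cross terms vanish by disjointness of supports. What remains are the full squared
  norms 12 p^2 and 8 s^2, twice the half sums that enter \<open>p1\<close>.\<close>

lemma curvature_square:
  assumes "i \<in> {1..8}" "j \<in> {1..8}"
  shows "(\<Sum>m=1..8. \<Sum>k=1..8. \<Sum>l=1..8. Rm E (block_conn e p p s) x i m k l * Rm E (block_conn e p p s) x j m k l)
    = 12 * p\<^sup>2 * sq8 i j + 8 * s\<^sup>2 * sq1 i j"
proof -
  have "(\<Sum>m=1..8. \<Sum>k=1..8. \<Sum>l=1..8. Rm E (block_conn e p p s) x i m k l * Rm E (block_conn e p p s) x j m k l)
    = (\<Sum>m=1..8. \<Sum>k=1..8. \<Sum>l=1..8. (X8 p p l k)\<^sup>2 * (X8 a b i m * X8 a b j m) + (X1 s l k)\<^sup>2 * (X1 c i m * X1 c j m))"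
  proof (intro sum.cong refl)
    fix m k l :: nat assume "m \<in> {1..8}" "k \<in> {1..8}" "l \<in> {1..8}"
    then have "Rm E (block_conn e p p s) x i m k l * Rm E (block_conn e p p s) x j m k l =
      (X8 p p l k)\<^sup>2 * (X8 a b i m * X8 a b j m) + (X1 s l k)\<^sup>2 * (X1 c i m * X1 c j m)
      - (X8 p p l k * X1 s l k) * (X8 a b i m * X1 c j m + X1 c i m * X8 a b j m)"
      using assms by (simp add: Rm_block_conn power2_eq_square algebra_simps)
    then show "Rm E (block_conn e p p s) x i m k l * Rm E (block_conn e p p s) x j m k l =
      (X8 p p l k)\<^sup>2 * (X8 a b i m * X8 a b j m) + (X1 s l k)\<^sup>2 * (X1 c i m * X1 c j m)"
      by (simp add: X8_X1)
  qed
  also have "\<dots> = (\<Sum>m=1..8. (\<Sum>k=1..8. \<Sum>l=1..8. (X8 p p l k)\<^sup>2) * (X8 a b i m * X8 a b j m)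
      + (\<Sum>k=1..8. \<Sum>l=1..8. (X1 s l k)\<^sup>2) * (X1 c i m * X1 c j m))"
    by (simp only: sum.distrib sum_distrib_right)
  also have "(\<Sum>k=1..8. \<Sum>l=1..8. (X8 p p l k)\<^sup>2) = 12 * p\<^sup>2"
    by (subst sum.swap) (simp add: X_squares(1), simp add: power2_eq_square)
  also have "(\<Sum>k=1..8. \<Sum>l=1..8. (X1 s l k)\<^sup>2) = 8 * s\<^sup>2"
    by (subst sum.swap) (rule X_squares)
  finally show ?thesis
    by (simp add: sq8_def sq1_def sum.distrib sum_distrib_left)
qed

text \<open>Oriented so that numerals become column indices: entries with a symbolic index i or j
  then occur in one form only, and sums over the other index turn into polynomial identities in
  them.\<close>

lemma X8_skew_numeral: "X8 p q (numeral n) i = - X8 p q i (numeral n)"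
  by (rule X8_skew)

lemma X1_skew_numeral: "X1 s (numeral n) i = - X1 s i (numeral n)"
  by (rule X1_skew)

lemma X8_diag: "X8 p q i i = 0"
  by (simp add: X8_def)

lemma X1_diag: "X1 s i i = 0"
  by (simp add: X1_def)

text \<open>1 and 8 are the only indices singled out in \<open>tor\<close> and \<open>lc\<close>;
  for the remaining ones a symbolic index suffices.\<close>

lemma index_cases: "(i = 1 \<Longrightarrow> P) \<Longrightarrow> (i = 8 \<Longrightarrow> P) \<Longrightarrow> (i \<noteq> 1 \<Longrightarrow> i \<noteq> (8::nat) \<Longrightarrow> P) \<Longrightarrow> P"
  by blast

lemma torsion_square:
  "(\<Sum>m=1..8. \<Sum>n=1..8. tor i m n * tor j m n) = 2 * sq8 i j + 2 * sq1 i j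
    + (if i = 8 \<and> j = 8 then 4 * (a\<^sup>2 + b\<^sup>2 + a * b) else 0) + (if i = 1 \<and> j = 1 then 8 * c\<^sup>2 else 0)"
proof -
  note simps = tor_def sq8_def sq1_def X8_margin X1_margin sum_1_8
    X8_skew_numeral[of _ _ _ i] X8_skew_numeral[of _ _ _ j]
    X1_skew_numeral[of _ _ i] X1_skew_numeral[of _ _ j] X8_diag X1_diag
  show ?thesis
  proof (cases i rule: index_cases; cases j rule: index_cases)
    assume "i \<noteq> 1" "i \<noteq> 8" "j \<noteq> 1" "j \<noteq> 8"
    then show ?thesis by (simp add: simps algebra_simps)
  next
    assume "i = 1" "j = 1"
    then show ?thesis by (simp add: tor_def sq8_def sq1_def sum_1_8 X8_def X1_def power2_eq_square field_simps)
  next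
    assume "i = 8" "j = 8"
    then show ?thesis by (simp add: tor_def sq8_def sq1_def sum_1_8 X8_def X1_def power2_eq_square field_simps)
  next
    assume "i = 1" "j = 8"
    then show ?thesis by (simp add: tor_def sq8_def sq1_def sum_1_8 X8_def X1_def power2_eq_square field_simps)
  next
    assume "i = 8" "j = 1"
    then show ?thesis by (simp add: tor_def sq8_def sq1_def sum_1_8 X8_def X1_def power2_eq_square field_simps)
  qed (simp_all add: simps algebra_simps)
qed

text \<open>The Ricci curvature of a 2-step nilpotent group: minus half the squares of the structure
  matrices on the directions 2 to 7, and a quarter of their squared norms on the central directions
  1 and 8.\<close>

lemma ricci_sum:
  "(\<Sum>m=1..8. lc m j 8 * X8 a b m i - lc m j 1 * X1 c m i
      + (\<Sum>k=1..8. lc m k m * lc k j i - lc m k i * lc k j m))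
    = - 1/2 * (sq8 i j + sq1 i j) + (if i = 8 \<and> j = 8 then a\<^sup>2 + b\<^sup>2 + a * b else 0)
      + (if i = 1 \<and> j = 1 then 2 * c\<^sup>2 else 0)"
proof -
  note simps = lc_def sq8_def sq1_def X8_margin X1_margin sum_1_8
    X8_skew_numeral[of _ _ _ i] X8_skew_numeral[of _ _ _ j]
    X1_skew_numeral[of _ _ i] X1_skew_numeral[of _ _ j] X8_diag X1_diag
  show ?thesis
  proof (cases i rule: index_cases; cases j rule: index_cases)
    assume "i \<noteq> 1" "i \<noteq> 8" "j \<noteq> 1" "j \<noteq> 8"
    then show ?thesis by (simp add: simps algebra_simps)
  next
    assume "i = 1" "j = 1"
    then show ?thesis by (simp add: lc_def sq8_def sq1_def sum_1_8 X8_def X1_def power2_eq_square field_simps)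
  next
    assume "i = 8" "j = 8"
    then show ?thesis by (simp add: lc_def sq8_def sq1_def sum_1_8 X8_def X1_def power2_eq_square field_simps)
  next
    assume "i = 1" "j = 8"
    then show ?thesis by (simp add: lc_def sq8_def sq1_def sum_1_8 X8_def X1_def power2_eq_square field_simps)
  next
    assume "i = 8" "j = 1"
    then show ?thesis by (simp add: lc_def sq8_def sq1_def sum_1_8 X8_def X1_def power2_eq_square field_simps)
  qed (simp_all add: simps algebra_simps)
qed

text \<open>T is coclosed, being the Hodge dual of an exact form. Here this is verified in
  components.\<close>

lemma divergence_sum:
  "(\<Sum>m=1..8. \<Sum>l=1..8. lc l m m * tor l i j + lc l i m * tor m l j + lc l j m * tor m i l) = 0"
proof -
  note simps = lc_def tor_def X8_margin X1_margin sum_1_8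
    X8_skew_numeral[of _ _ _ i] X8_skew_numeral[of _ _ _ j]
    X1_skew_numeral[of _ _ i] X1_skew_numeral[of _ _ j] X8_diag X1_diag
  show ?thesis
  proof (cases i rule: index_cases; cases j rule: index_cases)
    assume "i \<noteq> 1" "i \<noteq> 8" "j \<noteq> 1" "j \<noteq> 8"
    then show ?thesis by (simp add: simps algebra_simps)
  next
    assume "i = 1" "j = 1"
    then show ?thesis by (simp add: lc_def tor_def sum_1_8 X8_def X1_def power2_eq_square field_simps)
  next
    assume "i = 8" "j = 8"
    then show ?thesis by (simp add: lc_def tor_def sum_1_8 X8_def X1_def power2_eq_square field_simps)
  next
    assume "i = 1" "j = 8"
    then show ?thesis by (simp add: lc_def tor_def sum_1_8 X8_def X1_def power2_eq_square field_simps)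
  next
    assume "i = 8" "j = 1"
    then show ?thesis by (simp add: lc_def tor_def sum_1_8 X8_def X1_def power2_eq_square field_simps)
  qed (simp_all add: simps algebra_simps)
qed

lemma nabla_comp_pair:
  "nabla_comp E \<sigma> \<alpha> x i [p, q] = frechet_derivative (\<lambda>y. \<alpha> y (frame_at E y [p, q])) (at x) (E i x) -
    (\<Sum>l=1..8. \<sigma> l p x [E i x] * \<alpha> x (frame_at E x [l, q]) + \<sigma> l q x [E i x] * \<alpha> x (frame_at E x [p, l]))"
  by (simp add: nabla_comp_def lessThan_Suc sum.distrib add_ac)

lemma nabla_comp_triple:
  "nabla_comp E \<sigma> \<alpha> x i [p, q, r] = frechet_derivative (\<lambda>y. \<alpha> y (frame_at E y [p, q, r])) (at x) (E i x) -
    (\<Sum>l=1..8. \<sigma> l p x [E i x] * \<alpha> x (frame_at E x [l, q, r]) + \<sigma> l q x [E i x] * \<alpha> x (frame_at E x [p, l, r])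
      + \<sigma> l r x [E i x] * \<alpha> x (frame_at E x [p, q, l]))"
  by (simp add: nabla_comp_def lessThan_Suc sum.distrib add_ac)

lemma block_conn_frame:
  "i \<in> {1..8} \<Longrightarrow> block_conn e p q s k l x [E i x] =
    (if i = 8 then X8 p q k l else if i = 1 then X1 s k l else 0)"
  by (simp add: block_conn_def e_E)

context
  fixes \<sigma>
  assumes lc: "levi_civita e E \<sigma>"
begin

text \<open>The connection forms have constant coefficients in the coframe, so only the structure
  equations contribute. Their expansion is known on single vectors, which is all that the derivative
  on a pair uses.\<close>

lemma ext_d_lc:
  assumes "i \<in> {1..8}" "j \<in> {1..8}" "m \<in> {1..8}" "n \<in> {1..8}"
  shows "ext_d (\<sigma> i j) x [E m x, E n x] = lc i j 8 * X8 a b m n - lc i j 1 * X1 c m n"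
proof -
  let ?\<tau> = "\<lambda>x vs. \<Sum>k=1..8. lc i j k * e k x vs"
  have "(\<lambda>y. \<sigma> i j y [v]) = (\<lambda>y. ?\<tau> y [v])" for v
    using lc_eval[OF lc assms(1,2)] by (simp only:)
  then have "ext_d (\<sigma> i j) x [E m x, E n x] = ext_d ?\<tau> x [E m x, E n x]"
    by (simp only: ext_d_pair)
  also have "\<dots> = (\<Sum>k=1..8. lc i j k * ext_d (e k) x [E m x, E n x])"
    unfolding sum_1_8
    by (simp add: ext_d_add ext_d_scale diff_coeffs_add diff_coeffs_scale diff_coeffs_e)
  also have "\<dots> = lc i j 8 * X8 a b m n - lc i j 1 * X1 c m n"
    unfolding sum_1_8 using assms(3,4) by (simp add: ext_d_e_frame)
  finally show ?thesis .
qed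

lemma Ric_lc:
  assumes "i \<in> {1..8}" "j \<in> {1..8}"
  shows "Ric E \<sigma> x i j = (\<Sum>m=1..8. lc m j 8 * X8 a b m i - lc m j 1 * X1 c m i
      + (\<Sum>k=1..8. lc m k m * lc k j i - lc m k i * lc k j m))"
  unfolding Ric_def Rm_def
proof (intro sum.cong refl)
  fix m :: nat assume m: "m \<in> {1..8}"
  have "wedge (\<sigma> m k) (\<sigma> k j) x [E m x, E i x] = lc m k m * lc k j i - lc m k i * lc k j m"
    if k: "k \<in> {1..8}" for k
  proof -
    have "one_form (\<sigma> m k)"
      using lc_one_form[OF lc m k] by (simp add: smooth_form_def one_form_def)
    then show ?thesis
      using m k assms
      by (simp add: wedge_one_form_Cons wedge_one_form_Nil contract_def lc_frame[OF lc])
  qed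
  then show "curvature \<sigma> m j x (frame_at E x [m, i]) = lc m j 8 * X8 a b m i - lc m j 1 * X1 c m i
      + (\<Sum>k=1..8. lc m k m * lc k j i - lc m k i * lc k j m)"
    using ext_d_lc[OF m assms(2) m assms(1)] by (simp add: curvature_def frame_at_def)
qed

text \<open>In the Ricci tensor minus a quarter of the torsion square the central parts cancel,
  leaving -(\<open>sq8\<close> + \<open>sq1\<close>). The difference of curvature squares is -4 d
  times the same sum, where \<alpha>' = 2 / d, so the halved constant 1 / d balances the first
  equation.\<close>

lemma equations_of_motion:
  assumes ab: "a = b" and l: "l\<^sup>2 < a\<^sup>2" and eq: "3 * l\<^sup>2 - 2 * m\<^sup>2 = 3 * a\<^sup>2 - 2 * c\<^sup>2"
  shows "heterotic_eom E \<sigma> T (A_conn e l m) (2 / (a\<^sup>2 + a * b + b\<^sup>2 - 3 * l\<^sup>2) / 2)"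
  unfolding heterotic_eom_def A_conn_eq
proof (intro conjI allI ballI)
  fix x :: "real^8" and i j :: nat
  assume ij: "i \<in> {1..8}" "j \<in> {1..8}"
  define d where "d = 3 * (a\<^sup>2 - l\<^sup>2)"
  have d: "d > 0" "a\<^sup>2 - l\<^sup>2 = d / 3" "c\<^sup>2 - m\<^sup>2 = d / 2" "a\<^sup>2 + a * b + b\<^sup>2 - 3 * l\<^sup>2 = d"
    using l eq ab by (simp_all add: d_def power2_eq_square)
  have H: "(\<Sum>m=1..8. \<Sum>n=1..8. T x (frame_at E x [i, m, n]) * T x (frame_at E x [j, m, n])) =
      (\<Sum>m=1..8. \<Sum>n=1..8. tor i m n * tor j m n)"
    using ij by (intro sum.cong refl) (simp add: frame_at_def T_frame)
  \<comment> \<open>For a = b the torsion connection has equal parameters too, so that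
    \<open>curvature_square\<close> applies to it.\<close>
  have blk: "block_conn e (- a) (- b) c = block_conn e (- a) (- a) c" using ab by simp
  have R: "(\<Sum>m=1..8. \<Sum>n=1..8. \<Sum>q=1..8.
        Rm E (add_torsion E \<sigma> T) x i m n q * Rm E (add_torsion E \<sigma> T) x j m n q) =
      (\<Sum>m=1..8. \<Sum>n=1..8. \<Sum>q=1..8.
        Rm E (block_conn e (- a) (- a) c) x i m n q * Rm E (block_conn e (- a) (- a) c) x j m n q)"
    using ij by (intro sum.cong refl) (simp add: Rm_def curvature_add_torsion[OF lc] blk)
  have "12 * l\<^sup>2 * sq8 i j + 8 * m\<^sup>2 * sq1 i j - (12 * (- a)\<^sup>2 * sq8 i j + 8 * c\<^sup>2 * sq1 i j)
    = - 12 * (a\<^sup>2 - l\<^sup>2) * sq8 i j - 8 * (c\<^sup>2 - m\<^sup>2) * sq1 i j"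
    by (simp add: algebra_simps)
  also have "\<dots> = - 4 * d * (sq8 i j + sq1 i j)"
    unfolding d by (simp add: algebra_simps)
  finally have diff: "12 * l\<^sup>2 * sq8 i j + 8 * m\<^sup>2 * sq1 i j - (12 * (- a)\<^sup>2 * sq8 i j + 8 * c\<^sup>2 * sq1 i j)
    = - 4 * d * (sq8 i j + sq1 i j)" .
  show "Ric E \<sigma> x i j
      - 1/4 * (\<Sum>m=1..8. \<Sum>n=1..8. T x (frame_at E x [i, m, n]) * T x (frame_at E x [j, m, n]))
      - 2 / (a\<^sup>2 + a * b + b\<^sup>2 - 3 * l\<^sup>2) / 2 / 4 *
       ((\<Sum>ma=1..8. \<Sum>a=1..8. \<Sum>b=1..8. Rm E (block_conn e l l m) x i ma a b * Rm E (block_conn e l l m) x j ma a b)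
         - (\<Sum>m=1..8. \<Sum>n=1..8. \<Sum>q=1..8.
            Rm E (add_torsion E \<sigma> T) x i m n q * Rm E (add_torsion E \<sigma> T) x j m n q)) = 0"
    unfolding R curvature_square[OF ij] diff H torsion_square Ric_lc[OF ij] ricci_sum d(4)
    using d(1) ab by (simp add: field_simps power2_eq_square)
next
  fix x :: "real^8" and j k :: nat
  assume jk: "j \<in> {1..8}" "k \<in> {1..8}"
  have "nabla_comp E \<sigma> T x i [i, j, k] =
      - (\<Sum>l=1..8. lc l i i * tor l j k + lc l j i * tor i l k + lc l k i * tor i j l)"
    if i: "i \<in> {1..8}" for i
  proof -
    have "(\<lambda>y. T y (frame_at E y [i, j, k])) = (\<lambda>y. tor i j k)"
      using i jk by (simp add: frame_at_def T_frame)
    then have "nabla_comp E \<sigma> T x i [i, j, k] = - (\<Sum>l=1..8. \<sigma> l i x [E i x] * T x (frame_at E x [l, j, k])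
        + \<sigma> l j x [E i x] * T x (frame_at E x [i, l, k]) + \<sigma> l k x [E i x] * T x (frame_at E x [i, j, l]))"
      by (simp add: nabla_comp_triple)
    also have "\<dots> = - (\<Sum>l=1..8. lc l i i * tor l j k + lc l j i * tor i l k + lc l k i * tor i j l)"
      using i jk by (intro arg_cong[where f = uminus] sum.cong refl) (simp add: frame_at_def T_frame lc_frame[OF lc])
    finally show ?thesis .
  qed
  then have "(\<Sum>i=1..8. nabla_comp E \<sigma> T x i [i, j, k]) =
    - (\<Sum>i=1..8. \<Sum>l=1..8. lc l i i * tor l j k + lc l j i * tor i l k + lc l k i * tor i j l)"
    by (simp add: sum_negf)
  then show "(\<Sum>i=1..8. nabla_comp E \<sigma> T x i [i, j, k]) = 0"
    by (simp add: divergence_sum)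
next
  fix x :: "real^8" and j s t :: nat
  assume jst: "j \<in> {1..8}" "s \<in> {1..8}" "t \<in> {1..8}"
  define F where "F s t i j = X8 l l s t * X8 a b i j - X1 m s t * X1 c i j" for s t i j
  have F: "curvature (block_conn e l l m) s t y (frame_at E y [i, j]) = F s t i j"
    if "s \<in> {1..8}" "t \<in> {1..8}" "i \<in> {1..8}" "j \<in> {1..8}" for s t i j y
    using that by (simp add: F_def frame_at_def curvature_block_conn X18_equal W_frame)
  have F0: "F s t 1 j = 0" "F s t 8 j = 0" for s t j
    by (simp_all add: F_def X8_margin X1_margin)
  show "(\<Sum>i=1..8. nabla_comp E (add_torsion E \<sigma> T) (curvature (block_conn e l l m) s t) x i [i, j] +
      (\<Sum>u=1..8. block_conn e l l m s u x [E i x] * curvature (block_conn e l l m) u t x (frame_at E x [i, j])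
         - curvature (block_conn e l l m) s u x (frame_at E x [i, j]) * block_conn e l l m u t x [E i x])) = 0"
  \<comment> \<open>Every summand vanishes by itself. For i other than 1 and 8 all connection forms
    are zero on \<open>E i\<close>; for i = 1 or 8 the curvature has no component along
    \<open>E i\<close> and the i-th columns of the connection matrices are zero.\<close>
  proof (intro sum.neutral ballI)
    fix i :: nat assume i: "i \<in> {1..8}"
    have "(\<lambda>y. curvature (block_conn e l l m) s t y (frame_at E y [i, j])) = (\<lambda>y. F s t i j)"
      using i jst by (simp add: F)
    then have "nabla_comp E (add_torsion E \<sigma> T) (curvature (block_conn e l l m) s t) x i [i, j] =
      - (\<Sum>k=1..8. add_torsion E \<sigma> T k i x [E i x] * curvature (block_conn e l l m) s t x (frame_at E x [k, j])
        + add_torsion E \<sigma> T k j x [E i x] * curvature (block_conn e l l m) s t x (frame_at E x [i, k]))"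
      by (simp add: nabla_comp_pair)
    also have "\<dots> = - (\<Sum>k=1..8. block_conn e (- a) (- b) c k i x [E i x] * F s t k j
        + block_conn e (- a) (- b) c k j x [E i x] * F s t i k)"
      using i jst by (intro arg_cong[where f = uminus] sum.cong refl) (simp add: F add_torsion_eq[OF lc])
    also have "\<dots> = 0"
      using i by (cases i rule: index_cases) (simp_all add: block_conn_frame X8_margin X1_margin F0)
    finally have "nabla_comp E (add_torsion E \<sigma> T) (curvature (block_conn e l l m) s t) x i [i, j] = 0" .
    moreover have "(\<Sum>u=1..8. block_conn e l l m s u x [E i x] * curvature (block_conn e l l m) u t x (frame_at E x [i, j])
         - curvature (block_conn e l l m) s u x (frame_at E x [i, j]) * block_conn e l l m u t x [E i x]) = 0"
      using i jst by (intro sum.neutral ballI) (auto simp: F block_conn_frame F0)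
    ultimately show "nabla_comp E (add_torsion E \<sigma> T) (curvature (block_conn e l l m) s t) x i [i, j] +
      (\<Sum>u=1..8. block_conn e l l m s u x [E i x] * curvature (block_conn e l l m) u t x (frame_at E x [i, j])
         - curvature (block_conn e l l m) s u x (frame_at E x [i, j]) * block_conn e l l m u t x [E i x]) = 0"
      by simp
  qed
qed

end

end

section \<open>Smooth maps\<close>

lemma Ck_SucI:
  assumes "\<And>x. (f has_derivative f' x) (at x)" "\<And>v. Ck k (\<lambda>x. f' x v)"
  shows "Ck (Suc k) f"
proof -
  have "frechet_derivative f (at x) = f' x" for x
    using frechet_derivative_at[OF assms(1)] by simp
  then show ?thesis using assms by (auto simp: differentiable_def)
qed

lemma Ck_deriv: "Ck (Suc k) f \<Longrightarrow> (f has_derivative frechet_derivative f (at x)) (at x)"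
  by (simp add: frechet_derivative_works[symmetric])

lemma Ck_const: "Ck k (\<lambda>x. t)"
proof (induction k arbitrary: t)
  case (Suc k)
  show ?case by (rule Ck_SucI[OF has_derivative_const Suc])
qed simp

lemma Ck_Suc_imp: "Ck (Suc k) f \<Longrightarrow> Ck k f"
proof (induction k arbitrary: f)
  case 0
  then show ?case
    by (simp add: continuous_at_imp_continuous_on differentiable_imp_continuous_within)
next
  case (Suc k)
  then show ?case by simp
qed

lemma Ck_add: "Ck k f \<Longrightarrow> Ck k g \<Longrightarrow> Ck k (\<lambda>x. f x + g x)"
proof (induction k arbitrary: f g)
  case (Suc k)
  show ?case
    by (rule Ck_SucI[OF has_derivative_add[OF Ck_deriv[OF Suc.prems(1)] Ck_deriv[OF Suc.prems(2)]]])
      (use Suc in auto)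
qed (simp add: continuous_on_add)

lemma Ck_linear: "bounded_linear L \<Longrightarrow> Ck k f \<Longrightarrow> Ck k (\<lambda>x. L (f x))"
proof (induction k arbitrary: f)
  case 0
  then show ?case by (simp add: bounded_linear.continuous_on)
next
  case (Suc k)
  show ?case
    by (rule Ck_SucI[OF bounded_linear.has_derivative[OF Suc.prems(1) Ck_deriv[OF Suc.prems(2)]]])
      (use Suc in auto)
qed

lemma Ck_scaleR: "Ck k f \<Longrightarrow> Ck k g \<Longrightarrow> Ck k (\<lambda>x. f x *\<^sub>R g x)"
proof (induction k arbitrary: f g)
  case (Suc k)
  show ?case
    by (rule Ck_SucI[OF has_derivative_scaleR[OF Ck_deriv[OF Suc.prems(1)] Ck_deriv[OF Suc.prems(2)]]])
      (use Suc.prems Suc.prems[THEN Ck_Suc_imp] in \<open>intro Ck_add Suc.IH; simp\<close>)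
qed (simp add: continuous_on_scaleR)

lemma Ck_sum: "(\<And>i. i \<in> I \<Longrightarrow> Ck k (f i)) \<Longrightarrow> Ck k (\<lambda>x. \<Sum>i\<in>I. f i x)"
  by (induction I rule: infinite_finite_induct) (auto intro: Ck_const Ck_add)

text \<open>The chain rule differentiates g in a direction that moves with the point, whereas
  \<open>Ck\<close> speaks of fixed directions. Expanding that direction in the basis leaves
  products of functions covered by the induction hypothesis.\<close>

lemma Ck_compose:
  fixes f :: "'a::euclidean_space \<Rightarrow> 'b::euclidean_space"
  shows "Ck k g \<Longrightarrow> Ck k f \<Longrightarrow> Ck k (\<lambda>x. g (f x))"
proof (induction k arbitrary: g)
  case 0
  then show ?case using continuous_on_compose2[of UNIV g UNIV f] by simp
next
  case (Suc k)
  have g: "(g has_derivative frechet_derivative g (at y)) (at y)" for y using Ck_deriv[OF Suc.prems(1)] .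
  have f: "(f has_derivative frechet_derivative f (at x)) (at x)" for x using Ck_deriv[OF Suc.prems(2)] .
  have "frechet_derivative g (at y) v = (\<Sum>b\<in>Basis. (v \<bullet> b) *\<^sub>R frechet_derivative g (at y) b)" for y v
    using linear_sum[OF has_derivative_linear[OF g], of y "\<lambda>b. (v \<bullet> b) *\<^sub>R b" Basis]
      linear_cmul[OF has_derivative_linear[OF g]] by (simp add: euclidean_representation)
  then have eq: "(\<lambda>x. frechet_derivative g (at (f x)) (frechet_derivative f (at x) v)) =
      (\<lambda>x. \<Sum>b\<in>Basis. (frechet_derivative f (at x) v \<bullet> b) *\<^sub>R frechet_derivative g (at (f x)) b)" for v
    by (intro ext)
  have "Ck k (\<lambda>x. frechet_derivative g (at (f x)) (frechet_derivative f (at x) v))" for v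
    unfolding eq
  proof (intro Ck_sum Ck_scaleR)
    fix b :: 'b
    have "Ck k (\<lambda>x. frechet_derivative f (at x) v)" using Suc.prems(2) by simp
    then show "Ck k (\<lambda>x. frechet_derivative f (at x) v \<bullet> b)"
      by (rule Ck_linear[OF bounded_linear_inner_left])
    show "Ck k (\<lambda>x. frechet_derivative g (at (f x)) b)"
      using Suc.prems(1) by (intro Suc.IH[OF _ Ck_Suc_imp[OF Suc.prems(2)]]) simp
  qed
  then show ?case
    by (intro Ck_SucI[OF diff_chain_at[OF f g, unfolded o_def]])
qed

lemma smoothI:
  assumes "\<And>x. (f has_derivative f' x) (at x)" "\<And>v. smooth (\<lambda>x. f' x v)"
  shows "smooth f"
  unfolding smooth_def
proof
  fix k
  have "Ck (Suc k) f" using assms by (intro Ck_SucI) (auto simp: smooth_def)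
  then show "Ck k f" by (rule Ck_Suc_imp)
qed

lemma smooth_const: "smooth (\<lambda>x. t)"
  and smooth_add: "smooth f \<Longrightarrow> smooth g \<Longrightarrow> smooth (\<lambda>x. f x + g x)"
  and smooth_scaleR: "smooth h \<Longrightarrow> smooth g \<Longrightarrow> smooth (\<lambda>x. h x *\<^sub>R g x)"
  and smooth_linear: "bounded_linear L \<Longrightarrow> smooth f \<Longrightarrow> smooth (\<lambda>x. L (f x))"
  unfolding smooth_def by (auto intro: Ck_const Ck_add Ck_scaleR Ck_linear)

lemma smooth_compose:
  fixes f :: "'a::euclidean_space \<Rightarrow> 'b::euclidean_space"
  shows "smooth g \<Longrightarrow> smooth f \<Longrightarrow> smooth (\<lambda>x. g (f x))"
  unfolding smooth_def by (auto intro: Ck_compose)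

lemma smooth_mult: "smooth f \<Longrightarrow> smooth g \<Longrightarrow> smooth (\<lambda>x. f x * g x :: real)"
  using smooth_scaleR[of f g] by simp

lemma smooth_minus: "smooth f \<Longrightarrow> smooth (\<lambda>x. - f x)"
  using smooth_linear[OF bounded_linear_minus[OF bounded_linear_ident]] by blast

lemma smooth_diff: "smooth f \<Longrightarrow> smooth g \<Longrightarrow> smooth (\<lambda>x. f x - g x)"
  using smooth_add[OF _ smooth_minus, of f g] by simp

lemma smooth_ident: "smooth (\<lambda>x. x)"
  by (rule smoothI[OF has_derivative_ident]) (rule smooth_const)

lemma smooth_continuous: "smooth f \<Longrightarrow> continuous_on UNIV f"
  unfolding smooth_def by (metis Ck.simps(1))

lemma smooth_frechet: "smooth f \<Longrightarrow> smooth (\<lambda>x. frechet_derivative f (at x) v)"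
  unfolding smooth_def by (metis Ck.simps(2))

section \<open>Closed 1-forms are exact\<close>

text \<open>The primitive is the integral of \<open>A (t *\<^sub>R x) x\<close> over t in [0, 1].
  After differentiation under the integral sign, closedness makes the integrand an exact
  t-derivative.\<close>

lemma poincare:
  fixes A :: "'a::euclidean_space \<Rightarrow> 'a \<Rightarrow> real"
  assumes lin: "\<And>x. linear (A x)" and sm: "\<And>v. smooth (\<lambda>x. A x v)"
    and closed: "\<And>x u v. frechet_derivative (\<lambda>y. A y v) (at x) u = frechet_derivative (\<lambda>y. A y u) (at x) v"
  obtains f where "\<And>x. (f has_derivative A x) (at x)"
proof -
  define D where "D v x = frechet_derivative (\<lambda>y. A y v) (at x)" for v x
  have D: "((\<lambda>y. A y v) has_derivative D v x) (at x)" for v x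
    unfolding D_def by (rule smooth_has_derivative[OF sm])
  have linD: "linear (D v x)" for v x using D has_derivative_linear by blast
  \<comment> \<open>Closedness exchanges the vector slot with the direction of differentiation, so
    linearity in the one gives linearity in the other.\<close>
  have D_sum: "D v x u = (\<Sum>b\<in>Basis. (v \<bullet> b) * D b x u)" for v x u
  proof -
    have "D v x u = D u x (\<Sum>b\<in>Basis. (v \<bullet> b) *\<^sub>R b)"
      using closed[of v x u] by (simp add: D_def euclidean_representation)
    also have "\<dots> = (\<Sum>b\<in>Basis. (v \<bullet> b) * D b x u)"
      using closed[of u x] by (simp add: linear_sum[OF linD] linear_cmul[OF linD]) (simp add: D_def)
    finally show ?thesis .
  qed
  define F where "F x t v = t * D x (t *\<^sub>R x) v + A (t *\<^sub>R x) v" for x v and t :: real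
  have linF: "linear (F x t)" for x t
    unfolding F_def using linD[of x "t *\<^sub>R x"] lin[of "t *\<^sub>R x"] by (auto simp: linear_iff algebra_simps)
  have F: "((\<lambda>x. A (t *\<^sub>R x) x) has_derivative F x t) (at x)" for x t
  proof -
    have "((\<lambda>y. A (t *\<^sub>R y) v) has_derivative (\<lambda>u. D v (t *\<^sub>R x) (t *\<^sub>R u))) (at x)" for v
      by (rule has_derivative_compose[OF _ D, where f = "\<lambda>y. t *\<^sub>R y" and f' = "\<lambda>u. t *\<^sub>R u"])
        (auto intro!: derivative_eq_intros)
    from has_derivative_pairing[OF lin this has_derivative_ident]
    show ?thesis by (simp add: F_def[abs_def] linear_cmul[OF linD])
  qed
  have cont_A: "continuous_on UNIV (\<lambda>(x, t). A (t *\<^sub>R x) v)" for v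
    unfolding case_prod_beta
    by (rule continuous_on_compose2[OF smooth_continuous[OF sm]]) (auto intro!: continuous_intros)
  have cont_D: "continuous_on UNIV (\<lambda>(x, t). D b (t *\<^sub>R x) v)" for b v
    unfolding case_prod_beta D_def
    by (rule continuous_on_compose2[OF smooth_continuous[OF smooth_frechet[OF sm]]]) (auto intro!: continuous_intros)
  have cont_F: "continuous_on UNIV (\<lambda>(x, t). F x t v)" for v
  proof -
    have "(\<lambda>(x, t). F x t v) = (\<lambda>p. snd p * (\<Sum>b\<in>Basis. (fst p \<bullet> b) * (\<lambda>(x, t). D b (t *\<^sub>R x) v) p)
        + (\<lambda>(x, t). A (t *\<^sub>R x) v) p)"
      by (auto simp: F_def D_sum[symmetric])
    then show ?thesis by (simp only:) (intro continuous_intros cont_D cont_A)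
  qed
  \<comment> \<open>The Leibniz rule takes the derivative as a continuous family of bounded linear
    maps; its continuity is checked on components.\<close>
  define B where "B x t = Blinfun (F x t)" for x t
  have B: "blinfun_apply (B x t) = F x t" for x t
    unfolding B_def by (rule bounded_linear_Blinfun_apply) (use linF linear_conv_bounded_linear in blast)
  have cont_B: "continuous_on (UNIV \<times> cbox 0 1) (\<lambda>(x, t). B x t)"
    unfolding case_prod_beta
    by (rule continuous_on_blinfun_componentwise)
      (use continuous_on_subset[OF cont_F subset_UNIV] in \<open>simp add: B case_prod_beta\<close>)
  define f where "f x = integral (cbox 0 1) (\<lambda>t::real. A (t *\<^sub>R x) x)" for x
  have cont_slice: "continuous_on (cbox 0 1) (\<lambda>t. h x t)" if "continuous_on UNIV (\<lambda>(x, t). h x t)"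
    for h :: "'a \<Rightarrow> real \<Rightarrow> real" and x
  proof -
    have "continuous_on (cbox 0 1) (\<lambda>t::real. (x, t))" by (intro continuous_intros)
    from continuous_on_compose2[OF that this] show ?thesis by simp
  qed
  have "(f has_derivative A x) (at x)" for x
  proof -
    have "(f has_derivative integral (cbox 0 1) (B x)) (at x within UNIV)"
      unfolding f_def
    proof (rule leibniz_rule)
      show "((\<lambda>x. A (t *\<^sub>R x) x) has_derivative blinfun_apply (B x t)) (at x within UNIV)" for x t
        using F by (simp add: B)
      show "(\<lambda>t. A (t *\<^sub>R x) x) integrable_on cbox 0 1" for x
      proof (rule integrable_continuous)
        show "continuous_on (cbox 0 1) (\<lambda>t. A (t *\<^sub>R x) x)" using cont_slice[OF cont_A[of x], of x] .
      qed
    qed (use cont_B in auto)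
    moreover have "blinfun_apply (integral (cbox 0 1) (B x)) = A x"
    proof (rule ext)
      fix v
      have "B x integrable_on cbox 0 1"
      proof (rule integrable_continuous)
        show "continuous_on (cbox 0 1) (B x)"
        proof -
          have "continuous_on (cbox 0 1) (\<lambda>t::real. (x, t))" by (intro continuous_intros)
          from continuous_on_compose2[OF cont_B this] show ?thesis by auto
        qed
      qed
      then have "blinfun_apply (integral (cbox 0 1) (B x)) v = integral (cbox 0 1) (\<lambda>t. F x t v)"
        by (simp only: blinfun_apply_integral B)
      \<comment> \<open>By closedness \<open>F x t v\<close> is the t-derivative of
        \<open>t * A (t *\<^sub>R x) v\<close>, whose boundary values are \<open>A x v\<close> and
        0.\<close>
      also have "((\<lambda>t. F x t v) has_integral 1 * A (1 *\<^sub>R x) v - 0 * A (0 *\<^sub>R x) v) {0..1}"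
      proof (rule fundamental_theorem_of_calculus)
        fix t :: real
        have "((\<lambda>t. A (t *\<^sub>R x) v) has_derivative (\<lambda>h. D v (t *\<^sub>R x) (h *\<^sub>R x))) (at t)"
          by (rule has_derivative_compose[OF _ D, where f = "\<lambda>t. t *\<^sub>R x" and f' = "\<lambda>h. h *\<^sub>R x"])
            (auto intro!: derivative_eq_intros)
        then have "((\<lambda>t. t * A (t *\<^sub>R x) v) has_derivative (\<lambda>h. t * D v (t *\<^sub>R x) (h *\<^sub>R x) + h * A (t *\<^sub>R x) v)) (at t)"
          by (intro has_derivative_mult has_derivative_ident)
        moreover have "D v (t *\<^sub>R x) (h *\<^sub>R x) = h * D x (t *\<^sub>R x) v" for h
          using closed by (simp add: linear_cmul[OF linD]) (simp add: D_def)
        ultimately have "((\<lambda>t. t * A (t *\<^sub>R x) v) has_vector_derivative F x t v) (at t)"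
          unfolding has_vector_derivative_def F_def by (simp add: algebra_simps)
        then show "((\<lambda>t. t * A (t *\<^sub>R x) v) has_vector_derivative F x t v) (at t within {0..1})"
          by (rule has_vector_derivative_at_within)
      qed simp
      then have "integral (cbox 0 1) (\<lambda>t. F x t v) = A x v"
        by (simp add: integral_unique)
      finally show "blinfun_apply (integral (cbox 0 1) (B x)) v = A x v" .
    qed
    ultimately show ?thesis by simp
  qed
  then show ?thesis by (rule that)
qed

lemma exact_one_form:
  assumes \<alpha>: "smooth_form 1 \<alpha>" and closed: "\<And>x u v. ext_d \<alpha> x [u, v] = 0"
  obtains f where "smooth f" "f p = 0" "\<And>x. (f has_derivative (\<lambda>v. \<alpha> x [v])) (at x)"
proof -
  have sm: "smooth (\<lambda>x. \<alpha> x [v])" for v using \<alpha> by (simp add: smooth_form_def)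
  obtain f where f: "\<And>x. (f has_derivative (\<lambda>v. \<alpha> x [v])) (at x)"
  proof (rule poincare[of "\<lambda>x v. \<alpha> x [v]"])
    show "linear (\<lambda>v. \<alpha> x [v])" for x by (rule smooth_form_linear[OF \<alpha>])
    show "frechet_derivative (\<lambda>y. \<alpha> y [v]) (at x) u = frechet_derivative (\<lambda>y. \<alpha> y [u]) (at x) v" for x u v
      using closed[of x u v] by (simp add: ext_d_pair)
  qed (use sm in auto)
  have f': "((\<lambda>x. f x - f p) has_derivative (\<lambda>v. \<alpha> x [v])) (at x)" for x
    using has_derivative_diff[OF f has_derivative_const] by simp
  show thesis
    by (rule that[of "\<lambda>x. f x - f p"]) (use smoothI[OF f' sm] f' in auto)
qed

lemma smooth_form_fun_mult:
  assumes "smooth f" "smooth_form k \<alpha>"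
  shows "smooth_form k (\<lambda>x vs. f x * \<alpha> x vs)"
  using assms(2) unfolding smooth_form_def
  by (auto simp: linear_iff algebra_simps intro!: smooth_mult assms(1))

lemma smooth_form_add:
  assumes "smooth_form k \<alpha>" "smooth_form k \<beta>"
  shows "smooth_form k (\<lambda>x vs. \<alpha> x vs + \<beta> x vs)"
  using assms unfolding smooth_form_def
  by (auto simp: linear_iff algebra_simps intro!: smooth_add)

lemma smooth_form_diff_coeffs: "smooth_form k \<alpha> \<Longrightarrow> diff_coeffs \<alpha>"
  unfolding smooth_form_def diff_coeffs_def by (auto intro: smooth_differentiable)

lemma ext_d_fun_mult:
  assumes "diff_coeffs \<alpha>" and f: "(f has_derivative f') (at x)"
  shows "ext_d (\<lambda>x vs. f x * \<alpha> x vs) x [u, v] =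
    f' u * \<alpha> x [v] - f' v * \<alpha> x [u] + f x * ext_d \<alpha> x [u, v]"
proof -
  have "frechet_derivative (\<lambda>y. f y * \<alpha> y [v]) (at x) u =
      f x * frechet_derivative (\<lambda>y. \<alpha> y [v]) (at x) u + f' u * \<alpha> x [v]" for u v
  proof (rule frechet_derivativeI)
    have "((\<lambda>y. \<alpha> y [v]) has_derivative frechet_derivative (\<lambda>y. \<alpha> y [v]) (at x)) (at x)"
      using assms(1) by (simp add: diff_coeffs_def frechet_derivative_works[symmetric])
    then show "((\<lambda>y. f y * \<alpha> y [v]) has_derivative
        (\<lambda>u. f x * frechet_derivative (\<lambda>y. \<alpha> y [v]) (at x) u + f' u * \<alpha> x [v])) (at x)"
      by (rule has_derivative_mult[OF f])
  qed
  then show ?thesis by (simp add: ext_d_pair algebra_simps)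
qed

lemma has_derivative_eq:
  fixes f g :: "'a::real_normed_vector \<Rightarrow> real"
  assumes "\<And>x. (f has_derivative D x) (at x)" "\<And>x. (g has_derivative D x) (at x)" "f p = g p"
  shows "f x = g x"
proof -
  have "((\<lambda>x. f x - g x) has_derivative (\<lambda>v. 0)) (at x within UNIV)" for x
    using has_derivative_diff[OF assms(1,2)] by simp
  then obtain k where "\<And>x. f x - g x = k"
    using has_derivative_zero_constant[of UNIV "\<lambda>x. f x - g x"] by auto
  with assms(3) show ?thesis by (metis eq_iff_diff_eq_0)
qed

section \<open>Local isomorphisms of groups\<close>

text \<open>
  A local homeomorphism that intertwines the group law with a group law \<open>M\<close> on a simply connected space
  is a covering, because the translates of a small neighbourhood of the unit are sheets.
\<close>

lemma local_isomorphism_bij: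
  fixes \<psi> :: "'a::euclidean_space \<Rightarrow> 'a" and G (structure)
  assumes G: "group G" "carrier G = UNIV"
    and left: "\<And>h. continuous_on UNIV (\<lambda>x. h \<otimes> x)"
    and hom: "\<And>h x. \<psi> (h \<otimes> x) = M (\<psi> h) (\<psi> x)"
    and one: "\<And>p. M p (\<psi> \<one>) = p"
    and cancel: "\<And>p p' q. M p q = M p' q \<Longrightarrow> p = p'"
    and L: "\<And>p q. L p (M p q) = q" "\<And>p q. M p (L p q) = q"
    and contM: "\<And>p. continuous_on UNIV (M p)" and contL: "\<And>p. continuous_on UNIV (L p)"
    and cont: "continuous_on UNIV \<psi>"
    and U: "open U" "\<one> \<in> U" "open V" "homeomorphism U V \<psi> \<phi>"
  shows "bij \<psi> \<and> continuous_on UNIV (inv_into UNIV \<psi>)"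
proof -
  interpret group G by (rule G)
  have [simp]: "x \<in> carrier G" for x using G(2) by simp
  have im: "\<psi> ` U = V" and \<phi>: "\<And>u. u \<in> U \<Longrightarrow> \<phi> (\<psi> u) = u" "\<And>y. y \<in> V \<Longrightarrow> \<psi> (\<phi> y) = y"
    and \<phi>U: "\<And>y. y \<in> V \<Longrightarrow> \<phi> y \<in> U" and cont\<phi>: "continuous_on V \<phi>"
    using U(4) by (auto simp: homeomorphism_def)
  have MV: "M p ` V = L p -` V" for p
    using L by (auto simp: image_iff) metis
  have openM: "open (M p ` V)" for p
    unfolding MV by (rule open_vimage[OF U(3) contL])
  have inM: "p \<in> M p ` V" for p
    using one im U(2) by (metis imageI)
  have M_range: "M p (\<psi> u) \<in> range \<psi> \<longleftrightarrow> p \<in> range \<psi>" for p u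
  proof
    assume "M p (\<psi> u) \<in> range \<psi>"
    then obtain g where "M p (\<psi> u) = \<psi> g" by auto
    also have "g = (g \<otimes> inv u) \<otimes> u" by (simp add: m_assoc)
    also have "\<psi> ((g \<otimes> inv u) \<otimes> u) = M (\<psi> (g \<otimes> inv u)) (\<psi> u)" by (rule hom)
    finally have "M p (\<psi> u) = M (\<psi> (g \<otimes> inv u)) (\<psi> u)" .
    from cancel[OF this] show "p \<in> range \<psi>" by simp
  next
    assume "p \<in> range \<psi>"
    then show "M p (\<psi> u) \<in> range \<psi>" using hom by (metis imageE rangeI)
  qed
  have V_range: "M p v \<in> range \<psi> \<longleftrightarrow> p \<in> range \<psi>" if "v \<in> V" for p v
    using that M_range im by blast
  \<comment> \<open>A set stable under right multiplication by V is a union of the open sets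
    \<open>M p\<close> with p in it applied to V. Applied to the range of \<psi> and to its
    complement, this makes the range clopen, hence everything.\<close>
  have "open S" if "\<And>p v. v \<in> V \<Longrightarrow> M p v \<in> S \<longleftrightarrow> p \<in> S" for S
  proof -
    have "(\<Union>p\<in>S. M p ` V) \<subseteq> S" using that by auto
    moreover have "S \<subseteq> (\<Union>p\<in>S. M p ` V)" using inM by blast
    ultimately have "S = (\<Union>p\<in>S. M p ` V)" by (rule equalityI[rotated])
    moreover have "open (\<Union>p\<in>S. M p ` V)" using openM by (intro open_UN) blast
    ultimately show ?thesis by simp
  qed
  from this[of "range \<psi>"] this[of "- range \<psi>"]
  have "open (range \<psi>)" "open (- range \<psi>)" using V_range by auto
  then have surj: "range \<psi> = UNIV"
    using clopen[of "range \<psi>"] by (auto simp: closed_def)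
  have cov: "covering_space UNIV \<psi> UNIV"
  proof
    fix p :: 'a
    \<comment> \<open>The sheets over the neighbourhood of p are the translates of U by the points
      of the fibre over p.\<close>
    define sheets where "sheets = {(\<lambda>u. g \<otimes> u) ` U | g. \<psi> g = p}"
    have sheet: "(\<lambda>u. g \<otimes> u) ` U = (\<lambda>u. inv g \<otimes> u) -` U" for g
    proof (intro equalityI subsetI)
      fix x assume "x \<in> (\<lambda>u. inv g \<otimes> u) -` U"
      moreover have "x = g \<otimes> (inv g \<otimes> x)" by (simp flip: m_assoc)
      ultimately show "x \<in> (\<lambda>u. g \<otimes> u) ` U" by blast
    qed (auto simp flip: m_assoc)
    have 1: "\<Union>sheets = UNIV \<inter> \<psi> -` (M p ` V)"
    proof (intro equalityI subsetI)
      fix x assume "x \<in> \<Union>sheets"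
      then obtain g u where "\<psi> g = p" "u \<in> U" "x = g \<otimes> u" by (auto simp: sheets_def)
      then show "x \<in> UNIV \<inter> \<psi> -` (M p ` V)" using im by (auto simp: hom)
    next
      fix x assume "x \<in> UNIV \<inter> \<psi> -` (M p ` V)"
      then obtain u where u: "u \<in> U" "\<psi> x = M p (\<psi> u)" using im by auto
      have x: "x = (x \<otimes> inv u) \<otimes> u" by (simp add: m_assoc)
      then have "M (\<psi> (x \<otimes> inv u)) (\<psi> u) = M p (\<psi> u)" using u(2) hom by metis
      then have "\<psi> (x \<otimes> inv u) = p" by (rule cancel)
      then show "x \<in> \<Union>sheets" unfolding sheets_def using x u(1) by blast
    qed
    have 2: "openin (top_of_set UNIV) S" if "S \<in> sheets" for S
      using that sheet open_vimage[OF U(1) left] by (auto simp: sheets_def)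
    have 3: "pairwise disjnt sheets"
    proof (rule pairwiseI)
      fix S S' assume "S \<in> sheets" "S' \<in> sheets" "S \<noteq> S'"
      then obtain g g' where g: "\<psi> g = p" "\<psi> g' = p" "S = (\<lambda>u. g \<otimes> u) ` U" "S' = (\<lambda>u. g' \<otimes> u) ` U"
        by (auto simp: sheets_def)
      have "g = g'" if "u \<in> U" "u' \<in> U" "g \<otimes> u = g' \<otimes> u'" for u u'
      proof -
        have "M p (\<psi> u) = M p (\<psi> u')" using that(3) hom g(1,2) by metis
        then have "\<psi> u = \<psi> u'" using L(1) by metis
        then have "u = u'" using \<phi>(1) that(1,2) by metis
        then show ?thesis using that(3) by simp
      qed
      then show "disjnt S S'" using g \<open>S \<noteq> S'\<close> by (auto simp: disjnt_def)
    qed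
    have 4: "\<exists>q. homeomorphism S (M p ` V) \<psi> q" if "S \<in> sheets" for S
    proof -
      from that obtain g where g: "\<psi> g = p" "S = (\<lambda>u. g \<otimes> u) ` U" by (auto simp: sheets_def)
      have "homeomorphism S (M p ` V) \<psi> (\<lambda>y. g \<otimes> \<phi> (L p y))"
      proof (rule homeomorphismI)
        show "continuous_on S \<psi>" using cont continuous_on_subset by blast
        have "continuous_on (M p ` V) (\<lambda>y. \<phi> (L p y))"
          by (rule continuous_on_compose2[OF cont\<phi> continuous_on_subset[OF contL subset_UNIV]]) (auto simp: L)
        then show "continuous_on (M p ` V) (\<lambda>y. g \<otimes> \<phi> (L p y))"
          by (rule continuous_on_compose2[OF left]) auto
        show "\<psi> ` S \<subseteq> M p ` V" using g im by (auto simp: hom)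
        show "(\<lambda>y. g \<otimes> \<phi> (L p y)) ` M p ` V \<subseteq> S" using g \<phi>U by (auto simp: L)
        show "g \<otimes> \<phi> (L p (\<psi> x)) = x" if "x \<in> S" for x
          using that g by (auto simp: hom L \<phi>)
        show "\<psi> (g \<otimes> \<phi> (L p y)) = y" if "y \<in> M p ` V" for y
          using that g by (auto simp: hom L \<phi>)
      qed
      then show ?thesis by blast
    qed
    show "\<exists>T. p \<in> T \<and> openin (top_of_set UNIV) T \<and> (\<exists>v. \<Union>v = UNIV \<inter> \<psi> -` T \<and>
        (\<forall>u\<in>v. openin (top_of_set UNIV) u) \<and> pairwise disjnt v \<and> (\<forall>u\<in>v. \<exists>q. homeomorphism u T \<psi> q))"
      using 1 2 3 4 inM openM by (intro exI[of _ "M p ` V"] exI[of _ sheets] conjI) auto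
  qed (use cont surj in auto)
  \<comment> \<open>The identity of a simply connected space lifts to a section of the covering. By
    uniqueness of lifts this section is also a left inverse.\<close>
  obtain s where s: "continuous_on UNIV s" "s (\<psi> \<one>) = \<one>" "\<And>y. \<psi> (s y) = y"
    using covering_space_lift_strong[OF cov, of \<one> "\<psi> \<one>" UNIV "\<lambda>y. y"]
    by (metis UNIV_I convex_UNIV convex_imp_simply_connected convex_imp_locally_path_connected
        continuous_on_id Pi_I)
  have "s (\<psi> x) = x" for x
    by (rule covering_space_lift_unique[OF cov, of "\<lambda>x. s (\<psi> x)" \<one> "\<lambda>x. x" UNIV \<psi> x])
      (use s cont continuous_on_compose2[OF s(1) cont] in auto)
  note left_inv = this
  have "inv_into UNIV \<psi> = s" by (rule Hilbert_Choice.inv_equality) (rule left_inv s(3))+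
  moreover have "bij \<psi>" by (rule o_bij[of s]) (simp_all add: fun_eq_iff left_inv s(3))
  ultimately show ?thesis using s(1) by simp
qed

section \<open>The spinor\<close>

text \<open>The exponent of -1 picked up when two Clifford words are exchanged: every pair of
  letters contributes a sign, except that a letter commutes with its own copy.\<close>

definition word_parity :: "nat list \<Rightarrow> nat list \<Rightarrow> nat" where
  "word_parity js is = length js * length is + length (filter (\<lambda>j. j \<in> set is) js)"

locale clifford_module =
  fixes \<gamma> :: "nat \<Rightarrow> real^16^16"
  assumes clifford: "clifford_rep \<gamma>"
begin

lemma gamma_anticommute:
  assumes "i \<in> {1..8}" "j \<in> {1..8}" "i \<noteq> j"
  shows "\<gamma> i *v (\<gamma> j *v s) = - (\<gamma> j *v (\<gamma> i *v s))"
proof -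
  have "\<gamma> i ** \<gamma> j + \<gamma> j ** \<gamma> i = 0"
    using clifford assms unfolding clifford_rep_def by simp
  then have "(\<gamma> i ** \<gamma> j + \<gamma> j ** \<gamma> i) *v s = 0" by simp
  then show ?thesis
    by (simp add: matrix_vector_mult_add_rdistrib matrix_vector_mul_assoc eq_neg_iff_add_eq_0)
qed

lemma gamma_square:
  assumes "i \<in> {1..8}"
  shows "\<gamma> i *v (\<gamma> i *v s) = - s"
proof -
  have "\<gamma> i ** \<gamma> i + \<gamma> i ** \<gamma> i = (- 2) *\<^sub>R mat 1"
    using clifford assms unfolding clifford_rep_def by auto
  then have "\<gamma> i *v (\<gamma> i *v s) + \<gamma> i *v (\<gamma> i *v s) = ((- 2) *\<^sub>R mat 1) *v s"
    by (simp only: matrix_vector_mult_add_rdistrib[symmetric] matrix_vector_mul_assoc)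
  also have "\<dots> = 2 *\<^sub>R (- s)"
    by (simp only: scaleR_matrix_vector_assoc[symmetric] matrix_vector_mul_lid) simp
  finally have "2 *\<^sub>R (\<gamma> i *v (\<gamma> i *v s)) = 2 *\<^sub>R (- s)"
    by (simp only: scaleR_2)
  then show ?thesis by (simp only: scaleR_cancel_left) simp
qed

lemma gamma_skew:
  assumes "i \<in> {1..8}"
  shows "(\<gamma> i *v s) \<bullet> t = - (s \<bullet> (\<gamma> i *v t))"
proof -
  have "s \<bullet> (\<gamma> i *v t) = (transpose (\<gamma> i) *v s) \<bullet> t"
    by (simp add: dot_lmul_matrix)
  also have "transpose (\<gamma> i) = - \<gamma> i"
    using clifford assms unfolding clifford_rep_def by blast
  also have "(- \<gamma> i) *v s = - (\<gamma> i *v s)"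
    using matrix_vector_mult_diff_rdistrib[of 0 "\<gamma> i" s] by simp
  finally show ?thesis by simp
qed

lemma gamma_neg: "\<gamma> i *v (- s) = - (\<gamma> i *v s)"
  by (rule linear_neg[OF matrix_vector_mul_linear])

lemma gamma_scale: "\<gamma> i *v (r *\<^sub>R s) = r *\<^sub>R (\<gamma> i *v s)"
  by (rule linear_cmul[OF matrix_vector_mul_linear])

lemma gamma_word_Nil [simp]: "gamma_word \<gamma> [] s = s"
  by (simp add: gamma_word_def)

lemma gamma_word_Cons: "gamma_word \<gamma> (i # is) s = \<gamma> i *v gamma_word \<gamma> is s"
  by (simp add: gamma_word_def)

lemma gamma_word_linear: "linear (gamma_word \<gamma> is)"
proof (induction "is")
  case Nil
  show ?case by (simp add: gamma_word_def linear_iff)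
next
  case (Cons i "is")
  have "linear ((*v) (\<gamma> i) \<circ> gamma_word \<gamma> is)"
    by (rule linear_compose[OF Cons.IH matrix_vector_mul_linear])
  then show ?case by (simp add: gamma_word_Cons[abs_def] o_def)
qed

lemmas gamma_word_diff = linear_diff[OF gamma_word_linear]
  and gamma_word_neg = linear_neg[OF gamma_word_linear]

lemma gamma_gamma_word:
  assumes "i \<in> {1..8}" "set is \<subseteq> {1..8}" "distinct is"
  shows "\<gamma> i *v gamma_word \<gamma> is s =
    (- 1) ^ (length is + (if i \<in> set is then 1 else 0)) *\<^sub>R gamma_word \<gamma> is (\<gamma> i *v s)"
  using assms(2,3)
proof (induction "is")
  case (Cons j "is")
  then show ?case
    using gamma_anticommute[OF assms(1), of j]
    by (cases "i = j") (auto simp: gamma_word_Cons gamma_scale gamma_neg power_add)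
qed simp

lemma gamma_word_commute:
  assumes "set is \<subseteq> {1..8}" "distinct is" "set js \<subseteq> {1..8}"
  shows "gamma_word \<gamma> js (gamma_word \<gamma> is s) =
    (- 1) ^ (length js * length is + length (filter (\<lambda>j. j \<in> set is) js)) *\<^sub>R
      gamma_word \<gamma> is (gamma_word \<gamma> js s)"
  using assms(3)
proof (induction js)
  case (Cons j js)
  then show ?case
    using gamma_gamma_word[of j "is" "gamma_word \<gamma> js s"] assms
    by (simp add: gamma_word_Cons gamma_scale power_add)
qed simp

lemma norm_gamma: "i \<in> {1..8} \<Longrightarrow> \<gamma> i *v s = 0 \<longleftrightarrow> s = 0"
  by (metis gamma_square matrix_vector_mult_0_right neg_equal_0_iff_equal)

lemma gamma_word_eq_0: "set is \<subseteq> {1..8} \<Longrightarrow> gamma_word \<gamma> is s = 0 \<longleftrightarrow> s = 0"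
  by (induction "is") (simp_all add: gamma_word_Cons norm_gamma)

lemma gamma_word_even:
  "even (word_parity js is) \<Longrightarrow> set is \<subseteq> {1..8} \<Longrightarrow> distinct is \<Longrightarrow> set js \<subseteq> {1..8} \<Longrightarrow>
    gamma_word \<gamma> js (gamma_word \<gamma> is s) = gamma_word \<gamma> is (gamma_word \<gamma> js s)"
  using gamma_word_commute[of "is" js s] by (simp add: word_parity_def)

lemma gamma_word_odd:
  "odd (word_parity js is) \<Longrightarrow> set is \<subseteq> {1..8} \<Longrightarrow> distinct is \<Longrightarrow> set js \<subseteq> {1..8} \<Longrightarrow>
    gamma_word \<gamma> js (gamma_word \<gamma> is s) = - gamma_word \<gamma> is (gamma_word \<gamma> js s)"
  using gamma_word_commute[of "is" js s] by (simp add: word_parity_def)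

text \<open>The involution K commutes with the words in S, so \<open>s - K s\<close> is the wanted
  eigenvector unless it is zero. In that case s has eigenvalue +1, and U, which anticommutes with K
  and commutes with S, flips the sign.\<close>

lemma eigenvector_step:
  assumes s: "s \<noteq> 0" "\<forall>L\<in>S. gamma_word \<gamma> L s = - s"
    and K: "set K \<subseteq> {1..8}" "distinct K" "gamma_word \<gamma> K (gamma_word \<gamma> K s) = s"
    and U: "set U \<subseteq> {1..8}" "distinct U" "odd (word_parity K U)"
    and S: "\<forall>L\<in>S. set L \<subseteq> {1..8} \<and> even (word_parity L K) \<and> even (word_parity L U)"
  obtains t where "t \<noteq> 0" "\<forall>L\<in>insert K S. gamma_word \<gamma> L t = - t"
proof (cases "s = gamma_word \<gamma> K s")
  case False
  have "gamma_word \<gamma> L (s - gamma_word \<gamma> K s) = - (s - gamma_word \<gamma> K s)" if "L \<in> insert K S" for L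
  proof (cases "L = K")
    case True
    then show ?thesis using K(3) by (simp add: gamma_word_diff)
  next
    case False
    with that have "L \<in> S" by simp
    then show ?thesis
      using s(2) S gamma_word_even[of L K s] K by (simp add: gamma_word_diff gamma_word_neg)
  qed
  with False show ?thesis by (intro that[of "s - gamma_word \<gamma> K s"]) auto
next
  case True
  have "gamma_word \<gamma> L (gamma_word \<gamma> U s) = - gamma_word \<gamma> U s" if "L \<in> insert K S" for L
  proof (cases "L = K")
    case L: True
    show ?thesis using True gamma_word_odd[OF U(3,1,2) K(1), of s] by (simp add: L)
  next
    case False
    with that have "L \<in> S" by simp
    then show ?thesis
      using s(2) S gamma_word_even[of L U s] U by (simp add: gamma_word_neg)
  qed
  with s(1) show ?thesis
    by (intro that[of "gamma_word \<gamma> U s"]) (use gamma_word_eq_0[OF U(1)] in auto)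
qed

text \<open>Anticommutation oriented towards increasing indices, so that rewriting sorts words and
  terminates.\<close>

lemma gamma_sort: "j < i \<Longrightarrow> i \<in> {1..8} \<Longrightarrow> j \<in> {1..8} \<Longrightarrow>
    \<gamma> i *v (\<gamma> j *v s) = - (\<gamma> j *v (\<gamma> i *v s))"
  by (rule gamma_anticommute) auto

lemmas gamma_simps = gamma_word_Cons gamma_sort gamma_square gamma_neg

text \<open>The four words are commuting involutions, imposed one at a time. The auxiliary words 2,
  4, 6 and 23 anticommute with the word just added and commute with the earlier ones.\<close>

lemma ex_spinor:
  "\<exists>s. s \<noteq> 0 \<and> gamma_word \<gamma> [1,2,3,8] s = - s \<and> gamma_word \<gamma> [1,4,5,8] s = - s \<and>
    gamma_word \<gamma> [1,6,7,8] s = - s \<and> gamma_word \<gamma> [1,2,4,6] s = - s"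
proof -
  have sq: "gamma_word \<gamma> [1,2,3,8] (gamma_word \<gamma> [1,2,3,8] s) = s"
    "gamma_word \<gamma> [1,4,5,8] (gamma_word \<gamma> [1,4,5,8] s) = s"
    "gamma_word \<gamma> [1,6,7,8] (gamma_word \<gamma> [1,6,7,8] s) = s"
    "gamma_word \<gamma> [1,2,4,6] (gamma_word \<gamma> [1,2,4,6] s) = s" for s
    by (simp_all add: gamma_simps)
  have "axis 1 1 \<noteq> (0::real^16)" "\<forall>L\<in>{}. gamma_word \<gamma> L (axis 1 1) = - axis 1 1"
    by (simp_all add: axis_eq_0_iff)
  then obtain s1 where "s1 \<noteq> 0" "\<forall>L\<in>{[1,2,3,8]}. gamma_word \<gamma> L s1 = - s1"
    by (rule eigenvector_step[of _ _ "[1,2,3,8]" "[2]"]) (simp_all only: sq, simp_all add: word_parity_def)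
  then obtain s2 where "s2 \<noteq> 0" "\<forall>L\<in>{[1,4,5,8], [1,2,3,8]}. gamma_word \<gamma> L s2 = - s2"
    by (rule eigenvector_step[of _ _ "[1,4,5,8]" "[4]"]) (simp_all only: sq, simp_all add: word_parity_def)
  then obtain s3 where "s3 \<noteq> 0" "\<forall>L\<in>{[1,6,7,8], [1,4,5,8], [1,2,3,8]}. gamma_word \<gamma> L s3 = - s3"
    by (rule eigenvector_step[of _ _ "[1,6,7,8]" "[6]"]) (simp_all only: sq, simp_all add: word_parity_def)
  then obtain s4 where "s4 \<noteq> 0"
      "\<forall>L\<in>{[1,2,4,6], [1,6,7,8], [1,4,5,8], [1,2,3,8]}. gamma_word \<gamma> L s4 = - s4"
    by (rule eigenvector_step[of _ _ "[1,2,4,6]" "[2,3]"]) (simp_all only: sq, simp_all add: word_parity_def)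
  then show ?thesis by auto
qed

context
  fixes s
  assumes s: "gamma_word \<gamma> [1,2,3,8] s = - s" "gamma_word \<gamma> [1,4,5,8] s = - s"
    "gamma_word \<gamma> [1,6,7,8] s = - s" "gamma_word \<gamma> [1,2,4,6] s = - s"
begin

text \<open>Each of the other ten words of \<Phi> is, up to sign, a product of two, three or four of
  the generators. The list \<open>e\<close> gives the eigenvalues of these products, and sorting the
  letters turns each product into a single word.\<close>

lemma spinor_Phi: "(r, K) \<in> set Phi_comb \<Longrightarrow> gamma_word \<gamma> K s = - r *\<^sub>R s"
proof -
  let ?A = "gamma_word \<gamma> [1,2,3,8]" and ?B = "gamma_word \<gamma> [1,4,5,8]"
  let ?C = "gamma_word \<gamma> [1,6,7,8]" and ?D = "gamma_word \<gamma> [1,2,4,6]"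
  have e: "?A (?B s) = s" "?A (?C s) = s" "?B (?C s) = s" "?A (?D s) = s" "?B (?D s) = s" "?C (?D s) = s"
    "?A (?B (?D s)) = - s" "?A (?C (?D s)) = - s" "?B (?C (?D s)) = - s" "?A (?B (?C (?D s))) = s"
    by (simp_all add: s gamma_word_neg)
  note e = e[unfolded gamma_word_Cons gamma_word_Nil]
  have "gamma_word \<gamma> [2,3,4,5] s = - s" using e(1) by (simp add: gamma_simps, (metis minus_minus)?)
  moreover have "gamma_word \<gamma> [2,3,6,7] s = - s" using e(2) by (simp add: gamma_simps, (metis minus_minus)?)
  moreover have "gamma_word \<gamma> [4,5,6,7] s = - s" using e(3) by (simp add: gamma_simps, (metis minus_minus)?)
  moreover have "gamma_word \<gamma> [3,4,6,8] s = - s" using e(4) by (simp add: gamma_simps, (metis minus_minus)?)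
  moreover have "gamma_word \<gamma> [2,5,6,8] s = - s" using e(5) by (simp add: gamma_simps, (metis minus_minus)?)
  moreover have "gamma_word \<gamma> [2,4,7,8] s = - s" using e(6) by (simp add: gamma_simps, (metis minus_minus)?)
  moreover have "gamma_word \<gamma> [1,3,5,6] s = s" using e(7) by (simp add: gamma_simps, (metis minus_minus)?)
  moreover have "gamma_word \<gamma> [1,3,4,7] s = s" using e(8) by (simp add: gamma_simps, (metis minus_minus)?)
  moreover have "gamma_word \<gamma> [1,2,5,7] s = s" using e(9) by (simp add: gamma_simps, (metis minus_minus)?)
  moreover have "gamma_word \<gamma> [3,5,7,8] s = s" using e(10) by (simp add: gamma_simps, (metis minus_minus)?)
  ultimately show "(r, K) \<in> set Phi_comb \<Longrightarrow> gamma_word \<gamma> K s = - r *\<^sub>R s"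
    using s by (auto simp: Phi_comb_def)
qed

lemma gamma_word_skew:
  "set is \<subseteq> {1..8} \<Longrightarrow> gamma_word \<gamma> is u \<bullet> w = (- 1) ^ length is * (u \<bullet> gamma_word \<gamma> (rev is) w)"
proof (induction "is" arbitrary: w)
  case (Cons i "is")
  have "gamma_word \<gamma> (rev is @ [i]) w = gamma_word \<gamma> (rev is) (\<gamma> i *v w)"
    by (simp add: gamma_word_def)
  then show ?case using Cons by (simp add: gamma_word_Cons gamma_skew)
qed simp

lemma spinor_orthogonal:
  assumes K: "K \<in> {[1,2,3,8], [1,4,5,8], [1,6,7,8], [1,2,4,6]}"
    and I: "set is \<subseteq> {1..8}" "distinct is" "odd (word_parity K is)"
  shows "s \<bullet> gamma_word \<gamma> is s = 0"
proof -
  have Ks: "gamma_word \<gamma> K s = - s" "set K \<subseteq> {1..8}" "length K = 4" using K s by auto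
  \<comment> \<open>Reversing four distinct letters takes six exchanges, so no sign appears and K
    acts symmetrically.\<close>
  have rev: "gamma_word \<gamma> (rev K) w = gamma_word \<gamma> K w" for w
    using K by (auto simp: gamma_simps)
  have "gamma_word \<gamma> K (gamma_word \<gamma> is s) = gamma_word \<gamma> is s"
    using gamma_word_odd[OF I(3,1,2) Ks(2), of s] Ks by (simp add: gamma_word_neg)
  then have "s \<bullet> gamma_word \<gamma> is s = s \<bullet> gamma_word \<gamma> (rev K) (gamma_word \<gamma> is s)" by (simp add: rev)
  also have "\<dots> = gamma_word \<gamma> K s \<bullet> gamma_word \<gamma> is s"
    using gamma_word_skew[OF Ks(2), of s "gamma_word \<gamma> is s"] Ks(3) by simp
  also have "\<dots> = - (s \<bullet> gamma_word \<gamma> is s)" by (simp add: Ks)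
  finally show ?thesis by simp
qed

end

end

section \<open>The 4-form of the spinor and the Killing spinor equations\<close>

lemma Phi_words: "map snd Phi_comb = [[1,2,3,8], [1,3,4,7], [1,4,5,8], [1,6,7,8], [1,2,5,7], [1,3,5,6],
    [1,2,4,6], [4,5,6,7], [2,5,6,8], [2,3,6,7], [2,3,4,5], [3,4,6,8], [2,4,7,8], [3,5,7,8]]"
  by (simp add: Phi_comb_def)

text \<open>Self-duality of the extended Hamming code: a word of length four that meets every
  generator in an even number of letters is itself one of the fourteen words of \<Phi>. It is
  checked on all 256 subsets.\<close>

lemma word_cases:
  "\<forall>J \<in> set (subseqs [1,2,3,4,5,6,7,8]). sorted_wrt (<) J \<and> (length J = 4 \<longrightarrow> J \<in> set (map snd Phi_comb) \<or>
    (\<exists>K \<in> set [[1,2,3,8], [1,4,5,8], [1,6,7,8], [1,2,4,6]]. odd (word_parity K J)))"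
  unfolding Phi_words by code_simp

lemma sum_list_single:
  "distinct (map snd cs) \<Longrightarrow>
    (\<Sum>(r, K)\<leftarrow>cs. if K = J then X else 0) = (if J \<in> set (map snd cs) then X else (0::real))"
  by (induction cs) (force simp: image_iff)+

locale nil_spin = nil_coframe + clifford_module
begin

text \<open>Reordering a Clifford word of distinct letters costs the sign of the permutation, and a
  monomial evaluated on the permuted frame has the same sign as its value.\<close>

lemma gamma_word_permute:
  assumes "set ks \<subseteq> {1..8}" "distinct ks" "distinct is" "set is = set ks"
  shows "gamma_word \<gamma> is s = emon e ks x (frame_at E x is) *\<^sub>R gamma_word \<gamma> ks s"
  using assms
proof (induction "is" arbitrary: ks)
  case Nil
  then show ?case by (simp add: frame_at_def emon_Nil)
next
  case (Cons j "is")
  then have "j \<in> set ks" by auto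
  then obtain l1 l2 where ks: "ks = l1 @ j # l2" by (meson split_list)
  have j: "j \<in> {1..8}" "j \<notin> set l1" "set l1 \<subseteq> {1..8}" "distinct l1" using Cons.prems ks by auto
  have "gamma_word \<gamma> ks s = gamma_word \<gamma> l1 (\<gamma> j *v gamma_word \<gamma> l2 s)"
    by (simp add: ks gamma_word_def)
  also have "\<dots> = (- 1) ^ length l1 *\<^sub>R (\<gamma> j *v gamma_word \<gamma> (l1 @ l2) s)"
    using gamma_gamma_word[OF j(1,3,4), of "gamma_word \<gamma> l2 s"] j(2)
    by (simp add: gamma_word_def flip: power_add mult_2)
  finally have 1: "gamma_word \<gamma> ks s = (- 1) ^ length l1 *\<^sub>R (\<gamma> j *v gamma_word \<gamma> (l1 @ l2) s)" .
  have 2: "emon e ks x (frame_at E x (j # is)) = (- 1) ^ length l1 * emon e (l1 @ l2) x (frame_at E x is)"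
    using Cons.prems emon_frame_in[of l1 j l2 x "frame_at E x is"] by (simp add: ks frame_at_def)
  have "gamma_word \<gamma> is s = emon e (l1 @ l2) x (frame_at E x is) *\<^sub>R gamma_word \<gamma> (l1 @ l2) s"
    using Cons.prems by (intro Cons.IH) (auto simp: ks)
  then show ?case
    unfolding 1 2 by (simp add: gamma_word_Cons gamma_scale flip: power_add mult_2)
qed

lemma emon_frame_subset:
  assumes "set ks \<subseteq> {1..8}" "distinct ks" "set is \<subseteq> {1..8}" "\<not> set is \<subseteq> set ks"
  shows "emon e ks x (frame_at E x is) = 0"
  using assms
proof (induction "is" arbitrary: ks)
  case (Cons j "is")
  show ?case
  proof (cases "j \<in> set ks")
    case True
    then obtain l1 l2 where ks: "ks = l1 @ j # l2" by (meson split_list)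
    have "emon e (l1 @ l2) x (frame_at E x is) = 0"
      using Cons.prems by (intro Cons.IH) (auto simp: ks)
    then show ?thesis
      using Cons.prems emon_frame_in[of l1 j l2 x "frame_at E x is"] by (simp add: ks frame_at_def)
  next
    case False
    then show ?thesis
      using Cons.prems emon_frame_notin[of ks j x "frame_at E x is"] by (simp add: frame_at_def)
  qed
qed simp

lemma Phi_comb_sorted: "(r, K) \<in> set Phi_comb \<Longrightarrow> set K \<subseteq> {1..8} \<and> sorted_wrt (<) K \<and> length K = 4"
  by (auto simp: Phi_comb_def)

text \<open>At most one monomial of \<Phi> has the letters of the given list; if there is one, its
  eigenvalue settles the claim, and otherwise the expectation value is zero by
  orthogonality.\<close>

lemma spinor_defines_Phi:
  assumes s: "gamma_word \<gamma> [1,2,3,8] s = - s" "gamma_word \<gamma> [1,4,5,8] s = - s"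
    "gamma_word \<gamma> [1,6,7,8] s = - s" "gamma_word \<gamma> [1,2,4,6] s = - s"
  shows "spinor_defines \<gamma> E (\<lambda>x. s) (Phi_form e)"
  unfolding spinor_defines_def
proof (intro allI impI, elim conjE)
  fix x and "is" :: "nat list"
  assume "is": "length is = 4" "distinct is" "set is \<subseteq> {1..8}"
  \<comment> \<open>J is the increasing rearrangement of the given indices.\<close>
  have "set is \<in> set ` set (subseqs [1,2,3,4,5,6,7,8::nat])"
    using "is"(3) unfolding subseqs_powset by (auto simp: numeral_eq_Suc)
  then obtain J where J: "J \<in> set (subseqs [1,2,3,4,5,6,7,8])" "set is = set J" by blast
  have "distinct J" using subseqs_distinctD[OF J(1)] by simp
  then have len: "length J = 4" using "is" J(2) by (metis distinct_card)
  have subJ: "set J \<subseteq> {1..8}" using J(2) "is"(3) by simp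
  have word: "r * emon e K x (frame_at E x is) * (s \<bullet> s) = (if K = J then - (s \<bullet> gamma_word \<gamma> is s) else 0)"
    if r: "(r, K) \<in> set Phi_comb" for r K
  proof (cases "K = J")
    case True
    have "gamma_word \<gamma> is s = emon e J x (frame_at E x is) *\<^sub>R (- r *\<^sub>R s)"
      using gamma_word_permute[OF subJ \<open>distinct J\<close> "is"(2) J(2), of s x] spinor_Phi[OF s r] True by simp
    then show ?thesis using True by simp
  next
    case False
    have K: "set K \<subseteq> {1..8}" "sorted_wrt (<) K" "length K = 4" using Phi_comb_sorted[OF r] by auto
    then have "distinct K" by (simp add: strict_sorted_iff)
    have "set is \<noteq> set K"
      using False K(2) J(2) word_cases J(1) strict_sorted_equal by metis
    moreover have "card (set is) = card (set K)"
      using "is" K \<open>distinct K\<close> by (simp add: distinct_card)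
    ultimately have "\<not> set is \<subseteq> set K" by (metis List.finite_set card_subset_eq)
    then show ?thesis
      using False emon_frame_subset[OF K(1) \<open>distinct K\<close> "is"(3)] by simp
  qed
  have "Phi_form e x (frame_at E x is) * (s \<bullet> s) =
      (\<Sum>(r, K)\<leftarrow>Phi_comb. r * emon e K x (frame_at E x is) * (s \<bullet> s))"
    unfolding Phi_form_eq ecomb_def by (simp only: split_def sum_list_mult_const)
  also have "\<dots> = (\<Sum>(r, K)\<leftarrow>Phi_comb. if K = J then - (s \<bullet> gamma_word \<gamma> is s) else 0)"
    by (intro arg_cong[where f = sum_list] map_cong refl, clarify) (rule word)
  also have "\<dots> = (if J \<in> set (map snd Phi_comb) then - (s \<bullet> gamma_word \<gamma> is s) else 0)"
    by (rule sum_list_single) (simp add: Phi_words)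
  also have "\<dots> = - (s \<bullet> gamma_word \<gamma> is s)"
  proof (cases "J \<in> set (map snd Phi_comb)")
    case False
    have "\<exists>K \<in> set [[1,2,3,8], [1,4,5,8], [1,6,7,8], [1,2,4,6]]. odd (word_parity K J)"
      using bspec[OF word_cases J(1), THEN conjunct2, THEN mp, OF len] False by argo
    then obtain K where K': "K \<in> set [[1,2,3,8], [1,4,5,8], [1,6,7,8], [1,2,4,6]]" "odd (word_parity K J)"
      by (rule bexE)
    then have K: "K \<in> {[1,2,3,8], [1,4,5,8], [1,6,7,8], [1,2,4,6]}" "odd (word_parity K J)" by simp_all
    have "word_parity K is = word_parity K J" using J(2) "is"(1) len by (simp add: word_parity_def)
    with spinor_orthogonal[OF s K(1) "is"(3,2)] K(2) show ?thesis by simp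
  qed simp
  finally show "Phi_form e x (frame_at E x is) * (s \<bullet> s) = - (s \<bullet> gamma_word \<gamma> is s)" .
qed

lemma clifford_action_ecomb:
  assumes "sorted_comb cs"
  shows "clifford_action \<gamma> E (ecomb e cs) x s = (\<Sum>(r, is)\<leftarrow>cs. r *\<^sub>R gamma_word \<gamma> is s)"
  unfolding clifford_action_def
  using assms by (intro ecomb_frame_sum) (auto simp: sorted_comb_def)

lemma clifford_action_add:
  "clifford_action \<gamma> E (\<lambda>x vs. \<alpha> x vs + \<beta> x vs) x s = clifford_action \<gamma> E \<alpha> x s + clifford_action \<gamma> E \<beta> x s"
  by (simp add: clifford_action_def scaleR_add_left sum.distrib)

lemma clifford_action_scale:
  "clifford_action \<gamma> E (\<lambda>x vs. r * \<alpha> x vs) x s = r *\<^sub>R clifford_action \<gamma> E \<alpha> x s"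
  by (simp add: clifford_action_def scaleR_sum_right)

context
  fixes s
  assumes s: "gamma_word \<gamma> [1,2,3,8] s = - s" "gamma_word \<gamma> [1,4,5,8] s = - s"
    "gamma_word \<gamma> [1,6,7,8] s = - s" "gamma_word \<gamma> [1,2,4,6] s = - s"
begin

text \<open>Multiplying an eigenvalue equation for a 4-letter word by two of its letters identifies
  the actions of two 2-letter words. These identities encode that \<open>W1\<close> and
  \<open>W8\<close> annihilate the spinor.\<close>

lemma spinor_pairs:
  "\<gamma> 4 *v (\<gamma> 5 *v s) = \<gamma> 2 *v (\<gamma> 3 *v s)" "\<gamma> 6 *v (\<gamma> 7 *v s) = \<gamma> 2 *v (\<gamma> 3 *v s)"
  "\<gamma> 3 *v (\<gamma> 5 *v s) = - (\<gamma> 2 *v (\<gamma> 4 *v s))" "\<gamma> 3 *v (\<gamma> 4 *v s) = \<gamma> 2 *v (\<gamma> 5 *v s)"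
proof -
  have w: "gamma_word \<gamma> [2,3,4,5] s = - s" "gamma_word \<gamma> [2,3,6,7] s = - s"
    using spinor_Phi[OF s, of 1 "[2,3,4,5]"] spinor_Phi[OF s, of 1 "[2,3,6,7]"] by (simp_all add: Phi_comb_def)
  note w' = w(1)[THEN arg_cong[where f = "gamma_word \<gamma> [2,3]"]] w(2)[THEN arg_cong[where f = "gamma_word \<gamma> [2,3]"]]
    w(1)[THEN arg_cong[where f = "gamma_word \<gamma> [2,4]"]] w(1)[THEN arg_cong[where f = "gamma_word \<gamma> [2,5]"]]
  show "\<gamma> 4 *v (\<gamma> 5 *v s) = \<gamma> 2 *v (\<gamma> 3 *v s)" using w'(1) by (simp add: gamma_simps)
  show "\<gamma> 6 *v (\<gamma> 7 *v s) = \<gamma> 2 *v (\<gamma> 3 *v s)" using w'(2) by (simp add: gamma_simps)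
  show "\<gamma> 3 *v (\<gamma> 5 *v s) = - (\<gamma> 2 *v (\<gamma> 4 *v s))" using w'(3) by (simp add: gamma_simps)
  show "\<gamma> 3 *v (\<gamma> 4 *v s) = \<gamma> 2 *v (\<gamma> 5 *v s)" using w'(4) by (simp add: gamma_simps)
qed

lemma action_W1: "clifford_action \<gamma> E W1 x s = 0"
  by (subst clifford_action_ecomb) (simp_all add: d1_comb_def gamma_word_Cons spinor_pairs)

lemma action_W8: "clifford_action \<gamma> E W8 x s = 0"
  by (subst clifford_action_ecomb)
    (simp_all add: d8_comb_def gamma_word_Cons spinor_pairs scaleR_add_left[symmetric])

lemma action_T: "clifford_action \<gamma> E T x s = 0"
proof -
  \<comment> \<open>The letter 1 does not occur in \<open>W1\<close>, nor 8 in \<open>W8\<close>, so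
    these wedge products are Clifford products.\<close>
  have "clifford_action \<gamma> E T x s =
    \<gamma> 1 *v clifford_action \<gamma> E W1 x s + \<gamma> 8 *v clifford_action \<gamma> E W8 x s"
    by (simp add: clifford_action_ecomb torsion_comb_def d1_comb_def d8_comb_def gamma_word_Cons
      gamma_scale gamma_sort[of 2 8] gamma_sort[of 3 8] gamma_sort[of 4 8] gamma_sort[of 5 8]
      gamma_sort[of 6 8] gamma_sort[of 7 8] gamma_neg matrix_vector_right_distrib matrix_vector_mult_diff_distrib)
  then show ?thesis by (simp add: action_W1 action_W8)
qed

lemma action_curvature:
  assumes "i \<in> {1..8}" "j \<in> {1..8}"
  shows "clifford_action \<gamma> E (curvature (A_conn e l m) i j) x s = 0"
  unfolding A_conn_eq curvature_block_conn[OF assms]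
  by (simp only: clifford_action_add clifford_action_scale action_W1 action_W8 X18_equal[OF assms])
    simp

text \<open>A constant spinor is parallel because both connection matrices, as elements of the spin
  algebra, annihilate it.\<close>

lemma spin_deriv_block:
  assumes "\<And>i j. i \<in> {1..8} \<Longrightarrow> j \<in> {1..8} \<Longrightarrow> \<sigma> i j = block_conn e p q r i j"
  shows "spin_deriv \<gamma> \<sigma> (\<lambda>x. s) x v = 0"
proof -
  have "(\<Sum>i=1..8. \<Sum>j=1..8. X8 p q j i *\<^sub>R gamma_word \<gamma> [i, j] s) = 0"
    unfolding sum_1_8
    by (simp add: X8_def gamma_word_Cons spinor_pairs gamma_sort[of 2 3] gamma_sort[of 4 5] gamma_sort[of 6 7] algebra_simps)
  moreover have "(\<Sum>i=1..8. \<Sum>j=1..8. X1 r j i *\<^sub>R gamma_word \<gamma> [i, j] s) = 0"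
    unfolding sum_1_8
    by (simp add: X1_def gamma_word_Cons spinor_pairs gamma_sort[of 2 4] gamma_sort[of 2 5]
      gamma_sort[of 3 4] gamma_sort[of 3 5] algebra_simps)
  moreover have "(\<Sum>i=1..8. \<Sum>j=1..8. \<sigma> j i x [v] *\<^sub>R gamma_word \<gamma> [i, j] s) =
     e 8 x [v] *\<^sub>R (\<Sum>i=1..8. \<Sum>j=1..8. X8 p q j i *\<^sub>R gamma_word \<gamma> [i, j] s) +
     e 1 x [v] *\<^sub>R (\<Sum>i=1..8. \<Sum>j=1..8. X1 r j i *\<^sub>R gamma_word \<gamma> [i, j] s)"
    unfolding scaleR_sum_right sum.distrib[symmetric]
    by (intro sum.cong refl) (simp add: assms block_conn_def algebra_simps)
  ultimately show ?thesis by (simp add: spin_deriv_def)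
qed

end

lemma killing_spinor:
  assumes lc: "levi_civita e E \<sigma>"
  shows "killing_spinor_eqs G \<Gamma> \<gamma> E \<sigma> (Phi_form e) (\<lambda>x. \<phi>0) T (A_conn e l m)"
proof -
  obtain s where s: "s \<noteq> 0" "gamma_word \<gamma> [1,2,3,8] s = - s" "gamma_word \<gamma> [1,4,5,8] s = - s"
    "gamma_word \<gamma> [1,6,7,8] s = - s" "gamma_word \<gamma> [1,2,4,6] s = - s"
    using ex_spinor by blast
  have "ext_d (form_of_fun (\<lambda>x. \<phi>0)) x vs = 0" for x vs
    by (rule ext_d_const) (simp add: form_of_fun_def)
  then have "clifford_action \<gamma> E (\<lambda>y vs. ext_d (form_of_fun (\<lambda>x. \<phi>0)) y vs - 1/2 * T y vs) x s = 0" for x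
    using clifford_action_scale[of "- 1/2" T x s] by (simp add: action_T[OF s(2-)])
  note dilatino = this
  show ?thesis
    unfolding killing_spinor_eqs_def
  proof (intro exI[of _ "\<lambda>x. s"] conjI allI ballI)
    show "smooth (\<lambda>x. s)" by (rule smooth_const)
    show "spinor_defines \<gamma> E (\<lambda>x. s) (Phi_form e)" by (rule spinor_defines_Phi[OF s(2-)])
    show "spin_deriv \<gamma> (add_torsion E \<sigma> T) (\<lambda>x. s) x v = 0" for x v
      by (rule spin_deriv_block[OF s(2-) add_torsion_eq[OF lc]])
    show "clifford_action \<gamma> E (curvature (A_conn e l m) i j) x s = 0" if "i \<in> {1..8}" "j \<in> {1..8}" for x i j
      by (rule action_curvature[OF s(2-) that])
  qed (use s(1) dilatino in simp_all)
qed

end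

section \<open>Vectors with eight entries and the global coordinates\<close>

lemma exhaust_8: "x = 1 \<or> x = 2 \<or> x = 3 \<or> x = 4 \<or> x = 5 \<or> x = 6 \<or> x = 7 \<or> x = 8" for x :: 8
proof (induct x)
  case (of_int z)
  then have "z = 0 \<or> z = 1 \<or> z = 2 \<or> z = 3 \<or> z = 4 \<or> z = 5 \<or> z = 6 \<or> z = 7" by auto
  then show ?case by auto
qed

lemma forall_8: "(\<forall>i::8. P i) \<longleftrightarrow> P 1 \<and> P 2 \<and> P 3 \<and> P 4 \<and> P 5 \<and> P 6 \<and> P 7 \<and> P 8"
  by (metis exhaust_8)

lemma vector_8:
  "(vector [a1,a2,a3,a4,a5,a6,a7,a8] :: real^8) $ 1 = a1"
  "(vector [a1,a2,a3,a4,a5,a6,a7,a8] :: real^8) $ 2 = a2"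
  "(vector [a1,a2,a3,a4,a5,a6,a7,a8] :: real^8) $ 3 = a3"
  "(vector [a1,a2,a3,a4,a5,a6,a7,a8] :: real^8) $ 4 = a4"
  "(vector [a1,a2,a3,a4,a5,a6,a7,a8] :: real^8) $ 5 = a5"
  "(vector [a1,a2,a3,a4,a5,a6,a7,a8] :: real^8) $ 6 = a6"
  "(vector [a1,a2,a3,a4,a5,a6,a7,a8] :: real^8) $ 7 = a7"
  "(vector [a1,a2,a3,a4,a5,a6,a7,a8] :: real^8) $ 8 = a8"
  by (simp_all add: vector_def)

lemma vector_8_eqI:
  fixes u v :: "real^8"
  assumes "u $ 1 = v $ 1" "u $ 2 = v $ 2" "u $ 3 = v $ 3" "u $ 4 = v $ 4" "u $ 5 = v $ 5"
    "u $ 6 = v $ 6" "u $ 7 = v $ 7" "u $ 8 = v $ 8"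
  shows "u = v"
  using assms by (simp add: vec_eq_iff forall_8)

lemma vector_8_axis:
  "(vector [a1,a2,a3,a4,a5,a6,a7,a8] :: real^8) = a1 *\<^sub>R axis 1 1 + a2 *\<^sub>R axis 2 1 + a3 *\<^sub>R axis 3 1
    + a4 *\<^sub>R axis 4 1 + a5 *\<^sub>R axis 5 1 + a6 *\<^sub>R axis 6 1 + a7 *\<^sub>R axis 7 1 + a8 *\<^sub>R axis 8 1"
  by (rule vector_8_eqI) (simp_all add: vector_8 axis_def)

lemma smooth_vector_8:
  assumes "smooth f1" "smooth f2" "smooth f3" "smooth f4" "smooth f5" "smooth f6" "smooth f7" "smooth f8"
  shows "smooth (\<lambda>x. vector [f1 x, f2 x, f3 x, f4 x, f5 x, f6 x, f7 x, f8 x] :: real^8)"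
  unfolding vector_8_axis by (intro smooth_add smooth_scaleR smooth_const assms)

lemma has_derivative_vector_8:
  assumes "(f1 has_derivative d1) F" "(f2 has_derivative d2) F" "(f3 has_derivative d3) F" "(f4 has_derivative d4) F"
    "(f5 has_derivative d5) F" "(f6 has_derivative d6) F" "(f7 has_derivative d7) F" "(f8 has_derivative d8) F"
  shows "((\<lambda>x. vector [f1 x, f2 x, f3 x, f4 x, f5 x, f6 x, f7 x, f8 x] :: real^8) has_derivative
    (\<lambda>v. vector [d1 v, d2 v, d3 v, d4 v, d5 v, d6 v, d7 v, d8 v])) F"
  unfolding vector_8_axis by (intro has_derivative_add has_derivative_scaleR_left assms)

lemma smooth_nth: "smooth f \<Longrightarrow> smooth (\<lambda>x. f x $ i)"
  by (rule smooth_linear[OF bounded_linear_vec_nth])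

locale nil_group = nil_coframe +
  fixes G :: "(real^8) monoid" (structure)
  assumes lie: "lie_group G" and invariant: "i \<in> {1..8} \<Longrightarrow> invariant_under G (carrier G) (e i)"
begin

lemma is_group: "group G" and carrier_UNIV: "carrier G = UNIV"
  using lie by (auto simp: lie_group_def)

lemma smooth_left: "smooth (\<lambda>x. h \<otimes> x)"
proof -
  have "bounded_linear (\<lambda>x::real^8. (0::real^8, x))"
    by (intro bounded_linear_Pair bounded_linear_zero bounded_linear_ident)
  then have "smooth (\<lambda>x::real^8. (h, 0) + (0::real^8, x))"
    by (intro smooth_add smooth_const smooth_linear[OF _ smooth_ident])
  then have "smooth (\<lambda>x::real^8. (h, x))" by simp
  moreover have "smooth (\<lambda>(x, y). x \<otimes> y)" using lie by (simp add: lie_group_def)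
  ultimately show ?thesis using smooth_compose[of "\<lambda>(x, y). x \<otimes> y" "\<lambda>x. (h, x)"] by simp
qed

lemma left_invariant:
  assumes "i \<in> {1..8}"
  shows "e i (h \<otimes> x) [frechet_derivative (\<lambda>x. h \<otimes> x) (at x) v] = e i x [v]"
proof -
  have "pullback (\<lambda>x. h \<otimes> x) (e i) x [v] = e i x [v]"
    using invariant[OF assms] by (simp add: invariant_under_def carrier_UNIV)
  then show ?thesis by (simp add: pullback_def)
qed

lemma left_chain:
  assumes "\<And>x. (f has_derivative D x) (at x)"
  shows "((\<lambda>x. f (h \<otimes> x)) has_derivative
    (\<lambda>v. D (h \<otimes> x) (frechet_derivative (\<lambda>x. h \<otimes> x) (at x) v))) (at x)"
  using diff_chain_at[OF smooth_has_derivative[OF smooth_left] assms] by (simp add: o_def)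

theorem global_frame_coordinates:
  assumes a: "a \<noteq> 0" and b: "b \<noteq> 0" and ab: "a + b \<noteq> 0"
  shows "\<exists>w x1 y1 x2 y2 x3 y3 z :: real^8 \<Rightarrow> real.
           global_coordinates [w, x1, y1, x2, y2, x3, y3, z] \<and>
           metric e = sum_of_squares
             [\<lambda>p v. dcoord w p v + c / b * (x1 p / a - y1 p) * dcoord x2 p v
                              + c * (x1 p / a + y1 p) * dcoord y2 p v,
              \<lambda>p v. 1 / a * dcoord x1 p v,
              \<lambda>p v. dcoord y1 p v,
              \<lambda>p v. 1 / b * dcoord x2 p v,
              \<lambda>p v. dcoord y2 p v,
              \<lambda>p v. - 1 / (a + b) * dcoord x3 p v,
              \<lambda>p v. dcoord y3 p v,
              \<lambda>p v. x1 p * dcoord y1 p v + x2 p * dcoord y2 p v + x3 p * dcoord y3 p v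
                    - dcoord z p v]"
proof -
  interpret group G by (rule is_group)
  have closed_e: "ext_d (e i) x [u, v] = 0" if "i \<in> {2..7}" for i x u v
    using that by (simp add: d_e zero_form_def)
  have "\<exists>f. smooth f \<and> f \<one> = 0 \<and> (\<forall>x. (f has_derivative (\<lambda>v. e i x [v])) (at x))" if "i \<in> {2..7}" for i
    by (rule exact_one_form[OF smooth_coframe closed_e[OF that], of \<one>]) (use that in auto)
  then obtain f where f: "\<And>i. i \<in> {2..7} \<Longrightarrow> smooth (f i) \<and> f i \<one> = 0 \<and>
      (\<forall>x. (f i has_derivative (\<lambda>v. e i x [v])) (at x))" by metis
  have sf: "smooth (f 2)" "smooth (f 3)" "smooth (f 4)" "smooth (f 5)" "smooth (f 6)" "smooth (f 7)"
    and f1: "f 2 \<one> = 0" "f 3 \<one> = 0" "f 4 \<one> = 0" "f 5 \<one> = 0" "f 6 \<one> = 0" "f 7 \<one> = 0"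
    and df: "(f 2 has_derivative (\<lambda>v. e 2 x [v])) (at x)" "(f 3 has_derivative (\<lambda>v. e 3 x [v])) (at x)"
      "(f 4 has_derivative (\<lambda>v. e 4 x [v])) (at x)" "(f 5 has_derivative (\<lambda>v. e 5 x [v])) (at x)"
      "(f 6 has_derivative (\<lambda>v. e 6 x [v])) (at x)" "(f 7 has_derivative (\<lambda>v. e 7 x [v])) (at x)" for x
    using f by simp_all
  have se: "smooth_form 1 (e 1)" "smooth_form 1 (e 2)" "smooth_form 1 (e 3)" "smooth_form 1 (e 4)"
    "smooth_form 1 (e 5)" "smooth_form 1 (e 6)" "smooth_form 1 (e 7)" "smooth_form 1 (e 8)"
    by (simp_all add: smooth_coframe)
  have de: "diff_coeffs (e 1)" "diff_coeffs (e 3)" "diff_coeffs (e 4)" "diff_coeffs (e 5)"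
    "diff_coeffs (e 7)" "diff_coeffs (e 8)"
    by (simp_all add: diff_coeffs_e)
  \<comment> \<open>\<zeta> and \<omega> are \<open>- e 8\<close> and \<open>e 1\<close> corrected
    by primitives times closed forms whose derivatives cancel the structure equations. Their
    primitives become the coordinates z and w.\<close>
  define \<zeta> where "\<zeta> x vs = (a * f 2 x) * e 3 x vs + (b * f 4 x) * e 5 x vs
      + (- (a + b) * f 6 x) * e 7 x vs + (- 1) * e 8 x vs" for x vs
  define \<omega> where "\<omega> x vs = e 1 x vs + (- c * (f 2 x - f 3 x)) * e 4 x vs
      + (- c * (f 2 x + f 3 x)) * e 5 x vs" for x vs
  have s\<zeta>: "smooth_form 1 \<zeta>" unfolding \<zeta>_def
    by (intro smooth_form_add smooth_form_fun_mult smooth_mult smooth_const sf se)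
  have s\<omega>: "smooth_form 1 \<omega>" unfolding \<omega>_def
    by (intro smooth_form_add smooth_form_fun_mult smooth_mult smooth_add smooth_diff smooth_const sf se)
  note dc_mult = smooth_form_diff_coeffs[OF smooth_form_fun_mult]
  have dcs: "diff_coeffs (\<lambda>x vs. (a * f 2 x) * e 3 x vs)" "diff_coeffs (\<lambda>x vs. (b * f 4 x) * e 5 x vs)"
    "diff_coeffs (\<lambda>x vs. (- (a + b) * f 6 x) * e 7 x vs)" "diff_coeffs (\<lambda>x vs. (- 1) * e 8 x vs)"
    "diff_coeffs (\<lambda>x vs. (- c * (f 2 x - f 3 x)) * e 4 x vs)"
    "diff_coeffs (\<lambda>x vs. (- c * (f 2 x + f 3 x)) * e 5 x vs)"
    by (rule dc_mult[OF _ se(3)] dc_mult[OF _ se(5)] dc_mult[OF _ se(7)] dc_mult[OF _ se(8)] dc_mult[OF _ se(4)];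
      intro smooth_mult smooth_add smooth_diff smooth_const sf)+
  have "ext_d \<zeta> x [u, v] = 0" for x u v
  proof -
    have 1: "ext_d (\<lambda>x vs. (a * f 2 x) * e 3 x vs) x [u, v] = a * e 2 x [u] * e 3 x [v] - a * e 2 x [v] * e 3 x [u]"
      using ext_d_fun_mult[OF de(2) has_derivative_mult_right[OF df(1)[of x]], of a u v] closed_e[of 3] by simp
    have 2: "ext_d (\<lambda>x vs. (b * f 4 x) * e 5 x vs) x [u, v] = b * e 4 x [u] * e 5 x [v] - b * e 4 x [v] * e 5 x [u]"
      using ext_d_fun_mult[OF de(4) has_derivative_mult_right[OF df(3)[of x]], of b u v] closed_e[of 5] by simp
    have 3: "ext_d (\<lambda>x vs. (- (a + b) * f 6 x) * e 7 x vs) x [u, v] =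
        - (a + b) * e 6 x [u] * e 7 x [v] - - (a + b) * e 6 x [v] * e 7 x [u]"
      using ext_d_fun_mult[OF de(5) has_derivative_mult_right[OF df(5)[of x]], of "- (a + b)" u v] closed_e[of 7] by simp
    have 4: "ext_d (\<lambda>x vs. (- 1) * e 8 x vs) x [u, v] = - 1 * W8 x [u, v]"
      by (subst ext_d_scale) (simp_all add: de d_e8)
    have "ext_d \<zeta> x [u, v] = ext_d (\<lambda>x vs. (a * f 2 x) * e 3 x vs) x [u, v]
      + ext_d (\<lambda>x vs. (b * f 4 x) * e 5 x vs) x [u, v] + ext_d (\<lambda>x vs. (- (a + b) * f 6 x) * e 7 x vs) x [u, v]
      + ext_d (\<lambda>x vs. (- 1) * e 8 x vs) x [u, v]"
      unfolding \<zeta>_def by (simp only: ext_d_add diff_coeffs_add dcs)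
    then show ?thesis unfolding 1 2 3 4 by (simp add: comb_simps emon_pair_eval algebra_simps)
  qed
  from exact_one_form[OF s\<zeta> this, of \<one>] obtain z0 where z0: "smooth z0" "z0 \<one> = 0"
    "\<And>x. (z0 has_derivative (\<lambda>v. \<zeta> x [v])) (at x)" by blast
  have "ext_d \<omega> x [u, v] = 0" for x u v
  proof -
    have 1: "ext_d (\<lambda>x vs. (- c * (f 2 x - f 3 x)) * e 4 x vs) x [u, v] =
        - c * (e 2 x [u] - e 3 x [u]) * e 4 x [v] - - c * (e 2 x [v] - e 3 x [v]) * e 4 x [u]"
      using ext_d_fun_mult[OF de(3) has_derivative_mult_right[OF has_derivative_diff[OF df(1)[of x] df(2)]], of "- c" u v]
        closed_e[of 4] by simp
    have 2: "ext_d (\<lambda>x vs. (- c * (f 2 x + f 3 x)) * e 5 x vs) x [u, v] =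
        - c * (e 2 x [u] + e 3 x [u]) * e 5 x [v] - - c * (e 2 x [v] + e 3 x [v]) * e 5 x [u]"
      using ext_d_fun_mult[OF de(4) has_derivative_mult_right[OF has_derivative_add[OF df(1)[of x] df(2)]], of "- c" u v]
        closed_e[of 5] by simp
    have "ext_d \<omega> x [u, v] = ext_d (e 1) x [u, v]
      + ext_d (\<lambda>x vs. (- c * (f 2 x - f 3 x)) * e 4 x vs) x [u, v]
      + ext_d (\<lambda>x vs. (- c * (f 2 x + f 3 x)) * e 5 x vs) x [u, v]"
      unfolding \<omega>_def by (simp only: ext_d_add diff_coeffs_add dcs de)
    then show ?thesis unfolding 1 2 d_e1 by (simp add: comb_simps emon_pair_eval algebra_simps)
  qed
  from exact_one_form[OF s\<omega> this, of \<one>] obtain w where w: "smooth w" "w \<one> = 0"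
    "\<And>x. (w has_derivative (\<lambda>v. \<omega> x [v])) (at x)" by blast
  define x1 y1 x2 y2 x3 y3
    where "x1 p = a * f 2 p" and "y1 p = f 3 p" and "x2 p = b * f 4 p" and "y2 p = f 5 p"
      and "x3 p = - (a + b) * f 6 p" and "y3 p = f 7 p" for p
  note xy_def = x1_def y1_def x2_def y2_def x3_def y3_def
  have dx: "(x1 has_derivative (\<lambda>v. a * e 2 x [v])) (at x)" "(x2 has_derivative (\<lambda>v. b * e 4 x [v])) (at x)"
    "(x3 has_derivative (\<lambda>v. - (a + b) * e 6 x [v])) (at x)"
    and dy: "(y1 has_derivative (\<lambda>v. e 3 x [v])) (at x)" "(y2 has_derivative (\<lambda>v. e 5 x [v])) (at x)"
    "(y3 has_derivative (\<lambda>v. e 7 x [v])) (at x)" for x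
    unfolding xy_def by (intro has_derivative_mult_right df)+
  \<comment> \<open>By left invariance both sides have the same differential in x, and they agree at
    the unit. The twisted laws for z and w follow in the same way.\<close>
  have f_hom: "f i (h \<otimes> x) = f i h + f i x" if i: "i \<in> {2..7}" for i h x
  proof (rule has_derivative_eq[where p = \<one> and D = "\<lambda>x v. e i x [v]"])
    have i8: "i \<in> {1..8}" using i by simp
    show "((\<lambda>x. f i (h \<otimes> x)) has_derivative (\<lambda>v. e i x [v])) (at x)" for x
      using left_chain[of "f i" "\<lambda>x v. e i x [v]" h x] f[OF i] left_invariant[OF i8] by simp
    show "((\<lambda>x. f i h + f i x) has_derivative (\<lambda>v. e i x [v])) (at x)" for x
      using has_derivative_add[OF has_derivative_const, of "f i" "\<lambda>v. e i x [v]" "at x" "f i h"] f[OF i] by simp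
    show "f i (h \<otimes> \<one>) = f i h + f i \<one>" using f[OF i] by (simp add: carrier_UNIV)
  qed
  have z_hom: "z0 (h \<otimes> x) = z0 h + z0 x + x1 h * y1 x + x2 h * y2 x + x3 h * y3 x" for h x
  proof (rule has_derivative_eq[where p = \<one>
        and D = "\<lambda>x v. \<zeta> x [v] + x1 h * e 3 x [v] + x2 h * e 5 x [v] + x3 h * e 7 x [v]"])
    show "((\<lambda>x. z0 (h \<otimes> x)) has_derivative
        (\<lambda>v. \<zeta> x [v] + x1 h * e 3 x [v] + x2 h * e 5 x [v] + x3 h * e 7 x [v])) (at x)" for x
      using left_chain[of z0 "\<lambda>x v. \<zeta> x [v]" h x, OF z0(3)]
      by (simp add: \<zeta>_def left_invariant f_hom xy_def algebra_simps)
    show "((\<lambda>x. z0 h + z0 x + x1 h * y1 x + x2 h * y2 x + x3 h * y3 x) has_derivative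
        (\<lambda>v. \<zeta> x [v] + x1 h * e 3 x [v] + x2 h * e 5 x [v] + x3 h * e 7 x [v])) (at x)" for x
      using has_derivative_add[OF has_derivative_add[OF has_derivative_add[OF has_derivative_add[OF
        has_derivative_const[of "z0 h"] z0(3)] has_derivative_mult_right[OF dy(1), of "x1 h"]]
        has_derivative_mult_right[OF dy(2), of "x2 h"]] has_derivative_mult_right[OF dy(3), of "x3 h"], of x]
      by simp
  qed (simp add: carrier_UNIV z0 xy_def f1)
  have w_hom: "w (h \<otimes> x) = w h + w x - c * (f 2 h - f 3 h) * f 4 x - c * (f 2 h + f 3 h) * f 5 x" for h x
  proof (rule has_derivative_eq[where p = \<one>
        and D = "\<lambda>x v. \<omega> x [v] - c * (f 2 h - f 3 h) * e 4 x [v] - c * (f 2 h + f 3 h) * e 5 x [v]"])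
    show "((\<lambda>x. w (h \<otimes> x)) has_derivative
        (\<lambda>v. \<omega> x [v] - c * (f 2 h - f 3 h) * e 4 x [v] - c * (f 2 h + f 3 h) * e 5 x [v])) (at x)" for x
      using left_chain[of w "\<lambda>x v. \<omega> x [v]" h x, OF w(3)]
      by (simp add: \<omega>_def left_invariant f_hom algebra_simps)
    show "((\<lambda>x. w h + w x - c * (f 2 h - f 3 h) * f 4 x - c * (f 2 h + f 3 h) * f 5 x) has_derivative
        (\<lambda>v. \<omega> x [v] - c * (f 2 h - f 3 h) * e 4 x [v] - c * (f 2 h + f 3 h) * e 5 x [v])) (at x)" for x
      using has_derivative_diff[OF has_derivative_diff[OF has_derivative_add[OF
        has_derivative_const[of "w h"] w(3)] has_derivative_mult_right[OF df(3), of "c * (f 2 h - f 3 h)"]]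
        has_derivative_mult_right[OF df(4), of "c * (f 2 h + f 3 h)"], of x]
      by simp
  qed (simp add: carrier_UNIV w f1)
  define \<psi> :: "real^8 \<Rightarrow> real^8" where "\<psi> p = vector [w p, x1 p, y1 p, x2 p, y2 p, x3 p, y3 p, z0 p]" for p
  have sxy: "smooth x1" "smooth y1" "smooth x2" "smooth y2" "smooth x3" "smooth y3"
    unfolding xy_def[abs_def] by (intro smooth_mult smooth_const sf)+
  have s\<psi>: "smooth \<psi>" unfolding \<psi>_def[abs_def] by (intro smooth_vector_8 sxy w z0)
  have \<psi>1: "\<psi> \<one> = 0" by (rule vector_8_eqI) (simp_all add: \<psi>_def vector_8 xy_def f1 w z0)
  define D\<psi> :: "real^8 \<Rightarrow> real^8 \<Rightarrow> real^8" where
    "D\<psi> x v = vector [\<omega> x [v], a * e 2 x [v], e 3 x [v], b * e 4 x [v], e 5 x [v], - (a + b) * e 6 x [v], e 7 x [v], \<zeta> x [v]]" for x v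
  have d\<psi>: "(\<psi> has_derivative D\<psi> x) (at x)" for x
    unfolding \<psi>_def[abs_def] D\<psi>_def by (intro has_derivative_vector_8 dx dy w z0)
  \<comment> \<open>The coframe components of the vector with coordinate velocity v at a point with
    coordinates q. Thus \<open>R\<close> below inverts the derivative of \<psi>.\<close>
  define \<theta> :: "real^8 \<Rightarrow> real^8 \<Rightarrow> nat \<Rightarrow> real" where
    "\<theta> q v k = (if k = 1 then v $ 1 + c * (q $ 2 / a - q $ 3) * (v $ 4 / b) + c * (q $ 2 / a + q $ 3) * v $ 5
      else if k = 2 then v $ 2 / a else if k = 3 then v $ 3 else if k = 4 then v $ 4 / b else if k = 5 then v $ 5
      else if k = 6 then - v $ 6 / (a + b) else if k = 7 then v $ 7
      else q $ 2 * v $ 3 + q $ 4 * v $ 5 + q $ 6 * v $ 7 - v $ 8)" for q v k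
  define R where "R q p v = (\<Sum>k=1..8. \<theta> q v k *\<^sub>R E k p)" for q p v
  have eR: "e i p [R q p v] = \<theta> q v i" if "i \<in> {1..8}" for i p q v
    unfolding R_def by (rule e_sum_frame[OF that])
  have linR: "linear (R q p)" for q p
    unfolding R_def
    by (rule linearI) (simp_all add: \<theta>_def sum_1_8 algebra_simps add_divide_distrib diff_divide_distrib)
  have DR: "D\<psi> p (R (\<psi> p) p v) = v" for p v
    by (rule vector_8_eqI)
      (simp_all add: D\<psi>_def vector_8 \<omega>_def \<zeta>_def eR \<theta>_def \<psi>_def xy_def a b ab field_simps)
  have linD: "linear (D\<psi> x)" for x using d\<psi> has_derivative_linear by blast
  have RD: "R (\<psi> p) p (D\<psi> p v) = v" for p v
    using linear_inverse_left[OF linR linD, of "\<psi> p" p p] DR by (auto simp: fun_eq_iff)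
  \<comment> \<open>The group law in coordinates, read off from the addition laws above;
    \<open>L\<close> is its left division.\<close>
  define M :: "real^8 \<Rightarrow> real^8 \<Rightarrow> real^8" where "M p q = vector [
    p $ 1 + q $ 1 - c * (p $ 2 / a - p $ 3) * (q $ 4 / b) - c * (p $ 2 / a + p $ 3) * q $ 5,
    p $ 2 + q $ 2, p $ 3 + q $ 3, p $ 4 + q $ 4, p $ 5 + q $ 5, p $ 6 + q $ 6, p $ 7 + q $ 7,
    p $ 8 + q $ 8 + p $ 2 * q $ 3 + p $ 4 * q $ 5 + p $ 6 * q $ 7]" for p q
  define L :: "real^8 \<Rightarrow> real^8 \<Rightarrow> real^8" where "L p q = vector [
    q $ 1 - p $ 1 + c * (p $ 2 / a - p $ 3) * ((q $ 4 - p $ 4) / b) + c * (p $ 2 / a + p $ 3) * (q $ 5 - p $ 5),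
    q $ 2 - p $ 2, q $ 3 - p $ 3, q $ 4 - p $ 4, q $ 5 - p $ 5, q $ 6 - p $ 6, q $ 7 - p $ 7,
    q $ 8 - p $ 8 - p $ 2 * (q $ 3 - p $ 3) - p $ 4 * (q $ 5 - p $ 5) - p $ 6 * (q $ 7 - p $ 7)]" for p q
  have hom: "\<psi> (h \<otimes> x) = M (\<psi> h) (\<psi> x)" for h x
    by (rule vector_8_eqI)
      (simp_all add: \<psi>_def M_def vector_8 w_hom z_hom xy_def f_hom a b algebra_simps)
  define f' where "f' x = Blinfun (D\<psi> x)" for x
  have f': "blinfun_apply (f' x) = D\<psi> x" for x
    unfolding f'_def by (rule bounded_linear_Blinfun_apply) (use linD linear_conv_bounded_linear in blast)
  have Rb: "blinfun_apply (Blinfun (R (\<psi> \<one>) \<one>)) = R (\<psi> \<one>) \<one>"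
    by (rule bounded_linear_Blinfun_apply) (use linR linear_conv_bounded_linear in blast)
  have D_frechet: "D\<psi> x v = frechet_derivative \<psi> (at x) v" for x v
    using frechet_derivativeI[OF d\<psi>] by simp
  have contf': "continuous_on UNIV f'"
    by (rule continuous_on_blinfun_componentwise)
      (simp add: f' D_frechet smooth_continuous[OF smooth_frechet[OF s\<psi>]])
  have invf: "Blinfun (R (\<psi> \<one>) \<one>) o\<^sub>L f' \<one> = id_blinfun"
    by (rule blinfun_eqI) (simp add: Rb f' RD)
  obtain U V g where UV: "open U" "\<one> \<in> U" "open V" "homeomorphism U V \<psi> g"
  proof (rule inverse_function_theorem[OF open_UNIV _ contf' UNIV_I invf])
    show "(\<psi> has_derivative blinfun_apply (f' x)) (at x)" for x using d\<psi> by (simp add: f')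
  qed (rule that)
  have bij: "bij \<psi> \<and> continuous_on UNIV (inv_into UNIV \<psi>)"
  proof (rule local_isomorphism_bij[OF is_group carrier_UNIV smooth_continuous[OF smooth_left] hom _ _ _ _ _ _
        smooth_continuous[OF s\<psi>] UV])
    show "M p (\<psi> \<one>) = p" for p by (rule vector_8_eqI) (simp_all add: \<psi>1 M_def vector_8)
    show "L p (M p q) = q" for p q
      by (rule vector_8_eqI) (simp_all add: L_def M_def vector_8 algebra_simps)
    show "M p (L p q) = q" for p q
      by (rule vector_8_eqI) (simp_all add: L_def M_def vector_8 algebra_simps)
    show "p = p'" if "M p q = M p' q" for p p' q
    proof -
      have eq: "M p q $ i = M p' q $ i" for i using that by simp
      have e2: "p $ 2 = p' $ 2" "p $ 3 = p' $ 3" "p $ 4 = p' $ 4" "p $ 5 = p' $ 5" "p $ 6 = p' $ 6" "p $ 7 = p' $ 7"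
        using eq[of 2] eq[of 3] eq[of 4] eq[of 5] eq[of 6] eq[of 7] by (simp_all add: M_def vector_8)
      with eq[of 1] eq[of 8] show ?thesis by (intro vector_8_eqI) (simp_all add: M_def vector_8)
    qed
    show "continuous_on UNIV (M p)" for p
      unfolding M_def[abs_def]
      by (intro smooth_continuous smooth_vector_8 smooth_add smooth_diff smooth_mult smooth_const
        smooth_nth smooth_ident smooth_linear[OF bounded_linear_divide])
    show "continuous_on UNIV (L p)" for p
      unfolding L_def[abs_def]
      by (intro smooth_continuous smooth_vector_8 smooth_add smooth_diff smooth_mult smooth_const
        smooth_nth smooth_ident smooth_linear[OF bounded_linear_divide])
  qed
  define \<rho> where "\<rho> = inv_into UNIV \<psi>"
  have \<rho>: "\<psi> (\<rho> q) = q" for q using bij by (simp add: \<rho>_def bij_is_surj surj_f_inv_f)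
  have cont\<rho>: "continuous_on UNIV \<rho>" using bij by (simp add: \<rho>_def)
  have d\<rho>: "(\<rho> has_derivative R q (\<rho> q)) (at q)" for q
  proof (rule has_derivative_inverse_basic[OF d\<psi>, where T = UNIV])
    show "bounded_linear (R q (\<rho> q))" using linR linear_conv_bounded_linear by blast
    show "R q (\<rho> q) \<circ> D\<psi> (\<rho> q) = id" using RD[of "\<rho> q"] by (simp add: fun_eq_iff \<rho>)
    show "continuous (at q) \<rho>" using cont\<rho> by (simp add: continuous_on_eq_continuous_at)
  qed (simp_all add: \<rho>)
  have s\<theta>: "smooth (\<lambda>q. \<theta> q v k)" for v k
    unfolding \<theta>_def
    by (cases "k = 1"; cases "k = 2"; cases "k = 3"; cases "k = 4"; cases "k = 5"; cases "k = 6"; cases "k = 7"; simp;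
      intro smooth_add smooth_diff smooth_mult smooth_const smooth_nth smooth_ident
        smooth_linear[OF bounded_linear_divide])
  \<comment> \<open>Bootstrapping: the derivative of \<rho> combines the smooth coefficients
    \<theta> with the frame evaluated along \<rho>, so each order of differentiability yields the
    next.\<close>
  have "Ck k \<rho>" for k
  proof (induction k)
    case 0
    then show ?case using cont\<rho> by simp
  next
    case (Suc k)
    show ?case
    proof (rule Ck_SucI[OF d\<rho>])
      show "Ck k (\<lambda>q. R q (\<rho> q) v)" for v
        unfolding R_def
        using s\<theta> smooth_E Suc by (intro Ck_sum Ck_scaleR Ck_compose[OF _ Suc]) (simp_all add: smooth_def)
    qed
  qed
  then have "smooth \<rho>" by (simp add: smooth_def)
  with bij s\<psi> have "global_coordinates [w, x1, y1, x2, y2, x3, y3, z0]"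
    by (simp add: global_coordinates_def Let_def \<psi>_def[abs_def] \<rho>_def)
  moreover have dc: "dcoord w p v = \<omega> p [v]" "dcoord x1 p v = a * e 2 p [v]" "dcoord y1 p v = e 3 p [v]"
    "dcoord x2 p v = b * e 4 p [v]" "dcoord y2 p v = e 5 p [v]" "dcoord x3 p v = - (a + b) * e 6 p [v]"
    "dcoord y3 p v = e 7 p [v]" "dcoord z0 p v = \<zeta> p [v]" for p v
    unfolding dcoord_def by (rule frechet_derivativeI, rule dx dy w z0)+
  have co: "dcoord w p v + c / b * (x1 p / a - y1 p) * dcoord x2 p v + c * (x1 p / a + y1 p) * dcoord y2 p v = e 1 p [v]"
    "1 / a * dcoord x1 p v = e 2 p [v]" "1 / b * dcoord x2 p v = e 4 p [v]" "- 1 / (a + b) * dcoord x3 p v = e 6 p [v]"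
    "x1 p * dcoord y1 p v + x2 p * dcoord y2 p v + x3 p * dcoord y3 p v - dcoord z0 p v = e 8 p [v]" for p v
    using a b ab by (simp_all add: dc \<omega>_def \<zeta>_def xy_def field_simps)
  have "metric e = sum_of_squares
             [\<lambda>p v. dcoord w p v + c / b * (x1 p / a - y1 p) * dcoord x2 p v
                              + c * (x1 p / a + y1 p) * dcoord y2 p v,
              \<lambda>p v. 1 / a * dcoord x1 p v, \<lambda>p v. dcoord y1 p v, \<lambda>p v. 1 / b * dcoord x2 p v,
              \<lambda>p v. dcoord y2 p v, \<lambda>p v. - 1 / (a + b) * dcoord x3 p v, \<lambda>p v. dcoord y3 p v,
              \<lambda>p v. x1 p * dcoord y1 p v + x2 p * dcoord y2 p v + x3 p * dcoord y3 p v - dcoord z0 p v]"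
    unfolding co by (simp add: fun_eq_iff metric_def sum_of_squares_def sum_1_8 dc)
  ultimately show ?thesis by blast
qed

end

section \<open>The compact quotient\<close>

text \<open>The projection maps the compact set K onto all cosets. First the defining predicate is
  shown to be a topology, since \<open>topology\<close> determines the open sets only for such
  predicates.\<close>

lemma compact_quotient_space:
  assumes G: "group G" "carrier G = UNIV" and \<Gamma>: "max_rank_lattice G \<Gamma>"
  shows "compact_space (quotient_space G \<Gamma>)"
proof -
  interpret group G by (rule G)
  have sub: "subgroup \<Gamma> G" using \<Gamma> by (simp add: max_rank_lattice_def)
  obtain K where K: "compact K" "carrier G = \<Gamma> <#>\<^bsub>G\<^esub> K"
    using \<Gamma> by (auto simp: max_rank_lattice_def)
  let ?P = "\<lambda>U. U \<subseteq> rcosets\<^bsub>G\<^esub> \<Gamma> \<and> open {x \<in> carrier G. \<Gamma> #>\<^bsub>G\<^esub> x \<in> U}"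
  have "istopology ?P"
    unfolding istopology_def
  proof (intro conjI allI impI)
    fix S T assume "?P S" "?P T"
    moreover have "{x \<in> carrier G. \<Gamma> #>\<^bsub>G\<^esub> x \<in> S \<inter> T} =
        {x \<in> carrier G. \<Gamma> #>\<^bsub>G\<^esub> x \<in> S} \<inter> {x \<in> carrier G. \<Gamma> #>\<^bsub>G\<^esub> x \<in> T}" by blast
    ultimately show "S \<inter> T \<subseteq> rcosets\<^bsub>G\<^esub> \<Gamma>" "open {x \<in> carrier G. \<Gamma> #>\<^bsub>G\<^esub> x \<in> S \<inter> T}"
      by (auto simp only: open_Int)
  next
    fix \<U> assume \<U>: "\<forall>U\<in>\<U>. ?P U"
    have "{x \<in> carrier G. \<Gamma> #>\<^bsub>G\<^esub> x \<in> \<Union>\<U>} = (\<Union>U\<in>\<U>. {x \<in> carrier G. \<Gamma> #>\<^bsub>G\<^esub> x \<in> U})" by blast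
    moreover have "open (\<Union>U\<in>\<U>. {x \<in> carrier G. \<Gamma> #>\<^bsub>G\<^esub> x \<in> U})" using \<U> by (intro open_UN) blast
    ultimately show "open {x \<in> carrier G. \<Gamma> #>\<^bsub>G\<^esub> x \<in> \<Union>\<U>}" by simp
    show "\<Union>\<U> \<subseteq> rcosets\<^bsub>G\<^esub> \<Gamma>" using \<U> by blast
  qed
  then have op: "openin (quotient_space G \<Gamma>) = ?P"
    unfolding quotient_space_def by (rule topology_inverse')
  have coset: "\<Gamma> #>\<^bsub>G\<^esub> x \<in> rcosets\<^bsub>G\<^esub> \<Gamma>" for x
    using G(2) by (auto simp: RCOSETS_def)
  have "?P (rcosets\<^bsub>G\<^esub> \<Gamma>)" using coset G(2) by simp
  then have top: "topspace (quotient_space G \<Gamma>) = rcosets\<^bsub>G\<^esub> \<Gamma>"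
    unfolding topspace_def op by blast
  have "continuous_map euclidean (quotient_space G \<Gamma>) (\<lambda>x. \<Gamma> #>\<^bsub>G\<^esub> x)"
    unfolding continuous_map_def top op using coset G(2) by simp
  then have "compactin (quotient_space G \<Gamma>) ((\<lambda>x. \<Gamma> #>\<^bsub>G\<^esub> x) ` K)"
    using K(1) by (intro image_compactin[of euclidean]) simp_all
  moreover have "(\<lambda>x. \<Gamma> #>\<^bsub>G\<^esub> x) ` K = rcosets\<^bsub>G\<^esub> \<Gamma>"
  proof (intro equalityI subsetI)
    fix C assume "C \<in> rcosets\<^bsub>G\<^esub> \<Gamma>"
    then obtain x where x: "x \<in> carrier G" "C = \<Gamma> #>\<^bsub>G\<^esub> x" by (auto simp: RCOSETS_def)
    then obtain h k where "h \<in> \<Gamma>" "k \<in> K" "x = h \<otimes>\<^bsub>G\<^esub> k" unfolding K(2) set_mult_def by auto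
    then have "x \<in> \<Gamma> #>\<^bsub>G\<^esub> k" by (auto simp: r_coset_def)
    then have "\<Gamma> #>\<^bsub>G\<^esub> k = C"
      unfolding x(2) using repr_independence sub G(2) by blast
    then show "C \<in> (\<lambda>x. \<Gamma> #>\<^bsub>G\<^esub> x) ` K" using \<open>k \<in> K\<close> by blast
  qed (use coset in auto)
  ultimately show ?thesis by (simp add: compact_space_def top)
qed

context nil_group begin

lemma invariant_ecomb: "index_le8 cs \<Longrightarrow> invariant_under G S (ecomb e cs)"
  unfolding invariant_under_def
proof
  fix h assume cs: "index_le8 cs"
  show "pullback (\<lambda>x. h \<otimes> x) (ecomb e cs) = ecomb e cs"
  proof (rule pullback_ecomb)
    fix r "is" i assume "(r, is) \<in> set cs" "i \<in> set is"
    with bspec[OF cs[unfolded index_le8_def], of "(r, is)"] have "i \<in> {1..8}" by auto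
    then show "pullback (\<lambda>x. h \<otimes> x) (e i) = e i"
      using invariant by (simp add: invariant_under_def carrier_UNIV)
  qed
qed

lemma invariant_e: "i \<in> {1..8} \<Longrightarrow> invariant_under G S (e i)"
  using invariant by (simp add: invariant_under_def carrier_UNIV)

lemma invariant_block_conn: "invariant_under G S (block_conn e p q s i j)"
  using invariant_e[of 1 S] invariant_e[of 8 S]
  by (simp add: invariant_under_def pullback_def block_conn_def fun_eq_iff)

end

locale nil_quotient = nil_spin + nil_group +
  fixes \<Gamma> :: "(real^8) set" and \<sigma> :: conn_forms
  assumes lattice: "max_rank_lattice G \<Gamma>" and lc: "levi_civita e E \<sigma>"
begin

lemma compact_killing:
  "compact_killing_solution G \<Gamma> \<gamma> e E \<sigma> (Phi_form e) \<phi>0 T (A_conn e l m)"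
  unfolding compact_killing_solution_def
proof (intro conjI ballI)
  show "compact_space (quotient_space G \<Gamma>)"
    by (rule compact_quotient_space[OF is_group carrier_UNIV lattice])
  show "invariant_under G \<Gamma> (Phi_form e)"
    unfolding Phi_form_eq by (rule invariant_ecomb) (simp add: Phi_comb_def)
  show "invariant_under G \<Gamma> T"
    by (rule invariant_ecomb) (simp add: torsion_comb_def)
  show "invariant_under G \<Gamma> (add_torsion E \<sigma> T i j)" if "i \<in> {1..8}" "j \<in> {1..8}" for i j
    unfolding add_torsion_eq[OF lc that] by (rule invariant_block_conn)
  show "invariant_under G \<Gamma> (A_conn e l m i j)" for i j
    unfolding A_conn_eq by (rule invariant_block_conn)
qed (simp_all add: invariant_e killing_spinor[OF lc] balanced torsion_eq instanton)

end

theorem theorem5p13: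
  fixes a b c \<phi>0 :: real
    and G :: "(real^8) monoid"
    and \<Gamma> :: "(real^8) set"
    and e :: "nat \<Rightarrow> diff_form"
    and E :: "nat \<Rightarrow> real^8 \<Rightarrow> real^8"
    and \<sigma>g :: conn_forms
    and \<gamma> :: "nat \<Rightarrow> real^16^16"
    and \<Phi> T :: diff_form
  assumes "a \<noteq> 0" and "b \<noteq> 0" and "a + b \<noteq> 0"
    and "lie_group G" and "nilpotent_group G"
    and "\<And>i. i \<in> {1..8} \<Longrightarrow> smooth_form 1 (e i) \<and> invariant_under G (carrier G) (e i)"
    and "dual_frame e E"
    and "ext_d (e 1) = ecomb e [(c, [2,4]), (c, [2,5]), (- c, [3,4]), (c, [3,5])]"
    and "\<And>i. i \<in> {2..7} \<Longrightarrow> ext_d (e i) = zero_form"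
    and "ext_d (e 8) = ecomb e [(a, [2,3]), (b, [4,5]), (- (a + b), [6,7])]"
    and "max_rank_lattice G \<Gamma>"
    and "levi_civita e E \<sigma>g"
    and "clifford_rep \<gamma>"
    and "\<Phi> = Phi_form e"
    and "T = hodge e E (ext_d \<Phi>)"
  shows
    "balanced e E \<Phi>
     \<and>
     (\<forall>l m :: real.
        (l, m) \<noteq> (0, 0) \<and> 3 * l\<^sup>2 < a\<^sup>2 + a * b + b\<^sup>2 \<and>
        3 * l\<^sup>2 - 2 * m\<^sup>2 = a\<^sup>2 + a * b + b\<^sup>2 - 2 * c\<^sup>2 \<longrightarrow>
        compact_killing_solution G \<Gamma> \<gamma> e E \<sigma>g \<Phi> \<phi>0 T (A_conn e l m) \<and>
        anomaly_cancellation E \<sigma>g T (A_conn e l m) (2 / (a\<^sup>2 + a * b + b\<^sup>2 - 3 * l\<^sup>2)))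
     \<and>
     (\<forall>l m :: real.
        a = b \<and> (l, m) \<noteq> (0, 0) \<and> l\<^sup>2 < a\<^sup>2 \<and> 3 * l\<^sup>2 - 2 * m\<^sup>2 = 3 * a\<^sup>2 - 2 * c\<^sup>2 \<longrightarrow>
        (let \<alpha>' = 2 / (a\<^sup>2 + a * b + b\<^sup>2 - 3 * l\<^sup>2) in
          compact_killing_solution G \<Gamma> \<gamma> e E \<sigma>g \<Phi> \<phi>0 T (A_conn e l m) \<and>
          anomaly_cancellation E \<sigma>g T (A_conn e l m) \<alpha>' \<and>
          heterotic_eom E \<sigma>g T (A_conn e l m) (\<alpha>' / 2)))
     \<and>
     (a = b \<longrightarrow>
        (\<exists>w x1 y1 x2 y2 x3 y3 z :: real^8 \<Rightarrow> real.
           global_coordinates [w, x1, y1, x2, y2, x3, y3, z] \<and>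
           metric e = sum_of_squares
             [\<lambda>p v. dcoord w p v + c / b * (x1 p / a - y1 p) * dcoord x2 p v
                              + c * (x1 p / a + y1 p) * dcoord y2 p v,
              \<lambda>p v. 1 / a * dcoord x1 p v,
              \<lambda>p v. dcoord y1 p v,
              \<lambda>p v. 1 / b * dcoord x2 p v,
              \<lambda>p v. dcoord y2 p v,
              \<lambda>p v. - 1 / (a + b) * dcoord x3 p v,
              \<lambda>p v. dcoord y3 p v,
              \<lambda>p v. x1 p * dcoord y1 p v + x2 p * dcoord y2 p v + x3 p * dcoord y3 p v
                    - dcoord z p v]))"
proof -
  interpret nil_quotient e E a b c \<gamma> G \<Gamma> \<sigma>g
    by unfold_locales (use assms in \<open>simp_all add: d1_comb_def d8_comb_def\<close>)
  have T: "T = ecomb e (torsion_comb a b c)" using assms(14,15) torsion_eq by simp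
  note bal = balanced[folded assms(14)]
  note killing = compact_killing[of \<phi>0, folded T assms(14)]
  note anomaly = anomaly[OF lc, folded T]
  note eom = equations_of_motion[OF lc, folded T]
  note coordinates = global_frame_coordinates[OF assms(1-3)]
  \<comment> \<open>For a = b the general conditions on l and m reduce to these, as the quadratic
    form becomes 3 a^2.\<close>
  have anomaly': "anomaly_cancellation E \<sigma>g T (A_conn e l m) (2 / (a\<^sup>2 + a * b + b\<^sup>2 - 3 * l\<^sup>2))"
    if "a = b" "l\<^sup>2 < a\<^sup>2" "3 * l\<^sup>2 - 2 * m\<^sup>2 = 3 * a\<^sup>2 - 2 * c\<^sup>2" for l m
    using that by (intro anomaly) (simp_all add: power2_eq_square)
  show ?thesis
    unfolding Let_def
    by (intro conjI allI impI; (elim conjE)?;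
      (rule bal killing coordinates | (rule anomaly; assumption) | (rule anomaly'; assumption) | (rule eom; assumption)))
qed

end
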